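(* Let $H$ be a sequent calculus. (i) If $H$ is single-conclusion, $H$ extends $\mathbf{FL_e}$ (resp. $\mathbf{FL_e}^-$), and $H$ consists only of semi-analytic rules and focused axioms (resp. context-free focused axioms), then $H$ has $H$-feasible interpolation. (ii) If $H$ is single-conclusion, $H$ extends $\mathbf{IPC}$, and $H$ consists only of semi-analytic rules, context-sharing semi-analytic rules and focused axioms, then $H$ has $H$-feasible interpolation. (iii) If $H$ is multi-conclusion, $H$ extends $\mathbf{CFL_e}$ (resp. $\mathbf{CFL_e}^-$), and $H$ consists only of (multi-conclusion) semi-analytic rules and focused axioms (resp. context-free focused axioms), then $H$ has $H$-feasible interpolation.
   Context: Formulas are built from atoms in a fixed propositional language containing $\wedge,\vee,\to,*$ (fusion), constants $0,1,\top,\bot$ and possibly further connectives (e.g. a modality $\Box$); in the multi-conclusion setting it also contains $+$ (addition). $V(A)$ is the set of atoms of $A$; for meta-formulas (formulas that may contain formula variables) $V$ collects the formula variables and atoms. A sequent is $\Gamma\Rightarrow\Delta$ with $\Gamma,\Delta$ finite multisets of formulas; it is single-conclusion if $|\Delta|\le 1$. A rule is given by finitely many premise meta-sequents and a conclusion meta-sequent written with meta-formulas and meta-multiset variables (contexts); an instance substitutes formulas for formula variables and finite multisets of formulas for contexts. A calculus is a set of rules (axioms being rules without premises); $G\vdash S$ means $S$ has a tree-like proof in $G$; $|O|$ is the length of a fixed binary encoding of $O$. A calculus $H$ extends a calculus $G$ if every $G$-provable sequent is $H$-provable; "$H$ extends $\mathbf{IPC}$" means every sequent provable in a standard single-conclusion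 sequent calculus for intuitionistic logic is provable in $H$. $\mathbf{FL_e}^-$: single-conclusion calculus with axioms $\phi\Rightarrow\phi$, $\Rightarrow 1$, $0\Rightarrow$ and rules: $\Gamma\Rightarrow\Delta/\Gamma,1\Rightarrow\Delta$; $\Gamma\Rightarrow\,/\,\Gamma\Rightarrow 0$; $\Gamma,\phi\Rightarrow\Delta/\Gamma,\phi\wedge\psi\Rightarrow\Delta$ (and with $\psi$); $\Gamma\Rightarrow\phi,\ \Gamma\Rightarrow\psi/\Gamma\Rightarrow\phi\wedge\psi$; $\Gamma,\phi\Rightarrow\Delta,\ \Gamma,\psi\Rightarrow\Delta/\Gamma,\phi\vee\psi\Rightarrow\Delta$; $\Gamma\Rightarrow\phi/\Gamma\Rightarrow\phi\vee\psi$ and $\Gamma\Rightarrow\psi/\Gamma\Rightarrow\phi\vee\psi$; $\Gamma,\phi,\psi\Rightarrow\Delta/\Gamma,\phi*\psi\Rightarrow\Delta$; $\Gamma\Rightarrow\phi,\ \Sigma\Rightarrow\psi/\Gamma,\Sigma\Rightarrow\phi*\psi$; $\Gamma\Rightarrow\phi,\ \Sigma,\psi\Rightarrow\Lambda/\Gamma,\Sigma,\phi\to\psi\Rightarrow\Lambda$; $\Gamma,\phi\Rightarrow\psi/\Gamma\Rightarrow\phi\to\psi$. $\mathbf{FL_e}$ adds axioms $\Gamma\Rightarrow\top$ and $\Gamma,\bot\Rightarrow\Delta$. $\mathbf{CFL_e}^-$, $\mathbf{CFL_e}$ are the multi-conclusion versions (arbitrary right contexts in all succedents, e.g. $\Gamma\Rightarrow\phi,\Delta\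 \ \Sigma\Rightarrow\psi,\Lambda/\Gamma,\Sigma\Rightarrow\phi*\psi,\Delta,\Lambda$, $\Gamma\Rightarrow\phi,\Delta\ \ \Sigma,\psi\Rightarrow\Lambda/\Gamma,\Sigma,\phi\to\psi\Rightarrow\Delta,\Lambda$, $\Gamma\Rightarrow\Delta/\Gamma\Rightarrow 0,\Delta$, axioms $\Gamma\Rightarrow\top,\Delta$, $\Gamma,\bot\Rightarrow\Delta$) plus $\Gamma,\phi\Rightarrow\Delta\ \ \Sigma,\psi\Rightarrow\Lambda/\Gamma,\Sigma,\phi+\psi\Rightarrow\Delta,\Lambda$ and $\Gamma\Rightarrow\phi,\psi,\Delta/\Gamma\Rightarrow\phi+\psi,\Delta$. Semi-analytic rules (single-conclusion). Left: premises $\Pi_j,\bar\psi_{js}\Rightarrow\bar\theta_{js}$ (all $j\le m$, $s$) and $\Gamma_i,\bar\phi_{ir}\Rightarrow\Delta_i$ (all $i\le n$, $r$), conclusion $\Pi_1,\dots,\Pi_m,\Gamma_1,\dots,\Gamma_n,\phi\Rightarrow\Delta_1,\dots,\Delta_n$, where $\Pi_j,\Gamma_i,\Delta_i$ are meta-multiset variables, $\bar\phi,\bar\psi,\bar\theta$ finite multisets of meta-formulas, and all of $V(\bar\phi_{ir}),V(\bar\psi_{js}),V(\bar\theta_{js})$ are contained in $V(\phi)$. Right: premises $\Gamma_i,\bar\phi_{ir}\Rightarrow\bar\psi_{ir}$, conclusion $\Gamma_1,\dots,\Gamma_n\Rightarrow\phi$, with $V(\bar\phi_{ir}),V(\bar\psi_{ir})\subseteq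 V(\phi)$. Modal: $K$: $\Gamma\Rightarrow\phi/\Box\Gamma\Rightarrow\Box\phi$; $D$: $\Gamma\Rightarrow\,/\,\Box\Gamma\Rightarrow$; $RS4$: $\Box\Gamma\Rightarrow\phi/\Box\Gamma\Rightarrow\Box\phi$ ($\Gamma$ a meta-multiset variable, $\Box\emptyset=\emptyset$), where $D$ may be present only if $K$ is, and $RS4$ only if also $LS4$: $\Gamma,\phi\Rightarrow\Delta/\Gamma,\Box\phi\Rightarrow\Delta$ is present. A semi-analytic rule is a left, right or modal semi-analytic rule. Context-sharing semi-analytic rule: premises $\Gamma_i,\bar\psi_{is}\Rightarrow\bar\theta_{is}$ and $\Gamma_i,\bar\phi_{ir}\Rightarrow\Delta_i$, conclusion $\Gamma_1,\dots,\Gamma_n,\phi\Rightarrow\Delta_1,\dots,\Delta_n$, with all variables of $\bar\psi,\bar\theta,\bar\phi$ in $V(\phi)$. Multi-conclusion semi-analytic rules: left: premises $\Gamma_i,\bar\phi_{ir}\Rightarrow\bar\psi_{ir},\Delta_i$, conclusion $\Gamma_1,\dots,\Gamma_n,\phi\Rightarrow\Delta_1,\dots,\Delta_n$; right: same premises, conclusion $\Gamma_1,\dots,\Gamma_n\Rightarrow\phi,\Delta_1,\dots,\Delta_n$; same variable condition; plus the modal rules above. Focused axioms: (1) $\phi\Rightarrow\phi$; (2) $\Rightarrow\bar\alpha$; (3) $\bar\beta\Rightarrow$; (4) $\Gamma,\bar\phi\Rightarrow\Delta$; (5) $\Gamma\Rightarrow\bar\phi,\Delta$; where in (2)–(5)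 any two elements of $\bar\alpha$ (resp. $\bar\beta$, $\bar\phi$) have the same variables and $\Gamma,\Delta$ are meta-multiset variables. Context-free focused axioms are those of forms (1)–(3). $G$ has $H$-interpolation if whenever $\Sigma,\Lambda\Rightarrow\Delta$ has a tree-like $G$-proof $\pi$ there is a formula $C$ with $H\vdash\Sigma\Rightarrow C$, $H\vdash\Lambda,C\Rightarrow\Delta$ and $V(C)\subseteq V(\Sigma)\cap V(\Lambda\cup\Delta)$; it has $H$-feasible interpolation if moreover $|C|\le|\pi|^{O(1)}$.
   Formalization: "H extends G" is taken to mean that the rules of G are admissible in H (provability of G's sequents alone admits counterexamples); in the FL_e^- and CFL_e^- cases every context in a semi-analytic rule's conclusion must also occur in a premise. *)

theory Defs
  imports "HOL-Library.Multiset" "HOL-Library.List_Lexorder"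
begin

section \<open>Formulas and meta-formulas\<close>

text \<open>
  The connectives \<open>\<and>, \<or>, \<rightarrow>, *, 0, 1, \<top>, \<bottom>\<close> belong to every language.  Addition, the modality and
  any further connective (a symbol with an arity) are optional: a language is the set of the
  optional connectives it contains.
\<close>

datatype (vars: 'v) fm =
    Leaf 'v
  | Zero | One | Top | Bot
  | And "'v fm" "'v fm"
  | Or "'v fm" "'v fm"
  | Imp "'v fm" "'v fm"
  | Fusion "'v fm" "'v fm"
  | Plus "'v fm" "'v fm"
  | Box "'v fm"
  | Ext nat "'v fm list"

datatype connective = PlusC | BoxC | ExtC nat nat

type_synonym language = "connective set"

primrec over :: "language \<Rightarrow> 'v fm \<Rightarrow> bool" where
  "over L (Leaf v) = True"
| "over L Zero = True"
| "over L One = True"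
| "over L Top = True"
| "over L Bot = True"
| "over L (And A B) = (over L A \<and> over L B)"
| "over L (Or A B) = (over L A \<and> over L B)"
| "over L (Imp A B) = (over L A \<and> over L B)"
| "over L (Fusion A B) = (over L A \<and> over L B)"
| "over L (Plus A B) = (PlusC \<in> L \<and> over L A \<and> over L B)"
| "over L (Box A) = (BoxC \<in> L \<and> over L A)"
| "over L (Ext c As) = (ExtC c (length As) \<in> L \<and> list_all (over L) As)"

definition mvars :: "'v fm multiset \<Rightarrow> 'v set" where
  "mvars M = (\<Union>A\<in>set_mset M. vars A)"

text \<open>Atoms are natural numbers; a leaf of a meta-formula is an atom or a formula variable.\<close>

datatype mleaf = Atom nat | FVar nat

type_synonym formula = "nat fm"
type_synonym mformula = "mleaf fm"

primrec subst :: "(nat \<Rightarrow> formula) \<Rightarrow> mformula \<Rightarrow> formula" where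
  "subst \<sigma> (Leaf l) = (case l of Atom a \<Rightarrow> Leaf a | FVar x \<Rightarrow> \<sigma> x)"
| "subst \<sigma> Zero = Zero"
| "subst \<sigma> One = One"
| "subst \<sigma> Top = Top"
| "subst \<sigma> Bot = Bot"
| "subst \<sigma> (And A B) = And (subst \<sigma> A) (subst \<sigma> B)"
| "subst \<sigma> (Or A B) = Or (subst \<sigma> A) (subst \<sigma> B)"
| "subst \<sigma> (Imp A B) = Imp (subst \<sigma> A) (subst \<sigma> B)"
| "subst \<sigma> (Fusion A B) = Fusion (subst \<sigma> A) (subst \<sigma> B)"
| "subst \<sigma> (Plus A B) = Plus (subst \<sigma> A) (subst \<sigma> B)"
| "subst \<sigma> (Box A) = Box (subst \<sigma> A)"
| "subst \<sigma> (Ext c As) = Ext c (map (subst \<sigma>) As)"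


section \<open>Sequents, rules, calculi and proofs\<close>

datatype 'x sequent =
  Sequent (ante: "'x multiset") (succ: "'x multiset")  (infix "\<Rrightarrow>" 50)

text \<open>\<open>BCtx i\<close> stands for \<open>\<box>\<Gamma>\<close>, where \<open>\<Gamma>\<close> is the meta-multiset variable \<open>Ctx i\<close>.\<close>

datatype item = Fm mformula | Ctx nat | BCtx nat

datatype rule =
  Rule (prems: "item sequent multiset") (concl: "item sequent")

type_synonym calculus = "rule set"

primrec item_over :: "language \<Rightarrow> item \<Rightarrow> bool" where
  "item_over L (Fm A) = over L A"
| "item_over L (Ctx i) = True"
| "item_over L (BCtx i) = (BoxC \<in> L)"

definition mseq_over :: "language \<Rightarrow> item sequent \<Rightarrow> bool" where
  "mseq_over L S \<longleftrightarrow> (\<forall>x \<in># ante S + succ S. item_over L x)"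

definition calculus_over :: "language \<Rightarrow> calculus \<Rightarrow> bool" where
  "calculus_over L H \<longleftrightarrow>
     (\<forall>R\<in>H. mseq_over L (concl R) \<and> (\<forall>S \<in># prems R. mseq_over L S))"

primrec inst_item :: "(nat \<Rightarrow> formula) \<Rightarrow> (nat \<Rightarrow> formula multiset) \<Rightarrow> item \<Rightarrow> formula multiset" where
  "inst_item \<sigma> \<gamma> (Fm A) = {#subst \<sigma> A#}"
| "inst_item \<sigma> \<gamma> (Ctx i) = \<gamma> i"
| "inst_item \<sigma> \<gamma> (BCtx i) = image_mset Box (\<gamma> i)"

definition inst ::
    "(nat \<Rightarrow> formula) \<Rightarrow> (nat \<Rightarrow> formula multiset) \<Rightarrow> item sequent \<Rightarrow> formula sequent" where
  "inst \<sigma> \<gamma> S =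
     (\<Sum>\<^sub># (image_mset (inst_item \<sigma> \<gamma>) (ante S)) \<Rrightarrow> \<Sum>\<^sub># (image_mset (inst_item \<sigma> \<gamma>) (succ S)))"

text \<open>
  In a single-conclusion calculus only those rule instances are admitted in which all sequents
  are single-conclusion.
\<close>

datatype mode = Single | Multi

primrec admitted :: "mode \<Rightarrow> formula sequent \<Rightarrow> bool" where
  "admitted Single S = (size (succ S) \<le> 1)"
| "admitted Multi S = True"

datatype ptree = Node (root: "formula sequent") (subproofs: "ptree list")

inductive is_proof :: "mode \<Rightarrow> language \<Rightarrow> calculus \<Rightarrow> ptree \<Rightarrow> bool"
  for m :: mode and L :: language and H :: calculus where
  "R \<in> H \<Longrightarrow> (\<forall>x. over L (\<sigma> x)) \<Longrightarrow> (\<forall>i. \<forall>A \<in># \<gamma> i. over L A) \<Longrightarrow>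
   image_mset root (mset ts) = image_mset (inst \<sigma> \<gamma>) (prems R) \<Longrightarrow>
   S = inst \<sigma> \<gamma> (concl R) \<Longrightarrow> admitted m S \<Longrightarrow>
   (\<forall>t \<in> set ts. is_proof m L H t) \<Longrightarrow>
   is_proof m L H (Node S ts)"

definition provable :: "mode \<Rightarrow> language \<Rightarrow> calculus \<Rightarrow> formula sequent \<Rightarrow> bool" where
  "provable m L H S \<longleftrightarrow> (\<exists>\<pi>. is_proof m L H \<pi> \<and> root \<pi> = S)"

text \<open>
  \<open>H\<close> extends \<open>G\<close>: whatever can be proved with the help of the rules of \<open>G\<close> is provable in \<open>H\<close>;
  equivalently, all rules of \<open>G\<close> are admissible in \<open>H\<close>.  In particular every \<open>G\<close>-provable sequent
  is \<open>H\<close>-provable.  Since the calculi considered have no cut rule, the latter alone would not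
  make the theorems of \<open>H\<close> closed under the rules of \<open>G\<close>, and interpolation can then fail.
\<close>

definition extends :: "mode \<Rightarrow> language \<Rightarrow> calculus \<Rightarrow> calculus \<Rightarrow> bool" where
  "extends m L H G \<longleftrightarrow> (\<forall>S. provable m L (H \<union> G) S \<longrightarrow> provable m L H S)"


section \<open>Binary encoding\<close>

text \<open>Self-delimiting: every binary digit is preceded by \<open>True\<close>, and \<open>False\<close> ends the number.\<close>

fun enc_nat :: "nat \<Rightarrow> bool list" where
  "enc_nat n = (if n = 0 then [False] else True # odd n # enc_nat (n div 2))"

declare enc_nat.simps [simp del]

primrec enc_fm :: "formula \<Rightarrow> bool list" where
  "enc_fm (Leaf a) = [False, False, False, False] @ enc_nat a"
| "enc_fm Zero = [False, False, False, True]"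
| "enc_fm One = [False, False, True, False]"
| "enc_fm Top = [False, False, True, True]"
| "enc_fm Bot = [False, True, False, False]"
| "enc_fm (And A B) = [False, True, False, True] @ enc_fm A @ enc_fm B"
| "enc_fm (Or A B) = [False, True, True, False] @ enc_fm A @ enc_fm B"
| "enc_fm (Imp A B) = [False, True, True, True] @ enc_fm A @ enc_fm B"
| "enc_fm (Fusion A B) = [True, False, False, False] @ enc_fm A @ enc_fm B"
| "enc_fm (Plus A B) = [True, False, False, True] @ enc_fm A @ enc_fm B"
| "enc_fm (Box A) = [True, False, True, False] @ enc_fm A"
| "enc_fm (Ext c As) =
     [True, False, True, True] @ enc_nat c @ enc_nat (length As) @ concat (map enc_fm As)"

text \<open>A multiset is written down in the lexicographic order of the codes of its elements.\<close>

definition enc_mset :: "formula multiset \<Rightarrow> bool list" where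
  "enc_mset M = enc_nat (size M) @ concat (sorted_list_of_multiset (image_mset enc_fm M))"

definition enc_seq :: "formula sequent \<Rightarrow> bool list" where
  "enc_seq S = enc_mset (ante S) @ enc_mset (succ S)"

primrec enc_proof :: "ptree \<Rightarrow> bool list" where
  "enc_proof (Node S ts) = enc_seq S @ enc_nat (length ts) @ concat (map enc_proof ts)"


section \<open>Semi-analytic rules and focused axioms\<close>

definition fms :: "mformula multiset \<Rightarrow> item multiset" where
  "fms M = image_mset Fm M"

definition ctxs :: "nat list \<Rightarrow> item multiset" where
  "ctxs is = mset (map Ctx is)"

text \<open>
  The families of premises are given by lists: an entry \<open>(p, Fs)\<close> of \<open>P\<close> is a context \<open>\<Pi>\<^sub>j\<close> with the
  pairs of multisets \<open>\<psi>\<^sub>j\<^sub>s, \<theta>\<^sub>j\<^sub>s\<close> for all \<open>s\<close>, and an entry \<open>(g, d, Fs)\<close> of \<open>Q\<close> consists of contexts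
  \<open>\<Gamma>\<^sub>i, \<Delta>\<^sub>i\<close> and the \<open>\<phi>\<^sub>i\<^sub>r\<close> for all \<open>r\<close>.  All the lists may be empty.
\<close>

definition left_semi_analytic :: "rule \<Rightarrow> bool" where
  "left_semi_analytic R \<longleftrightarrow>
     (\<exists>(P :: (nat \<times> (mformula multiset \<times> mformula multiset) list) list)
       (Q :: (nat \<times> nat \<times> mformula multiset list) list) \<phi>.
        distinct (map fst P @ map fst Q @ map (fst \<circ> snd) Q) \<and>
        (\<forall>(p, Fs) \<in> set P. \<forall>(\<psi>s, \<theta>s) \<in> set Fs. mvars \<psi>s \<subseteq> vars \<phi> \<and> mvars \<theta>s \<subseteq> vars \<phi>) \<and>
        (\<forall>(g, d, Fs) \<in> set Q. \<forall>\<phi>s \<in> set Fs. mvars \<phi>s \<subseteq> vars \<phi>) \<and>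
        R = Rule
          (mset [add_mset (Ctx p) (fms \<psi>s) \<Rrightarrow> fms \<theta>s. (p, Fs) \<leftarrow> P, (\<psi>s, \<theta>s) \<leftarrow> Fs] +
           mset [add_mset (Ctx g) (fms \<phi>s) \<Rrightarrow> {#Ctx d#}. (g, d, Fs) \<leftarrow> Q, \<phi>s \<leftarrow> Fs])
          (add_mset (Fm \<phi>) (ctxs (map fst P) + ctxs (map fst Q)) \<Rrightarrow> ctxs (map (fst \<circ> snd) Q)))"

definition right_semi_analytic :: "rule \<Rightarrow> bool" where
  "right_semi_analytic R \<longleftrightarrow>
     (\<exists>(P :: (nat \<times> (mformula multiset \<times> mformula multiset) list) list) \<phi>.
        distinct (map fst P) \<and>
        (\<forall>(g, Fs) \<in> set P. \<forall>(\<phi>s, \<psi>s) \<in> set Fs. mvars \<phi>s \<subseteq> vars \<phi> \<and> mvars \<psi>s \<subseteq> vars \<phi>) \<and>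
        R = Rule
          (mset [add_mset (Ctx g) (fms \<phi>s) \<Rrightarrow> fms \<psi>s. (g, Fs) \<leftarrow> P, (\<phi>s, \<psi>s) \<leftarrow> Fs])
          (ctxs (map fst P) \<Rrightarrow> {#Fm \<phi>#}))"

text \<open>
  An entry \<open>(g, d, Es, Fs)\<close> consists of the contexts \<open>\<Gamma>\<^sub>i, \<Delta>\<^sub>i\<close>, the pairs \<open>\<psi>\<^sub>i\<^sub>s, \<theta>\<^sub>i\<^sub>s\<close> and the \<open>\<phi>\<^sub>i\<^sub>r\<close>.
\<close>

definition context_sharing_semi_analytic :: "rule \<Rightarrow> bool" where
  "context_sharing_semi_analytic R \<longleftrightarrow>
     (\<exists>(Q :: (nat \<times> nat \<times> (mformula multiset \<times> mformula multiset) list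
              \<times> mformula multiset list) list) \<phi>.
        distinct (map fst Q @ map (fst \<circ> snd) Q) \<and>
        (\<forall>(g, d, Es, Fs) \<in> set Q.
           (\<forall>(\<psi>s, \<theta>s) \<in> set Es. mvars \<psi>s \<subseteq> vars \<phi> \<and> mvars \<theta>s \<subseteq> vars \<phi>) \<and>
           (\<forall>\<phi>s \<in> set Fs. mvars \<phi>s \<subseteq> vars \<phi>)) \<and>
        R = Rule
          (mset [add_mset (Ctx g) (fms \<psi>s) \<Rrightarrow> fms \<theta>s. (g, d, Es, Fs) \<leftarrow> Q, (\<psi>s, \<theta>s) \<leftarrow> Es] +
           mset [add_mset (Ctx g) (fms \<phi>s) \<Rrightarrow> {#Ctx d#}. (g, d, Es, Fs) \<leftarrow> Q, \<phi>s \<leftarrow> Fs])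
          (add_mset (Fm \<phi>) (ctxs (map fst Q)) \<Rrightarrow> ctxs (map (fst \<circ> snd) Q)))"

definition multi_left_semi_analytic :: "rule \<Rightarrow> bool" where
  "multi_left_semi_analytic R \<longleftrightarrow>
     (\<exists>(Q :: (nat \<times> nat \<times> (mformula multiset \<times> mformula multiset) list) list) \<phi>.
        distinct (map fst Q @ map (fst \<circ> snd) Q) \<and>
        (\<forall>(g, d, Fs) \<in> set Q. \<forall>(\<phi>s, \<psi>s) \<in> set Fs. mvars \<phi>s \<subseteq> vars \<phi> \<and> mvars \<psi>s \<subseteq> vars \<phi>) \<and>
        R = Rule
          (mset [add_mset (Ctx g) (fms \<phi>s) \<Rrightarrow> add_mset (Ctx d) (fms \<psi>s).
                   (g, d, Fs) \<leftarrow> Q, (\<phi>s, \<psi>s) \<leftarrow> Fs])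
          (add_mset (Fm \<phi>) (ctxs (map fst Q)) \<Rrightarrow> ctxs (map (fst \<circ> snd) Q)))"

definition multi_right_semi_analytic :: "rule \<Rightarrow> bool" where
  "multi_right_semi_analytic R \<longleftrightarrow>
     (\<exists>(Q :: (nat \<times> nat \<times> (mformula multiset \<times> mformula multiset) list) list) \<phi>.
        distinct (map fst Q @ map (fst \<circ> snd) Q) \<and>
        (\<forall>(g, d, Fs) \<in> set Q. \<forall>(\<phi>s, \<psi>s) \<in> set Fs. mvars \<phi>s \<subseteq> vars \<phi> \<and> mvars \<psi>s \<subseteq> vars \<phi>) \<and>
        R = Rule
          (mset [add_mset (Ctx g) (fms \<phi>s) \<Rrightarrow> add_mset (Ctx d) (fms \<psi>s).
                   (g, d, Fs) \<leftarrow> Q, (\<phi>s, \<psi>s) \<leftarrow> Fs])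
          (ctxs (map fst Q) \<Rrightarrow> add_mset (Fm \<phi>) (ctxs (map (fst \<circ> snd) Q))))"

definition rule_K :: "rule \<Rightarrow> bool" where
  "rule_K R \<longleftrightarrow> (\<exists>g x. R =
     Rule {#{#Ctx g#} \<Rrightarrow> {#Fm (Leaf (FVar x))#}#}
       ({#BCtx g#} \<Rrightarrow> {#Fm (Box (Leaf (FVar x)))#}))"

definition rule_D :: "rule \<Rightarrow> bool" where
  "rule_D R \<longleftrightarrow> (\<exists>g. R = Rule {#{#Ctx g#} \<Rrightarrow> {#}#} ({#BCtx g#} \<Rrightarrow> {#}))"

definition rule_RS4 :: "rule \<Rightarrow> bool" where
  "rule_RS4 R \<longleftrightarrow> (\<exists>g x. R =
     Rule {#{#BCtx g#} \<Rrightarrow> {#Fm (Leaf (FVar x))#}#}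
       ({#BCtx g#} \<Rrightarrow> {#Fm (Box (Leaf (FVar x)))#}))"

definition rule_LS4 :: "rule \<Rightarrow> bool" where
  "rule_LS4 R \<longleftrightarrow> (\<exists>g d x. g \<noteq> d \<and> R =
     Rule {#{#Ctx g, Fm (Leaf (FVar x))#} \<Rrightarrow> {#Ctx d#}#}
       ({#Ctx g, Fm (Box (Leaf (FVar x)))#} \<Rrightarrow> {#Ctx d#}))"

definition modal_semi_analytic :: "rule \<Rightarrow> bool" where
  "modal_semi_analytic R \<longleftrightarrow> rule_K R \<or> rule_D R \<or> rule_RS4 R"

definition modal_condition :: "calculus \<Rightarrow> bool" where
  "modal_condition H \<longleftrightarrow>
     ((\<exists>R\<in>H. rule_D R) \<longrightarrow> (\<exists>R\<in>H. rule_K R)) \<and>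
     ((\<exists>R\<in>H. rule_RS4 R) \<longrightarrow> (\<exists>R\<in>H. rule_LS4 R))"

definition semi_analytic :: "mode \<Rightarrow> rule \<Rightarrow> bool" where
  "semi_analytic m R \<longleftrightarrow>
     (case m of
        Single \<Rightarrow> left_semi_analytic R \<or> right_semi_analytic R
      | Multi \<Rightarrow> multi_left_semi_analytic R \<or> multi_right_semi_analytic R)
     \<or> modal_semi_analytic R"

definition same_vars :: "mformula multiset \<Rightarrow> bool" where
  "same_vars M \<longleftrightarrow> (\<forall>A \<in># M. \<forall>B \<in># M. vars A = vars B)"

definition context_free_focused_axiom :: "rule \<Rightarrow> bool" where
  "context_free_focused_axiom R \<longleftrightarrow>
     (\<exists>\<phi>. R = Rule {#} ({#Fm \<phi>#} \<Rrightarrow> {#Fm \<phi>#})) \<or>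
     (\<exists>\<alpha>s. same_vars \<alpha>s \<and> R = Rule {#} ({#} \<Rrightarrow> fms \<alpha>s)) \<or>
     (\<exists>\<beta>s. same_vars \<beta>s \<and> R = Rule {#} (fms \<beta>s \<Rrightarrow> {#}))"

definition focused_axiom :: "rule \<Rightarrow> bool" where
  "focused_axiom R \<longleftrightarrow>
     context_free_focused_axiom R \<or>
     (\<exists>g d \<phi>s. g \<noteq> d \<and> same_vars \<phi>s \<and>
        R = Rule {#} (add_mset (Ctx g) (fms \<phi>s) \<Rrightarrow> {#Ctx d#})) \<or>
     (\<exists>g d \<phi>s. g \<noteq> d \<and> same_vars \<phi>s \<and>
        R = Rule {#} ({#Ctx g#} \<Rrightarrow> add_mset (Ctx d) (fms \<phi>s)))"

text \<open>
  A context of the conclusion that occurs in no premise makes a rule behave like an axiom with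
  context (e.g. \<open>\<Gamma> \<Rightarrow> \<phi>\<close> without premises).  Where only context-free axioms are
  allowed, such rules have to be excluded as well.
\<close>

definition contexts_in_premises :: "rule \<Rightarrow> bool" where
  "contexts_in_premises R \<longleftrightarrow>
     (\<forall>i. Ctx i \<in># ante (concl R) + succ (concl R) \<longrightarrow>
          (\<exists>S \<in># prems R. Ctx i \<in># ante S + succ S))"


section \<open>The calculi\<close>

context
begin

private abbreviation (input) "mphi \<equiv> Leaf (FVar 0)"
private abbreviation (input) "mpsi \<equiv> Leaf (FVar 1)"
private abbreviation (input) "\<Gamma> \<equiv> Ctx 0"
private abbreviation (input) "\<Delta> \<equiv> Ctx 1"
private abbreviation (input) "\<Sigma> \<equiv> Ctx 2"
private abbreviation (input) "\<Lambda> \<equiv> Ctx 3"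

definition lattice_imp_rules :: calculus where
  "lattice_imp_rules = {
     Rule {#{#\<Gamma>, Fm mphi#} \<Rrightarrow> {#\<Delta>#}#} ({#\<Gamma>, Fm (And mphi mpsi)#} \<Rrightarrow> {#\<Delta>#}),
     Rule {#{#\<Gamma>, Fm mpsi#} \<Rrightarrow> {#\<Delta>#}#} ({#\<Gamma>, Fm (And mphi mpsi)#} \<Rrightarrow> {#\<Delta>#}),
     Rule {#{#\<Gamma>#} \<Rrightarrow> {#Fm mphi#}, {#\<Gamma>#} \<Rrightarrow> {#Fm mpsi#}#} ({#\<Gamma>#} \<Rrightarrow> {#Fm (And mphi mpsi)#}),
     Rule {#{#\<Gamma>, Fm mphi#} \<Rrightarrow> {#\<Delta>#}, {#\<Gamma>, Fm mpsi#} \<Rrightarrow> {#\<Delta>#}#}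
       ({#\<Gamma>, Fm (Or mphi mpsi)#} \<Rrightarrow> {#\<Delta>#}),
     Rule {#{#\<Gamma>#} \<Rrightarrow> {#Fm mphi#}#} ({#\<Gamma>#} \<Rrightarrow> {#Fm (Or mphi mpsi)#}),
     Rule {#{#\<Gamma>#} \<Rrightarrow> {#Fm mpsi#}#} ({#\<Gamma>#} \<Rrightarrow> {#Fm (Or mphi mpsi)#}),
     Rule {#{#\<Gamma>#} \<Rrightarrow> {#Fm mphi#}, {#\<Sigma>, Fm mpsi#} \<Rrightarrow> {#\<Lambda>#}#}
       ({#\<Gamma>, \<Sigma>, Fm (Imp mphi mpsi)#} \<Rrightarrow> {#\<Lambda>#}),
     Rule {#{#\<Gamma>, Fm mphi#} \<Rrightarrow> {#Fm mpsi#}#} ({#\<Gamma>#} \<Rrightarrow> {#Fm (Imp mphi mpsi)#})}"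

definition FLe_minus :: calculus where
  "FLe_minus = lattice_imp_rules \<union> {
     Rule {#} ({#Fm mphi#} \<Rrightarrow> {#Fm mphi#}),
     Rule {#} ({#} \<Rrightarrow> {#Fm One#}),
     Rule {#} ({#Fm Zero#} \<Rrightarrow> {#}),
     Rule {#{#\<Gamma>#} \<Rrightarrow> {#\<Delta>#}#} ({#\<Gamma>, Fm One#} \<Rrightarrow> {#\<Delta>#}),
     Rule {#{#\<Gamma>#} \<Rrightarrow> {#}#} ({#\<Gamma>#} \<Rrightarrow> {#Fm Zero#}),
     Rule {#{#\<Gamma>, Fm mphi, Fm mpsi#} \<Rrightarrow> {#\<Delta>#}#} ({#\<Gamma>, Fm (Fusion mphi mpsi)#} \<Rrightarrow> {#\<Delta>#}),
     Rule {#{#\<Gamma>#} \<Rrightarrow> {#Fm mphi#}, {#\<Sigma>#} \<Rrightarrow> {#Fm mpsi#}#}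
       ({#\<Gamma>, \<Sigma>#} \<Rrightarrow> {#Fm (Fusion mphi mpsi)#})}"

definition FLe :: calculus where
  "FLe = FLe_minus \<union> {
     Rule {#} ({#\<Gamma>#} \<Rrightarrow> {#Fm Top#}),
     Rule {#} ({#\<Gamma>, Fm Bot#} \<Rrightarrow> {#\<Delta>#})}"

text \<open>Gentzen's LJ without cut, in the language \<open>\<and>, \<or>, \<rightarrow>, \<top>, \<bottom>\<close> of intuitionistic logic.\<close>

definition IPC :: calculus where
  "IPC = lattice_imp_rules \<union> {
     Rule {#} ({#Fm mphi#} \<Rrightarrow> {#Fm mphi#}),
     Rule {#} ({#} \<Rrightarrow> {#Fm Top#}),
     Rule {#} ({#Fm Bot#} \<Rrightarrow> {#}),
     Rule {#{#\<Gamma>#} \<Rrightarrow> {#\<Delta>#}#} ({#\<Gamma>, Fm mphi#} \<Rrightarrow> {#\<Delta>#}),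
     Rule {#{#\<Gamma>, Fm mphi, Fm mphi#} \<Rrightarrow> {#\<Delta>#}#} ({#\<Gamma>, Fm mphi#} \<Rrightarrow> {#\<Delta>#}),
     Rule {#{#\<Gamma>#} \<Rrightarrow> {#}#} ({#\<Gamma>#} \<Rrightarrow> {#Fm mphi#})}"

definition CFLe_minus :: calculus where
  "CFLe_minus = {
     Rule {#} ({#Fm mphi#} \<Rrightarrow> {#Fm mphi#}),
     Rule {#} ({#} \<Rrightarrow> {#Fm One#}),
     Rule {#} ({#Fm Zero#} \<Rrightarrow> {#}),
     Rule {#{#\<Gamma>#} \<Rrightarrow> {#\<Delta>#}#} ({#\<Gamma>, Fm One#} \<Rrightarrow> {#\<Delta>#}),
     Rule {#{#\<Gamma>#} \<Rrightarrow> {#\<Delta>#}#} ({#\<Gamma>#} \<Rrightarrow> {#Fm Zero, \<Delta>#}),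
     Rule {#{#\<Gamma>, Fm mphi#} \<Rrightarrow> {#\<Delta>#}#} ({#\<Gamma>, Fm (And mphi mpsi)#} \<Rrightarrow> {#\<Delta>#}),
     Rule {#{#\<Gamma>, Fm mpsi#} \<Rrightarrow> {#\<Delta>#}#} ({#\<Gamma>, Fm (And mphi mpsi)#} \<Rrightarrow> {#\<Delta>#}),
     Rule {#{#\<Gamma>#} \<Rrightarrow> {#Fm mphi, \<Delta>#}, {#\<Gamma>#} \<Rrightarrow> {#Fm mpsi, \<Delta>#}#}
       ({#\<Gamma>#} \<Rrightarrow> {#Fm (And mphi mpsi), \<Delta>#}),
     Rule {#{#\<Gamma>, Fm mphi#} \<Rrightarrow> {#\<Delta>#}, {#\<Gamma>, Fm mpsi#} \<Rrightarrow> {#\<Delta>#}#}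
       ({#\<Gamma>, Fm (Or mphi mpsi)#} \<Rrightarrow> {#\<Delta>#}),
     Rule {#{#\<Gamma>#} \<Rrightarrow> {#Fm mphi, \<Delta>#}#} ({#\<Gamma>#} \<Rrightarrow> {#Fm (Or mphi mpsi), \<Delta>#}),
     Rule {#{#\<Gamma>#} \<Rrightarrow> {#Fm mpsi, \<Delta>#}#} ({#\<Gamma>#} \<Rrightarrow> {#Fm (Or mphi mpsi), \<Delta>#}),
     Rule {#{#\<Gamma>, Fm mphi, Fm mpsi#} \<Rrightarrow> {#\<Delta>#}#} ({#\<Gamma>, Fm (Fusion mphi mpsi)#} \<Rrightarrow> {#\<Delta>#}),
     Rule {#{#\<Gamma>#} \<Rrightarrow> {#Fm mphi, \<Delta>#}, {#\<Sigma>#} \<Rrightarrow> {#Fm mpsi, \<Lambda>#}#}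
       ({#\<Gamma>, \<Sigma>#} \<Rrightarrow> {#Fm (Fusion mphi mpsi), \<Delta>, \<Lambda>#}),
     Rule {#{#\<Gamma>#} \<Rrightarrow> {#Fm mphi, \<Delta>#}, {#\<Sigma>, Fm mpsi#} \<Rrightarrow> {#\<Lambda>#}#}
       ({#\<Gamma>, \<Sigma>, Fm (Imp mphi mpsi)#} \<Rrightarrow> {#\<Delta>, \<Lambda>#}),
     Rule {#{#\<Gamma>, Fm mphi#} \<Rrightarrow> {#Fm mpsi, \<Delta>#}#} ({#\<Gamma>#} \<Rrightarrow> {#Fm (Imp mphi mpsi), \<Delta>#}),
     Rule {#{#\<Gamma>, Fm mphi#} \<Rrightarrow> {#\<Delta>#}, {#\<Sigma>, Fm mpsi#} \<Rrightarrow> {#\<Lambda>#}#}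
       ({#\<Gamma>, \<Sigma>, Fm (Plus mphi mpsi)#} \<Rrightarrow> {#\<Delta>, \<Lambda>#}),
     Rule {#{#\<Gamma>#} \<Rrightarrow> {#Fm mphi, Fm mpsi, \<Delta>#}#} ({#\<Gamma>#} \<Rrightarrow> {#Fm (Plus mphi mpsi), \<Delta>#})}"

definition CFLe :: calculus where
  "CFLe = CFLe_minus \<union> {
     Rule {#} ({#\<Gamma>#} \<Rrightarrow> {#Fm Top, \<Delta>#}),
     Rule {#} ({#\<Gamma>, Fm Bot#} \<Rrightarrow> {#\<Delta>#})}"

end


section \<open>Feasible interpolation\<close>

text \<open>\<open>feasible_interpolation m L G H\<close>: \<open>G\<close> has \<open>H\<close>-feasible interpolation.\<close>

definition feasible_interpolation :: "mode \<Rightarrow> language \<Rightarrow> calculus \<Rightarrow> calculus \<Rightarrow> bool" where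
  "feasible_interpolation m L G H \<longleftrightarrow>
     (\<exists>k::nat. \<forall>\<pi> \<Sigma> \<Lambda> \<Delta>. is_proof m L G \<pi> \<and> root \<pi> = (\<Sigma> + \<Lambda> \<Rrightarrow> \<Delta>) \<longrightarrow>
        (\<exists>C. over L C \<and>
             provable m L H (\<Sigma> \<Rrightarrow> {#C#}) \<and>
             provable m L H (add_mset C \<Lambda> \<Rrightarrow> \<Delta>) \<and>
             vars C \<subseteq> mvars \<Sigma> \<inter> mvars (\<Lambda> + \<Delta>) \<and>
             length (enc_fm C) \<le> length (enc_proof \<pi>) ^ k))"

end

theory Submission
  imports Defs
begin

text \<open>
  Maehara's method, without cut.  A sequent is split into two parts, and for each proof one builds by
  induction an interpolant of every splitting of its last sequent.  If the main formula of a
  semi-analytic rule lies in the second part, the interpolants of the premises sharing a context are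
  joined by \<open>\<and>\<close>, and the results for the different contexts by fusion: the variable condition keeps the
  variables of the active formulas on the side of the main formula.  If it lies in the first part, the
  two parts are interchanged; this turns an interpolant \<open>C\<close> into \<open>C \<rightarrow> 0\<close>.  For a single-conclusion rule
  the premises that carry the succedent cannot be interchanged; their interpolants are joined by \<open>\<or>\<close>
  to a formula \<open>D\<close>, and with the fusion \<open>C\<close> of all the others \<open>C \<rightarrow> D\<close> is an interpolant.
  Every interpolant of a premise is used once, hence the size of the result is linear in that of the proof.
\<close>

text \<open>The obstacle is the absence of cut: interpolants of the premises cannot be cut into a
  derivation of the conclusion. Semi-analytic rules leave their contexts arbitrary, so the
  interpolant of a block can be put into that block's own context, the rule is applied to the
  enlarged contexts, and only then left rules of the base calculus merge the added formulas into
  one. This explains both connectives: premises with a common context need one and the same extra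
  formula, which \<open>And\<close> supplies, while different contexts are concatenated in the
  conclusion, which \<open>fuse\<close> reflects. The base calculus enters solely through
  admissibility of its rules in \<open>H\<close>. A block without premises leaves nothing to
  interpolate; \<open>Top\<close> and \<open>Bot\<close> fill the gap, and over the calculi lacking
  them such blocks are excluded. The size bound needs a cost that is additive over the premises,
  hence the fixed slack in every interpolant: a join of two interpolants gives up one slack and pays
  its connective from it.\<close>

lemma mset_refinement:
  assumes "X + Y = A + (B :: 'a multiset)"
  obtains X1 X2 Y1 Y2 where "X = X1 + X2" "Y = Y1 + Y2" "A = X1 + Y1" "B = X2 + Y2"
proof (rule that[of "X \<inter># A" "X - A" "A - X" "Y - (A - X)"])
  have c: "count X a + count Y a = count A a + count B a" for a
    by (metis assms count_union)
  show "X = X \<inter># A + (X - A)" "A = X \<inter># A + (A - X)"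
    by (auto intro!: multiset_eqI)
  show "Y = A - X + (Y - (A - X))"
    by (rule multiset_eqI, insert c) (simp, smt (verit) add_leD1 diff_add_inverse le_add_diff_inverse
      le_diff_conv nat_le_linear add.commute diff_is_0_eq add_0)
  show "B = X - A + (Y - (A - X))"
    by (rule multiset_eqI, insert c) (simp, smt (verit) add_diff_cancel_left' diff_add_inverse
      diff_diff_left le_add_diff_inverse nat_le_linear add.commute diff_is_0_eq add_0 diff_add_assoc2)
qed

text \<open>Iterated refinement: a splitting of the concatenated contexts of a conclusion comes from
  a splitting of each single context.\<close>

lemma sum_mset_split:
  fixes f :: "'i \<Rightarrow> 'a multiset"
  assumes "finite I" and "sum f I = A + B"
  shows "\<exists>g h. (\<forall>i\<in>I. f i = g i + h i) \<and> sum g I = A \<and> sum h I = B"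
  using assms
proof (induction I arbitrary: A B rule: finite_induct)
  case empty
  then show ?case by auto
next
  case (insert i I)
  then have "f i + sum f I = A + B" by simp
  then obtain X1 X2 Y1 Y2 where x: "f i = X1 + X2" "sum f I = Y1 + Y2" "A = X1 + Y1" "B = X2 + Y2"
    by (rule mset_refinement)
  from insert.IH[OF x(2)] obtain g h
    where gh: "\<forall>i\<in>I. f i = g i + h i" "sum g I = Y1" "sum h I = Y2" by blast
  have "sum (g(i := X1)) I = sum g I" "sum (h(i := X2)) I = sum h I"
    using insert.hyps by (auto intro!: sum.cong)
  with gh x insert.hyps show ?case
    by (intro exI[of _ "g(i := X1)"] exI[of _ "h(i := X2)"]) auto
qed

lemma sum_mset_eq_empty_iff:
  fixes f :: "'i \<Rightarrow> 'a multiset"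
  shows "finite I \<Longrightarrow> sum f I = {#} \<longleftrightarrow> (\<forall>i\<in>I. f i = {#})"
  by (induction I rule: finite_induct) auto

lemma sum_Times_bool:
  "(\<Sum>x\<in>I \<times> UNIV. f x) = (\<Sum>i\<in>I. f (i, False) + f (i, True) :: 'b :: comm_monoid_add)"
proof -
  have "(\<Sum>x\<in>I \<times> UNIV. f x) = (\<Sum>i\<in>I. \<Sum>b\<in>UNIV. f (i, b))"
    by (simp add: sum.cartesian_product)
  then show ?thesis by (simp add: UNIV_bool)
qed

lemma size_le_1_cases:
  assumes "size M \<le> 1"
  obtains "M = {#}" | x where "M = {#x#}"
  using assms by (metis le_zero_eq less_one linorder_not_less nat_less_le size_1_singleton_mset size_eq_0_iff_empty)

section \<open>Formulas and substitution\<close>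

lemma mvars_simps [simp]:
  "mvars {#} = {}" "mvars (add_mset A M) = vars A \<union> mvars M" "mvars (M + N) = mvars M \<union> mvars N"
  by (auto simp: mvars_def)

lemma mvars_Box [simp]: "mvars (image_mset Box M) = mvars M"
  by (auto simp: mvars_def)

text \<open>Any one element of the nonempty \<open>N\<close> already has all the variables of each
  element of \<open>M\<close>. This is how the focus condition on axioms is used.\<close>

lemma mvars_subset_if_same_vars:
  assumes "\<And>A B. A \<in># M + N \<Longrightarrow> B \<in># M + N \<Longrightarrow> vars A = vars B" and "N \<noteq> {#}"
  shows "mvars M \<subseteq> mvars N"
proof
  fix x assume "x \<in> mvars M"
  then obtain A where A: "A \<in># M" "x \<in> vars A" by (auto simp: mvars_def)
  obtain B where B: "B \<in># N" using assms(2) by blast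
  have "vars A = vars B" by (rule assms(1)) (use A B in simp_all)
  with A B show "x \<in> mvars N" by (auto simp: mvars_def)
qed

lemma vars_subst:
  "vars (subst \<sigma> A) = (\<Union>l\<in>vars A. case l of Atom a \<Rightarrow> {a} | FVar x \<Rightarrow> vars (\<sigma> x))"
  by (induction A) (auto split: mleaf.splits)

text \<open>Transfers the variable condition from meta-formulas to instances: the variables of an
  instance depend only on the leaves of the meta-formula, and monotonically.\<close>

lemma mvars_subst_mono:
  "mvars M \<subseteq> vars B \<Longrightarrow> mvars (image_mset (subst \<sigma>) M) \<subseteq> vars (subst \<sigma> B)"
  by (fastforce simp: mvars_def vars_subst)

lemma over_subst: "over L A \<Longrightarrow> (\<And>x. over L (\<sigma> x)) \<Longrightarrow> over L (subst \<sigma> A)"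
  by (induction A) (auto split: mleaf.splits simp: list_all_iff)

definition mover :: "language \<Rightarrow> formula multiset \<Rightarrow> bool" where
  "mover L M \<longleftrightarrow> (\<forall>A \<in># M. over L A)"

lemma mover_simps [simp]:
  "mover L {#}" "mover L (add_mset A M) \<longleftrightarrow> over L A \<and> mover L M"
  "mover L (M + N) \<longleftrightarrow> mover L M \<and> mover L N"
  by (auto simp: mover_def)

lemma mover_sum: "finite I \<Longrightarrow> mover L (sum f I) \<longleftrightarrow> (\<forall>i\<in>I. mover L (f i))"
  by (induction I rule: finite_induct) auto

lemma mover_Box [simp]: "mover L (image_mset Box M) \<longleftrightarrow> mover L M \<and> (M \<noteq> {#} \<longrightarrow> BoxC \<in> L)"
  by (auto simp: mover_def)

text \<open>Every code starts with a 4-bit tag, so the 4 bits of a connective can be charged to a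
  formula that it joins.\<close>

lemma enc_fm_ge: "length (enc_fm A) \<ge> 4"
  by (cases A) auto

section \<open>Admissible rules\<close>

lemma provable_rule:
  assumes "R \<in> H" and "\<And>x. over L (\<sigma> x)" and "\<And>i. mover L (\<gamma> i)"
    and "\<And>S. S \<in># prems R \<Longrightarrow> provable m L H (inst \<sigma> \<gamma> S)"
    and "admitted m (inst \<sigma> \<gamma> (concl R))"
  shows "provable m L H (inst \<sigma> \<gamma> (concl R))"
proof -
  obtain ps where ps: "mset ps = prems R" using ex_mset by blast
  from assms(4) have "\<forall>S\<in>set ps. \<exists>t. is_proof m L H t \<and> root t = inst \<sigma> \<gamma> S"
    by (metis ps provable_def set_mset_mset)
  then obtain t where t: "\<forall>S\<in>set ps. is_proof m L H (t S) \<and> root (t S) = inst \<sigma> \<gamma> S"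
    by metis
  have "image_mset root (mset (map t ps)) = image_mset (inst \<sigma> \<gamma>) (prems R)"
  proof -
    have "map root (map t ps) = map (inst \<sigma> \<gamma>) ps" using t by simp
    then show ?thesis by (metis mset_map ps)
  qed
  then have "is_proof m L H (Node (inst \<sigma> \<gamma> (concl R)) (map t ps))"
    using assms t by (intro is_proof.intros[of R H L \<sigma> \<gamma>]) (auto simp: mover_def)
  then show ?thesis unfolding provable_def by force
qed

lemma is_proof_mono: "is_proof m L H t \<Longrightarrow> H \<subseteq> H' \<Longrightarrow> is_proof m L H' t"
  by (induction rule: is_proof.induct) (auto intro!: is_proof.intros)

text \<open>\<open>H\<close>-proofs of the premises followed by one rule of \<open>G\<close> form a
  proof in the union, which extension pulls back to \<open>H\<close>. All derivations with
  interpolants are assembled from such steps and from the rules of \<open>H\<close>.\<close>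

lemma extends_rule:
  assumes "extends m L H G" and "R \<in> G" and "\<And>x. over L (\<sigma> x)" and "\<And>i. mover L (\<gamma> i)"
    and "\<And>S. S \<in># prems R \<Longrightarrow> provable m L H (inst \<sigma> \<gamma> S)"
    and "admitted m (inst \<sigma> \<gamma> (concl R))"
  shows "provable m L H (inst \<sigma> \<gamma> (concl R))"
proof -
  have "provable m L (H \<union> G) (inst \<sigma> \<gamma> S)" if "S \<in># prems R" for S
    using assms(5)[OF that] is_proof_mono unfolding provable_def by blast
  then have "provable m L (H \<union> G) (inst \<sigma> \<gamma> (concl R))"
    using assms by (intro provable_rule) auto
  with assms(1) show ?thesis by (simp add: extends_def)
qed

lemma provable_admitted: "provable m L H S \<Longrightarrow> admitted m S"
  unfolding provable_def by (auto elim: is_proof.cases)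

lemma inst_over:
  assumes "mseq_over L S" and "\<And>x. over L (\<sigma> x)" and "\<And>i. mover L (\<gamma> i)"
  shows "mover L (ante (inst \<sigma> \<gamma> S) + succ (inst \<sigma> \<gamma> S))"
proof -
  have "mover L (inst_item \<sigma> \<gamma> x)" if "item_over L x" for x
    using that assms(2,3) over_subst by (cases x) auto
  with assms(1) show ?thesis
    by (fastforce simp: mseq_over_def inst_def mover_def)
qed

text \<open>The last step of the proof suffices, since rule and substitution are both over
  \<open>L\<close>.\<close>

lemma provable_over:
  assumes "calculus_over L H" and "provable m L H S"
  shows "mover L (ante S + succ S)"
  using assms(2) unfolding provable_def
proof (elim exE conjE)
  fix \<pi> assume "is_proof m L H \<pi>" "root \<pi> = S"
  then obtain R \<sigma> \<gamma> where "R \<in> H" "\<And>x. over L (\<sigma> x)" "\<And>i. mover L (\<gamma> i)"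
    "S = inst \<sigma> \<gamma> (concl R)"
    by (cases rule: is_proof.cases) (auto simp: mover_def)
  then show ?thesis
    using assms(1) inst_over[of L "concl R" \<sigma> \<gamma>] by (auto simp: calculus_over_def)
qed

section \<open>Maehara interpolation over an abstract calculus\<close>

text \<open>
  \<open>fuse\<close>, \<open>unit\<close>, \<open>zero\<close> are fusion, \<open>1\<close>, \<open>0\<close> over the substructural calculi and \<open>\<and>\<close>, \<open>\<top>\<close>, \<open>\<bottom>\<close>
  over intuitionistic logic.  The right contexts of the rules are empty for
  single-conclusion calculi, by \<open>pr_single\<close>.
\<close>

locale interpolation_calculus =
  fixes m :: mode and L :: language
    and pr :: "formula multiset \<Rightarrow> formula multiset \<Rightarrow> bool" (infix "\<turnstile>" 50)
    and fuse :: "formula \<Rightarrow> formula \<Rightarrow> formula" and unit zero :: formula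
  assumes pr_over: "\<Gamma> \<turnstile> \<Delta> \<Longrightarrow> mover L \<Gamma> \<and> mover L \<Delta>"
    and pr_single: "\<Gamma> \<turnstile> \<Delta> \<Longrightarrow> m = Single \<Longrightarrow> size \<Delta> \<le> 1"
    and over_ops [simp]: "over L (fuse A B) \<longleftrightarrow> over L A \<and> over L B" "over L unit" "over L zero"
    and vars_ops [simp]: "vars (fuse A B) = vars A \<union> vars B" "vars unit = {}" "vars zero = {}"
    and enc_ops [simp]: "length (enc_fm (fuse A B)) = 4 + length (enc_fm A) + length (enc_fm B)"
      "length (enc_fm unit) = 4" "length (enc_fm zero) = 4"
    and identity: "over L A \<Longrightarrow> {#A#} \<turnstile> {#A#}"
    and and_left1: "add_mset A \<Gamma> \<turnstile> \<Delta> \<Longrightarrow> over L B \<Longrightarrow> add_mset (And A B) \<Gamma> \<turnstile> \<Delta>"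
    and and_left2: "add_mset B \<Gamma> \<turnstile> \<Delta> \<Longrightarrow> over L A \<Longrightarrow> add_mset (And A B) \<Gamma> \<turnstile> \<Delta>"
    and and_right: "\<Gamma> \<turnstile> add_mset A \<Delta> \<Longrightarrow> \<Gamma> \<turnstile> add_mset B \<Delta> \<Longrightarrow> \<Gamma> \<turnstile> add_mset (And A B) \<Delta>"
    and or_left: "add_mset A \<Gamma> \<turnstile> \<Delta> \<Longrightarrow> add_mset B \<Gamma> \<turnstile> \<Delta> \<Longrightarrow> add_mset (Or A B) \<Gamma> \<turnstile> \<Delta>"
    and or_right1: "\<Gamma> \<turnstile> add_mset A \<Delta> \<Longrightarrow> over L B \<Longrightarrow> \<Gamma> \<turnstile> add_mset (Or A B) \<Delta>"
    and or_right2: "\<Gamma> \<turnstile> add_mset B \<Delta> \<Longrightarrow> over L A \<Longrightarrow> \<Gamma> \<turnstile> add_mset (Or A B) \<Delta>"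
    and imp_left: "\<Gamma> \<turnstile> add_mset A \<Delta> \<Longrightarrow> add_mset B \<Gamma>' \<turnstile> \<Delta>' \<Longrightarrow>
      add_mset (Imp A B) (\<Gamma> + \<Gamma>') \<turnstile> \<Delta> + \<Delta>'"
    and imp_right: "add_mset A \<Gamma> \<turnstile> add_mset B \<Delta> \<Longrightarrow> \<Gamma> \<turnstile> add_mset (Imp A B) \<Delta>"
    and fuse_left: "add_mset A (add_mset B \<Gamma>) \<turnstile> \<Delta> \<Longrightarrow> add_mset (fuse A B) \<Gamma> \<turnstile> \<Delta>"
    and fuse_right: "\<Gamma> \<turnstile> add_mset A \<Delta> \<Longrightarrow> \<Gamma>' \<turnstile> add_mset B \<Delta>' \<Longrightarrow>
      \<Gamma> + \<Gamma>' \<turnstile> add_mset (fuse A B) (\<Delta> + \<Delta>')"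
    and unit_left: "\<Gamma> \<turnstile> \<Delta> \<Longrightarrow> add_mset unit \<Gamma> \<turnstile> \<Delta>"
    and unit_right: "{#} \<turnstile> {#unit#}"
    and zero_left: "{#zero#} \<turnstile> {#}"
    and zero_right: "\<Gamma> \<turnstile> \<Delta> \<Longrightarrow> (m = Single \<Longrightarrow> \<Delta> = {#}) \<Longrightarrow> \<Gamma> \<turnstile> add_mset zero \<Delta>"
begin

text \<open>Availability of the \<open>Top\<close> and \<open>Bot\<close> axioms with arbitrary
  contexts. It is kept as a proposition about the calculus, so that the same lemmas also cover the
  bases without these axioms, where each block of a rule must have a premise instead.\<close>

definition has_bounds :: bool where
  "has_bounds \<longleftrightarrow>
     (\<forall>\<Gamma> \<Delta>. mover L \<Gamma> \<longrightarrow> mover L \<Delta> \<longrightarrow> (m = Single \<longrightarrow> \<Delta> = {#}) \<longrightarrow> \<Gamma> \<turnstile> add_mset Top \<Delta>) \<and>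
     (\<forall>\<Gamma> \<Delta>. mover L \<Gamma> \<longrightarrow> mover L \<Delta> \<longrightarrow> (m = Single \<longrightarrow> size \<Delta> \<le> 1) \<longrightarrow> add_mset Bot \<Gamma> \<turnstile> \<Delta>)"

text \<open>The slack of 8 pays for the connectives that join this interpolant with others.\<close>

definition itp ::
    "formula multiset \<Rightarrow> formula multiset \<Rightarrow> formula multiset \<Rightarrow> formula multiset \<Rightarrow> nat \<Rightarrow> bool" where
  "itp G1 D1 G2 D2 n \<longleftrightarrow>
     (\<exists>C. over L C \<and> G1 \<turnstile> add_mset C D1 \<and> add_mset C G2 \<turnstile> D2 \<and>
        vars C \<subseteq> mvars (G1 + D1) \<inter> mvars (G2 + D2) \<and> length (enc_fm C) + 8 \<le> n)"

text \<open>All splittings are considered at once, because the splitting of a conclusion determines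
  which ones of the premises are needed. In a single-conclusion calculus the interpolant occupies
  the succedent of the first part, so \<open>D1\<close> has to be empty.\<close>

definition interpolable :: "formula sequent \<Rightarrow> nat \<Rightarrow> bool" where
  "interpolable S n \<longleftrightarrow>
     (\<forall>G1 G2 D1 D2. ante S = G1 + G2 \<longrightarrow> succ S = D1 + D2 \<longrightarrow> (m = Single \<longrightarrow> D1 = {#}) \<longrightarrow>
        itp G1 D1 G2 D2 n)"

lemma itp_mono: "itp G1 D1 G2 D2 n \<Longrightarrow> n \<le> n' \<Longrightarrow> itp G1 D1 G2 D2 n'"
  unfolding itp_def by force

lemma interpolable_mono: "interpolable S n \<Longrightarrow> n \<le> n' \<Longrightarrow> interpolable S n'"
  unfolding interpolable_def using itp_mono by blast

section \<open>Exchanging and joining interpolants\<close>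

text \<open>From \<open>C, G2\<close> proving \<open>D2\<close> one obtains \<open>zero\<close> as
  an additional succedent and then moves \<open>C\<close> to the right. A single-conclusion calculus
  can add \<open>zero\<close> only to an empty succedent. The 8 bits are the tag of
  \<open>Imp\<close> and the code of \<open>zero\<close>.\<close>

lemma itp_swap:
  assumes "itp G1 D1 G2 D2 n" and "m = Single \<Longrightarrow> D2 = {#}"
  shows "itp G2 D2 G1 D1 (n + 8)"
proof -
  from assms(1) obtain C where C: "over L C" "G1 \<turnstile> add_mset C D1" "add_mset C G2 \<turnstile> D2"
    "vars C \<subseteq> mvars (G1 + D1) \<inter> mvars (G2 + D2)" "length (enc_fm C) + 8 \<le> n"
    unfolding itp_def by blast
  have "G2 \<turnstile> add_mset (Imp C zero) D2"
    by (rule imp_right, rule zero_right[OF C(3) assms(2)])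
  moreover have "add_mset (Imp C zero) G1 \<turnstile> D1"
    using imp_left[OF C(2) zero_left] by simp
  ultimately show ?thesis unfolding itp_def using C
    by (intro exI[of _ "Imp C zero"]) auto
qed

text \<open>One block with its active formulas in the second part. All its premises share a context,
  so a single \<open>X\<close> has to fit each of them: the first part proves all interpolants from
  the same context, and each premise projects to its own. \<open>W\<close> stands for the variables
  of the main formula. An \<open>And\<close> costs 4 bits, taken from the slack of the interpolant
  it adds.\<close>

lemma conjunction_block:
  assumes "Fs \<noteq> []"
    and "\<And>\<phi> \<psi>. (\<phi>, \<psi>) \<in> set Fs \<Longrightarrow>
      itp A D1 (B + \<phi>) (\<psi> + D2) (n (\<phi>, \<psi>)) \<and> mvars (\<phi> + \<psi>) \<subseteq> W"
  shows "\<exists>X. over L X \<and> A \<turnstile> add_mset X D1 \<and>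
    (\<forall>(\<phi>, \<psi>) \<in> set Fs. add_mset X (B + \<phi>) \<turnstile> \<psi> + D2) \<and>
    vars X \<subseteq> mvars (A + D1) \<inter> (mvars (B + D2) \<union> W) \<and>
    length (enc_fm X) + 8 \<le> (\<Sum>p\<leftarrow>Fs. n p)"
  using assms
proof (induction Fs rule: list_nonempty_induct)
  case (single p)
  obtain \<phi> \<psi> where p: "p = (\<phi>, \<psi>)" by force
  with single have *: "itp A D1 (B + \<phi>) (\<psi> + D2) (n p)" "mvars (\<phi> + \<psi>) \<subseteq> W" by auto
  then obtain Y where "over L Y" "A \<turnstile> add_mset Y D1" "add_mset Y (B + \<phi>) \<turnstile> \<psi> + D2"
    "vars Y \<subseteq> mvars (A + D1) \<inter> mvars (B + \<phi> + (\<psi> + D2))" "length (enc_fm Y) + 8 \<le> n p"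
    unfolding itp_def by blast
  moreover from this(4) have "vars Y \<subseteq> mvars (A + D1) \<inter> (mvars (B + D2) \<union> W)"
    using *(2) by auto
  ultimately show ?case using p by (intro exI[of _ Y]) simp
next
  case (cons p Fs)
  have "itp A D1 (B + \<phi>) (\<psi> + D2) (n (\<phi>, \<psi>)) \<and> mvars (\<phi> + \<psi>) \<subseteq> W"
    if "(\<phi>, \<psi>) \<in> set Fs" for \<phi> \<psi>
    by (rule cons.prems) (simp add: that)
  from cons.IH[OF this] obtain X where X: "over L X" "A \<turnstile> add_mset X D1"
    "\<forall>(\<phi>, \<psi>) \<in> set Fs. add_mset X (B + \<phi>) \<turnstile> \<psi> + D2"
    "vars X \<subseteq> mvars (A + D1) \<inter> (mvars (B + D2) \<union> W)"
    "length (enc_fm X) + 8 \<le> (\<Sum>p\<leftarrow>Fs. n p)"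
    by blast
  obtain \<phi> \<psi> where p: "p = (\<phi>, \<psi>)" by force
  with cons.prems have *: "itp A D1 (B + \<phi>) (\<psi> + D2) (n p)" "mvars (\<phi> + \<psi>) \<subseteq> W" by auto
  then obtain Y where Y: "over L Y" "A \<turnstile> add_mset Y D1" "add_mset Y (B + \<phi>) \<turnstile> \<psi> + D2"
    "vars Y \<subseteq> mvars (A + D1) \<inter> mvars (B + \<phi> + (\<psi> + D2))" "length (enc_fm Y) + 8 \<le> n p"
    unfolding itp_def by blast
  have "A \<turnstile> add_mset (And Y X) D1" by (rule and_right[OF Y(2) X(2)])
  moreover have "\<forall>(\<phi>, \<psi>) \<in> set (p # Fs). add_mset (And Y X) (B + \<phi>) \<turnstile> \<psi> + D2"
    using X(1,3) Y(1,3) and_left1 and_left2 by (auto simp: p)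
  moreover have "vars Y \<subseteq> mvars (A + D1) \<inter> (mvars (B + D2) \<union> W)"
    using Y(4) *(2) by auto
  ultimately show ?case using X(1,4,5) Y(1,5)
    by (intro exI[of _ "And Y X"] conjI) (assumption | simp)+
qed

text \<open>Dual situation: the active formulas stay in the first part, so the interpolants appear
  as succedents of the premises and have to be weakened to a common succedent.\<close>

lemma disjunction_block:
  assumes "Fs \<noteq> []"
    and "\<And>\<phi>. \<phi> \<in> set Fs \<Longrightarrow> itp (A + \<phi>) D1 B D2 (n \<phi>) \<and> mvars \<phi> \<subseteq> W"
  shows "\<exists>X. over L X \<and> (\<forall>\<phi> \<in> set Fs. A + \<phi> \<turnstile> add_mset X D1) \<and> add_mset X B \<turnstile> D2 \<and>
    vars X \<subseteq> (mvars (A + D1) \<union> W) \<inter> mvars (B + D2) \<and>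
    length (enc_fm X) + 8 \<le> (\<Sum>p\<leftarrow>Fs. n p)"
  using assms
proof (induction Fs rule: list_nonempty_induct)
  case (single p)
  then have *: "itp (A + p) D1 B D2 (n p)" "mvars p \<subseteq> W" by auto
  then obtain Y where "over L Y" "A + p \<turnstile> add_mset Y D1" "add_mset Y B \<turnstile> D2"
    "vars Y \<subseteq> mvars (A + p + D1) \<inter> mvars (B + D2)" "length (enc_fm Y) + 8 \<le> n p"
    unfolding itp_def by blast
  moreover from this(4) have "vars Y \<subseteq> (mvars (A + D1) \<union> W) \<inter> mvars (B + D2)"
    using *(2) by auto
  ultimately show ?case by (intro exI[of _ Y]) simp
next
  case (cons \<phi> Fs)
  have "itp (A + \<phi>) D1 B D2 (n \<phi>) \<and> mvars \<phi> \<subseteq> W" if "\<phi> \<in> set Fs" for \<phi>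
    by (rule cons.prems) (simp add: that)
  from cons.IH[OF this] obtain X where X: "over L X" "\<forall>\<phi> \<in> set Fs. A + \<phi> \<turnstile> add_mset X D1" "add_mset X B \<turnstile> D2"
    "vars X \<subseteq> (mvars (A + D1) \<union> W) \<inter> mvars (B + D2)"
    "length (enc_fm X) + 8 \<le> (\<Sum>p\<leftarrow>Fs. n p)"
    by blast
  from cons.prems have *: "itp (A + \<phi>) D1 B D2 (n \<phi>)" "mvars \<phi> \<subseteq> W" by auto
  then obtain Y where Y: "over L Y" "A + \<phi> \<turnstile> add_mset Y D1" "add_mset Y B \<turnstile> D2"
    "vars Y \<subseteq> mvars (A + \<phi> + D1) \<inter> mvars (B + D2)" "length (enc_fm Y) + 8 \<le> n \<phi>"
    unfolding itp_def by blast
  have "add_mset (Or Y X) B \<turnstile> D2" by (rule or_left[OF Y(3) X(3)])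
  moreover have "\<forall>\<phi> \<in> set (\<phi> # Fs). A + \<phi> \<turnstile> add_mset (Or Y X) D1"
    using X(1,2) Y(1,2) or_right1 or_right2 by auto
  moreover have "vars Y \<subseteq> (mvars (A + D1) \<union> W) \<inter> mvars (B + D2)"
    using Y(4) *(2) by auto
  ultimately show ?case using X(1,4,5) Y(1,5)
    by (intro exI[of _ "Or Y X"] conjI) (assumption | simp)+
qed

text \<open>\<open>B' i\<close> is the second part of context \<open>i\<close>, enlarged by the
  interpolant of its block, so that the premises hold over \<open>B'\<close> and the rule can be
  applied there. The condition with arbitrary \<open>\<Gamma>\<close>, \<open>\<Delta>\<close> says
  that the enlargements may afterwards be merged into \<open>C\<close>, whatever main formula and
  succedent the rule has produced.\<close>

definition combines where
  "combines I Fs A D1 B D2 W C B' \<longleftrightarrow>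
     over L C \<and> sum A I \<turnstile> add_mset C (sum D1 I) \<and>
     (\<forall>i\<in>I. mover L (B' i) \<and> (\<forall>(\<phi>, \<psi>) \<in> set (Fs i). B' i + \<phi> \<turnstile> \<psi> + D2 i)) \<and>
     (\<forall>\<Gamma> \<Delta>. sum B' I + \<Gamma> \<turnstile> \<Delta> \<longrightarrow> add_mset C (sum B I + \<Gamma>) \<turnstile> \<Delta>) \<and>
     vars C \<subseteq> mvars (sum A I + sum D1 I) \<inter> (mvars (sum B I + sum D2 I) \<union> W)"

text \<open>Induction on the set of blocks. Each \<open>fuse\<close> costs 4 bits, which the slack
  of the interpolant of the new block covers.\<close>

lemma combine_blocks_nonempty:
  assumes "finite I" and "\<And>i. i \<in> I \<Longrightarrow> Fs i \<noteq> []"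
    and "\<And>i \<phi> \<psi>. i \<in> I \<Longrightarrow> (\<phi>, \<psi>) \<in> set (Fs i) \<Longrightarrow>
      itp (A i) (D1 i) (B i + \<phi>) (\<psi> + D2 i) (n i (\<phi>, \<psi>)) \<and> mvars (\<phi> + \<psi>) \<subseteq> W"
    and "\<And>i. i \<in> I \<Longrightarrow> mover L (B i)"
  shows "\<exists>C B'. combines I Fs A D1 B D2 W C B' \<and>
    length (enc_fm C) \<le> 4 + (\<Sum>i\<in>I. \<Sum>p\<leftarrow>Fs i. n i p)"
  using assms
proof (induction I rule: finite_induct)
  case empty
  \<comment> \<open>The empty fusion is \<open>unit\<close>, whose 4 bits are the constant of the
    bound.\<close>
  show ?case
    by (intro exI[of _ unit] exI[of _ B]) (auto simp: combines_def unit_right unit_left)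
next
  case (insert i I)
  have "\<exists>C B'. combines I Fs A D1 B D2 W C B' \<and>
    length (enc_fm C) \<le> 4 + (\<Sum>i\<in>I. \<Sum>p\<leftarrow>Fs i. n i p)"
    by (rule insert.IH) (rule insert.prems; simp)+
  then obtain C B' where C: "combines I Fs A D1 B D2 W C B'"
    and Cn: "length (enc_fm C) \<le> 4 + (\<Sum>i\<in>I. \<Sum>p\<leftarrow>Fs i. n i p)"
    by blast
  obtain X where X: "over L X" "A i \<turnstile> add_mset X (D1 i)"
    "\<forall>(\<phi>, \<psi>) \<in> set (Fs i). add_mset X (B i + \<phi>) \<turnstile> \<psi> + D2 i"
    "vars X \<subseteq> mvars (A i + D1 i) \<inter> (mvars (B i + D2 i) \<union> W)"
    "length (enc_fm X) + 8 \<le> (\<Sum>p\<leftarrow>Fs i. n i p)"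
    using conjunction_block[OF insert.prems(1,2), of i i] by blast
  \<comment> \<open>Block \<open>i\<close> lies outside the smaller index set, so overwriting its
    entry of \<open>B'\<close> disturbs nothing.\<close>
  let ?B = "B'(i := add_mset X (B i))"
  have sumB: "sum ?B I = sum B' I" using insert.hyps by (auto intro: sum.cong)
  have "combines (insert i I) Fs A D1 B D2 W (fuse X C) ?B"
    unfolding combines_def
  proof (intro conjI allI impI)
    show "over L (fuse X C)" using X(1) C by (auto simp: combines_def)
    show "sum A (insert i I) \<turnstile> add_mset (fuse X C) (sum D1 (insert i I))"
      using fuse_right[OF X(2), of "sum A I" C "sum D1 I"] C insert.hyps by (auto simp: combines_def)
    show "\<forall>j\<in>insert i I. mover L (?B j) \<and> (\<forall>(\<phi>, \<psi>) \<in> set (Fs j). ?B j + \<phi> \<turnstile> \<psi> + D2 j)"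
      using C X insert.prems(3) insert.hyps by (auto simp: combines_def)
    show "vars (fuse X C) \<subseteq> mvars (sum A (insert i I) + sum D1 (insert i I)) \<inter>
      (mvars (sum B (insert i I) + sum D2 (insert i I)) \<union> W)"
      using X(4) C insert.hyps by (auto simp: combines_def)
    fix \<Gamma> \<Delta> assume "sum ?B (insert i I) + \<Gamma> \<turnstile> \<Delta>"
    then have "sum B' I + add_mset X (B i + \<Gamma>) \<turnstile> \<Delta>"
      using insert.hyps sumB by (simp add: ac_simps)
    then have "add_mset C (sum B I + add_mset X (B i + \<Gamma>)) \<turnstile> \<Delta>"
      using C unfolding combines_def by blast
    then show "add_mset (fuse X C) (sum B (insert i I) + \<Gamma>) \<turnstile> \<Delta>"
      using insert.hyps by (intro fuse_left) (simp add: ac_simps add_mset_commute)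
  qed
  moreover have "length (enc_fm (fuse X C)) \<le> 4 + (\<Sum>i\<in>insert i I. \<Sum>p\<leftarrow>Fs i. n i p)"
    using X(5) Cn insert.hyps by simp
  ultimately show ?case by blast
qed

text \<open>
  The number of blocks without premises is not bounded by the size of the proof, so one \<open>\<top>\<close> has to
  serve all of them.
\<close>

lemma combine_blocks:
  assumes fin: "finite I" and bnd: "has_bounds \<or> (\<forall>i\<in>I. Fs i \<noteq> [])"
    and prem: "\<And>i \<phi> \<psi>. i \<in> I \<Longrightarrow> (\<phi>, \<psi>) \<in> set (Fs i) \<Longrightarrow>
      itp (A i) (D1 i) (B i + \<phi>) (\<psi> + D2 i) (n i (\<phi>, \<psi>)) \<and> mvars (\<phi> + \<psi>) \<subseteq> W"
    and ov: "\<And>i. i \<in> I \<Longrightarrow> mover L (A i) \<and> mover L (B i) \<and> mover L (D1 i)"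
    and sg: "\<And>i. i \<in> I \<Longrightarrow> m = Single \<Longrightarrow> D1 i = {#}"
  shows "\<exists>C B'. combines I Fs A D1 B D2 W C B' \<and>
    length (enc_fm C) \<le> 12 + (\<Sum>i\<in>I. \<Sum>p\<leftarrow>Fs i. n i p)"
proof -
  define J where "J = {i \<in> I. Fs i \<noteq> []}"
  define E where "E = {i \<in> I. Fs i = []}"
  have IJE: "I = J \<union> E" "J \<inter> E = {}" and finJE: "finite J" "finite E"
    using fin by (auto simp: J_def E_def)
  have sumI: "sum f I = sum f J + sum f E" for f :: "'a \<Rightarrow> formula multiset"
    unfolding IJE(1) using IJE(2) finJE by (simp add: sum.union_disjoint)
  have "\<exists>C B'. combines J Fs A D1 B D2 W C B' \<and>
    length (enc_fm C) \<le> 4 + (\<Sum>i\<in>J. \<Sum>p\<leftarrow>Fs i. n i p)"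
  proof (rule combine_blocks_nonempty)
    fix i \<phi> \<psi> assume "i \<in> J" "(\<phi>, \<psi>) \<in> set (Fs i)"
    then show "itp (A i) (D1 i) (B i + \<phi>) (\<psi> + D2 i) (n i (\<phi>, \<psi>)) \<and> mvars (\<phi> + \<psi>) \<subseteq> W"
      by (intro prem) (simp_all add: J_def)
  qed (use finJE ov in \<open>simp_all add: J_def\<close>)
  then obtain C B' where C: "combines J Fs A D1 B D2 W C B'"
    and Cn: "length (enc_fm C) \<le> 4 + (\<Sum>i\<in>J. \<Sum>p\<leftarrow>Fs i. n i p)" by blast
  have n: "(\<Sum>i\<in>I. \<Sum>p\<leftarrow>Fs i. n i p) = (\<Sum>i\<in>J. \<Sum>p\<leftarrow>Fs i. n i p)"
    by (rule sum.mono_neutral_right) (use fin in \<open>auto simp: J_def\<close>)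
  show ?thesis
  proof (cases "E = {}")
    case True
    then have "I = J" using IJE by simp
    with C Cn show ?thesis by fastforce
  next
    case False
    then obtain e where e: "e \<in> E" by blast
    have hb: has_bounds using bnd e by (auto simp: E_def)
    \<comment> \<open>The first parts of all empty blocks together prove one \<open>Top\<close>. It
      is stored in the context of a single such block \<open>e\<close>, where no premise has to be
      checked.\<close>
    let ?B = "\<lambda>i. if i \<in> J then B' i else if i = e then add_mset Top (B i) else B i"
    have sJ: "sum ?B J = sum B' J" by (auto intro: sum.cong)
    have sE: "sum ?B E = add_mset Top (sum B E)"
    proof -
      have "e \<notin> J" using e IJE by auto
      have "sum ?B (E - {e}) = sum B (E - {e})" using IJE(2) by (intro sum.cong) auto
      with \<open>e \<notin> J\<close> show ?thesis
        using sum.remove[OF finJE(2) e, of ?B] sum.remove[OF finJE(2) e, of B] by simp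
    qed
    have "sum A E \<turnstile> add_mset Top (sum D1 E)"
      using hb ov sg IJE finJE by (auto simp: has_bounds_def mover_sum)
    moreover have CJ: "sum A J \<turnstile> add_mset C (sum D1 J)" using C by (simp add: combines_def)
    ultimately have "sum A I \<turnstile> add_mset (fuse Top C) (sum D1 I)"
      using fuse_right[of "sum A E" Top "sum D1 E" "sum A J" C "sum D1 J"]
      by (simp add: sumI ac_simps)
    moreover have "\<forall>i\<in>I. mover L (?B i) \<and> (\<forall>(\<phi>, \<psi>) \<in> set (Fs i). ?B i + \<phi> \<turnstile> \<psi> + D2 i)"
    proof
      fix i assume "i \<in> I"
      show "mover L (?B i) \<and> (\<forall>(\<phi>, \<psi>) \<in> set (Fs i). ?B i + \<phi> \<turnstile> \<psi> + D2 i)"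
      proof (cases "i \<in> J")
        case True
        then show ?thesis using C unfolding combines_def by simp
      next
        case False
        then have "Fs i = []" using \<open>i \<in> I\<close> by (simp add: J_def)
        then show ?thesis using False ov[OF \<open>i \<in> I\<close>] by auto
      qed
    qed
    moreover have "add_mset (fuse Top C) (sum B I + \<Gamma>) \<turnstile> \<Delta>" if "sum ?B I + \<Gamma> \<turnstile> \<Delta>" for \<Gamma> \<Delta>
    proof -
      have "sum B' J + (add_mset Top (sum B E) + \<Gamma>) \<turnstile> \<Delta>"
        using that unfolding sumI sJ sE by (simp add: ac_simps)
      then have "add_mset C (sum B J + (add_mset Top (sum B E) + \<Gamma>)) \<turnstile> \<Delta>"
        using C unfolding combines_def by blast
      then show ?thesis
        by (intro fuse_left) (simp add: sumI ac_simps add_mset_commute)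
    qed
    moreover have "vars (fuse Top C) \<subseteq> mvars (sum A I + sum D1 I) \<inter> (mvars (sum B I + sum D2 I) \<union> W)"
      using C by (auto simp: combines_def sumI)
    moreover have "over L (fuse Top C)" using C by (simp add: combines_def)
    ultimately have "combines I Fs A D1 B D2 W (fuse Top C) ?B"
      unfolding combines_def by blast
    \<comment> \<open>The 8 additional bits are \<open>Top\<close> and the tag of
      \<open>fuse\<close>.\<close>
    moreover have "length (enc_fm (fuse Top C)) \<le> 12 + (\<Sum>i\<in>I. \<Sum>p\<leftarrow>Fs i. n i p)"
      using Cn n by simp
    ultimately show ?thesis by blast
  qed
qed

section \<open>Rules in block form, with the main formula in either part\<close>

text \<open>
  Closure under a rule given by its instances: block \<open>i\<close> has the contexts \<open>\<gamma> i\<close> and, if \<open>i \<in> J\<close>, \<open>\<delta> i\<close>,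
  and \<open>Fs i\<close> lists the active formulas of its premises.
\<close>

definition admits where
  "admits I Fs J \<mu> \<nu> \<longleftrightarrow>
     (\<forall>\<gamma> \<delta>. (\<forall>i\<in>I. mover L (\<gamma> i) \<and> mover L (\<delta> i) \<and> (i \<notin> J \<longrightarrow> \<delta> i = {#}) \<and>
               (\<forall>(\<phi>, \<psi>) \<in> set (Fs i). \<gamma> i + \<phi> \<turnstile> \<psi> + \<delta> i)) \<longrightarrow>
        (m = Single \<longrightarrow> size (sum \<delta> I + \<nu>) \<le> 1) \<longrightarrow> sum \<gamma> I + \<mu> \<turnstile> sum \<delta> I + \<nu>)"

lemma admitsD:
  assumes "admits I Fs J \<mu> \<nu>"
    and "\<And>i. i \<in> I \<Longrightarrow> mover L (\<gamma> i) \<and> mover L (\<delta> i) \<and> (i \<notin> J \<longrightarrow> \<delta> i = {#}) \<and>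
      (\<forall>(\<phi>, \<psi>) \<in> set (Fs i). \<gamma> i + \<phi> \<turnstile> \<psi> + \<delta> i)"
    and "m = Single \<Longrightarrow> size (sum \<delta> I + \<nu>) \<le> 1"
  shows "sum \<gamma> I + \<mu> \<turnstile> sum \<delta> I + \<nu>"
  using assms unfolding admits_def by blast

text \<open>The rule is applied to the enlarged contexts of the second part, which contains the main
  formula; this is why the variables of active formulas are harmless there. The constant 20 consists
  of 12 for joining the blocks and the slack 8.\<close>

lemma itp_main_right:
  assumes adm: "admits I Fs J \<mu> \<nu>" and fin: "finite I"
    and bnd: "has_bounds \<or> (\<forall>i\<in>I. Fs i \<noteq> [])"
    and prem: "\<And>i \<phi> \<psi>. i \<in> I \<Longrightarrow> (\<phi>, \<psi>) \<in> set (Fs i) \<Longrightarrow>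
      itp (\<gamma>1 i) (\<delta>1 i) (\<gamma>2 i + \<phi>) (\<psi> + \<delta>2 i) (n i (\<phi>, \<psi>)) \<and> mvars (\<phi> + \<psi>) \<subseteq> mvars (\<mu> + \<nu>)"
    and ov: "\<And>i. i \<in> I \<Longrightarrow> mover L (\<gamma>1 i) \<and> mover L (\<gamma>2 i) \<and> mover L (\<delta>1 i) \<and> mover L (\<delta>2 i)"
    and J: "\<And>i. i \<in> I \<Longrightarrow> i \<notin> J \<Longrightarrow> \<delta>2 i = {#}"
    and sg: "\<And>i. i \<in> I \<Longrightarrow> m = Single \<Longrightarrow> \<delta>1 i = {#}"
    and sg2: "m = Single \<Longrightarrow> size (sum \<delta>2 I + \<nu>) \<le> 1"
  shows "itp (sum \<gamma>1 I) (sum \<delta>1 I) (sum \<gamma>2 I + \<mu>) (sum \<delta>2 I + \<nu>)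
    (20 + (\<Sum>i\<in>I. \<Sum>p\<leftarrow>Fs i. n i p))"
proof -
  have "\<exists>C B'. combines I Fs \<gamma>1 \<delta>1 \<gamma>2 \<delta>2 (mvars (\<mu> + \<nu>)) C B' \<and>
    length (enc_fm C) \<le> 12 + (\<Sum>i\<in>I. \<Sum>p\<leftarrow>Fs i. n i p)"
    by (rule combine_blocks[OF fin bnd prem]) (use ov sg in blast)+
  then obtain C B' where C: "combines I Fs \<gamma>1 \<delta>1 \<gamma>2 \<delta>2 (mvars (\<mu> + \<nu>)) C B'"
    and Cn: "length (enc_fm C) \<le> 12 + (\<Sum>i\<in>I. \<Sum>p\<leftarrow>Fs i. n i p)" by blast
  have "sum B' I + \<mu> \<turnstile> sum \<delta>2 I + \<nu>"
    by (rule admitsD[OF adm]) (use C ov J sg2 in \<open>unfold combines_def, blast+\<close>)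
  then have "add_mset C (sum \<gamma>2 I + \<mu>) \<turnstile> sum \<delta>2 I + \<nu>" using C unfolding combines_def by blast
  moreover have "sum \<gamma>1 I \<turnstile> add_mset C (sum \<delta>1 I)" "over L C"
    "vars C \<subseteq> mvars (sum \<gamma>1 I + sum \<delta>1 I) \<inter> mvars (sum \<gamma>2 I + \<mu> + (sum \<delta>2 I + \<nu>))"
    using C unfolding combines_def by auto
  ultimately show ?thesis using Cn unfolding itp_def by (intro exI[of _ C]) simp
qed

text \<open>Block \<open>k\<close> is the one that carries the succedent \<open>\<Delta>\<close>, so
  its interpolant \<open>D\<close> must be a succedent of the first part, whereas for all other
  blocks the roles of the parts are exchanged. Applying the rule with \<open>D\<close> in place of
  \<open>\<Delta>\<close> gives \<open>D\<close> from \<open>C\<close> and the first part. The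
  constant 28 is 12 for \<open>C\<close>, 4 for \<open>D\<close>, 4 for \<open>Imp\<close> and the
  slack 8.\<close>

lemma itp_main_left_single:
  assumes adm: "admits I Fs J \<mu> {#}" and fin: "finite I"
    and bnd: "has_bounds \<or> (\<forall>i\<in>I. Fs i \<noteq> [])" and k: "k \<in> I" "k \<in> J"
    and prem: "\<And>i \<phi> \<psi>. i \<in> I \<Longrightarrow> i \<noteq> k \<Longrightarrow> (\<phi>, \<psi>) \<in> set (Fs i) \<Longrightarrow>
      itp (\<gamma>2 i) {#} (\<gamma>1 i + \<phi>) \<psi> (n i (\<phi>, \<psi>)) \<and> mvars (\<phi> + \<psi>) \<subseteq> mvars \<mu>"
    and premk: "\<And>\<phi> \<psi>. (\<phi>, \<psi>) \<in> set (Fs k) \<Longrightarrow> \<psi> = {#} \<and>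
      itp (\<gamma>1 k + \<phi>) {#} (\<gamma>2 k) \<Delta> (n k (\<phi>, \<psi>)) \<and> mvars \<phi> \<subseteq> mvars \<mu>"
    and ov: "\<And>i. i \<in> I \<Longrightarrow> mover L (\<gamma>1 i) \<and> mover L (\<gamma>2 i)"
    and \<Delta>: "mover L \<Delta>" "m = Single \<Longrightarrow> size \<Delta> \<le> 1"
  shows "itp (sum \<gamma>1 I + \<mu>) {#} (sum \<gamma>2 I) \<Delta> (28 + (\<Sum>i\<in>I. \<Sum>p\<leftarrow>Fs i. n i p))"
proof -
  let ?I = "I - {k}"
  have "\<exists>C B'. combines ?I Fs \<gamma>2 (\<lambda>_. {#}) \<gamma>1 (\<lambda>_. {#}) (mvars \<mu>) C B' \<and>
    length (enc_fm C) \<le> 12 + (\<Sum>i\<in>?I. \<Sum>p\<leftarrow>Fs i. n i p)"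
  proof (rule combine_blocks)
    fix i \<phi> \<psi> assume "i \<in> ?I" "(\<phi>, \<psi>) \<in> set (Fs i)"
    then show "itp (\<gamma>2 i) {#} (\<gamma>1 i + \<phi>) (\<psi> + {#}) (n i (\<phi>, \<psi>)) \<and> mvars (\<phi> + \<psi>) \<subseteq> mvars \<mu>"
      using prem[of i \<phi> \<psi>] by simp
  qed (use fin bnd ov in auto)
  then obtain C B' where C: "combines ?I Fs \<gamma>2 (\<lambda>_. {#}) \<gamma>1 (\<lambda>_. {#}) (mvars \<mu>) C B'"
    and Cn: "length (enc_fm C) \<le> 12 + (\<Sum>i\<in>?I. \<Sum>p\<leftarrow>Fs i. n i p)" by blast
  have "\<exists>D. over L D \<and> (\<forall>\<phi> \<in> set (map fst (Fs k)). \<gamma>1 k + \<phi> \<turnstile> {#D#}) \<and> add_mset D (\<gamma>2 k) \<turnstile> \<Delta> \<and>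
    vars D \<subseteq> (mvars (\<gamma>1 k) \<union> mvars \<mu>) \<inter> mvars (\<gamma>2 k + \<Delta>) \<and>
    length (enc_fm D) \<le> 4 + (\<Sum>p\<leftarrow>Fs k. n k p)"
  \<comment> \<open>The empty disjunction is \<open>Bot\<close>, and its 4 bits are the constant of
    the bound on \<open>D\<close>; otherwise the slack leaves more than enough room.\<close>
  proof (cases "Fs k = []")
    case True
    then have has_bounds using bnd k by blast
    then have "add_mset Bot (\<gamma>2 k) \<turnstile> \<Delta>" using ov k \<Delta> unfolding has_bounds_def by blast
    with True show ?thesis by (intro exI[of _ Bot]) simp
  next
    case False
    have "(\<Sum>\<phi>\<leftarrow>map fst (Fs k). n k (\<phi>, {#})) = (\<Sum>p\<leftarrow>Fs k. n k p)"
      using premk by (force intro!: arg_cong[of _ _ sum_list] simp: comp_def)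
    moreover have "itp (\<gamma>1 k + \<phi>) {#} (\<gamma>2 k) \<Delta> (n k (\<phi>, {#})) \<and> mvars \<phi> \<subseteq> mvars \<mu>"
      if "\<phi> \<in> set (map fst (Fs k))" for \<phi>
      using that premk by fastforce
    ultimately show ?thesis
      using disjunction_block[of "map fst (Fs k)" "\<gamma>1 k" "{#}" "\<gamma>2 k" \<Delta> "\<lambda>\<phi>. n k (\<phi>, {#})" "mvars \<mu>"]
        False by fastforce
  qed
  then obtain D where D: "over L D" "\<And>\<phi> \<psi>. (\<phi>, \<psi>) \<in> set (Fs k) \<Longrightarrow> \<gamma>1 k + \<phi> \<turnstile> {#D#}"
    "add_mset D (\<gamma>2 k) \<turnstile> \<Delta>" "vars D \<subseteq> (mvars (\<gamma>1 k) \<union> mvars \<mu>) \<inter> mvars (\<gamma>2 k + \<Delta>)"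
    "length (enc_fm D) \<le> 4 + (\<Sum>p\<leftarrow>Fs k. n k p)" by force
  \<comment> \<open>Only block \<open>k\<close> has a succedent context, and its left context gets
    no interpolant; the other left contexts are the enlarged ones.\<close>
  let ?\<gamma> = "B'(k := \<gamma>1 k)" and ?\<delta> = "\<lambda>i. if i = k then {#D#} else {#}"
  have sumI: "sum f I = f k + sum f ?I" for f :: "'a \<Rightarrow> formula multiset"
    using fin k(1) by (rule sum.remove)
  have "sum ?\<delta> ?I = {#}" "sum ?\<gamma> ?I = sum B' ?I" by (auto intro: sum.cong)
  then have s: "sum ?\<delta> I = {#D#}" "sum ?\<gamma> I = \<gamma>1 k + sum B' ?I" by (simp_all add: sumI)
  have "mover L (?\<gamma> i) \<and> mover L (?\<delta> i) \<and> (i \<notin> J \<longrightarrow> ?\<delta> i = {#}) \<and>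
      (\<forall>(\<phi>, \<psi>) \<in> set (Fs i). ?\<gamma> i + \<phi> \<turnstile> \<psi> + ?\<delta> i)" if "i \<in> I" for i
  proof (cases "i = k")
    case True
    then show ?thesis using D(1,2) k ov premk by fastforce
  next
    case False
    then show ?thesis using C that unfolding combines_def by auto
  qed
  then have "sum ?\<gamma> I + \<mu> \<turnstile> sum ?\<delta> I + {#}"
  proof (rule admitsD[OF adm])
    show "size (sum ?\<delta> I + {#}) \<le> 1" unfolding s(1) by simp
  qed
  then have "sum B' ?I + (\<gamma>1 k + \<mu>) \<turnstile> {#D#}" unfolding s by (simp add: ac_simps)
  then have "add_mset C (sum \<gamma>1 ?I + (\<gamma>1 k + \<mu>)) \<turnstile> {#D#}" using C unfolding combines_def by blast
  then have "sum \<gamma>1 I + \<mu> \<turnstile> {#Imp C D#}" by (intro imp_right) (simp add: sumI[of \<gamma>1] ac_simps)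
  moreover have "add_mset (Imp C D) (sum \<gamma>2 I) \<turnstile> \<Delta>"
    using imp_left[of "sum \<gamma>2 ?I" C "{#}" D "\<gamma>2 k" \<Delta>] C D(3)
    by (simp add: sumI[of \<gamma>2] combines_def ac_simps)
  moreover have "vars (Imp C D) \<subseteq> mvars (sum \<gamma>1 I + \<mu> + {#}) \<inter> mvars (sum \<gamma>2 I + \<Delta>)"
    using C D(4) unfolding sumI[of \<gamma>1] sumI[of \<gamma>2] combines_def by auto
  moreover have "length (enc_fm (Imp C D)) + 8 \<le> 28 + (\<Sum>i\<in>I. \<Sum>p\<leftarrow>Fs i. n i p)"
    using Cn D(5) fin k by (simp add: sum.remove)
  moreover have "over L (Imp C D)" using C D(1) by (simp add: combines_def)
  ultimately show ?thesis unfolding itp_def by blast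
qed

text \<open>A splitting of the conclusion refines to splittings of the contexts, and the main
  formula falls entirely into one part. The bound 28 is enough for all cases: 20 directly, 20 plus 8
  after an exchange of the parts, and 28 for the implication.\<close>

lemma admits_interpolable:
  assumes adm: "admits I Fs J \<mu> \<nu>" and fin: "finite I" and main: "\<mu> + \<nu> = {#\<chi>#}"
    and bnd: "has_bounds \<or> (\<forall>i\<in>I. Fs i \<noteq> [])"
    and vs: "\<And>i \<phi> \<psi>. i \<in> I \<Longrightarrow> (\<phi>, \<psi>) \<in> set (Fs i) \<Longrightarrow> mvars (\<phi> + \<psi>) \<subseteq> vars \<chi>"
    and shape: "\<And>i \<phi> \<psi>. m = Single \<Longrightarrow> \<nu> = {#} \<Longrightarrow> i \<in> I \<Longrightarrow> i \<in> J \<Longrightarrow> (\<phi>, \<psi>) \<in> set (Fs i) \<Longrightarrow> \<psi> = {#}"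
    and ov: "\<And>i. i \<in> I \<Longrightarrow> mover L (\<gamma> i) \<and> mover L (\<delta> i)"
    and J: "\<And>i. i \<in> I \<Longrightarrow> i \<notin> J \<Longrightarrow> \<delta> i = {#}"
    and sg: "m = Single \<Longrightarrow> size (sum \<delta> I + \<nu>) \<le> 1"
    and IH: "\<And>i \<phi> \<psi>. i \<in> I \<Longrightarrow> (\<phi>, \<psi>) \<in> set (Fs i) \<Longrightarrow>
      interpolable (\<gamma> i + \<phi> \<Rrightarrow> \<psi> + \<delta> i) (n i (\<phi>, \<psi>))"
  shows "interpolable (sum \<gamma> I + \<mu> \<Rrightarrow> sum \<delta> I + \<nu>) (28 + (\<Sum>i\<in>I. \<Sum>p\<leftarrow>Fs i. n i p))"
  unfolding interpolable_def sequent.sel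
proof (intro allI impI)
  fix G1 G2 D1 D2
  assume G: "sum \<gamma> I + \<mu> = G1 + G2" and D: "sum \<delta> I + \<nu> = D1 + D2" and S: "m = Single \<longrightarrow> D1 = {#}"
  let ?n = "\<Sum>i\<in>I. \<Sum>p\<leftarrow>Fs i. n i p"
  obtain X1 X2 \<mu>1 \<mu>2 where X: "sum \<gamma> I = X1 + X2" "\<mu> = \<mu>1 + \<mu>2" "G1 = X1 + \<mu>1" "G2 = X2 + \<mu>2"
    using mset_refinement[OF G] .
  obtain Y1 Y2 \<nu>1 \<nu>2 where Y: "sum \<delta> I = Y1 + Y2" "\<nu> = \<nu>1 + \<nu>2" "D1 = Y1 + \<nu>1" "D2 = Y2 + \<nu>2"
    using mset_refinement[OF D] .
  obtain \<gamma>1 \<gamma>2 where \<gamma>: "\<And>i. i \<in> I \<Longrightarrow> \<gamma> i = \<gamma>1 i + \<gamma>2 i" "X1 = sum \<gamma>1 I" "X2 = sum \<gamma>2 I"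
    using sum_mset_split[OF fin X(1)] by blast
  obtain \<delta>1 \<delta>2 where \<delta>: "\<And>i. i \<in> I \<Longrightarrow> \<delta> i = \<delta>1 i + \<delta>2 i" "Y1 = sum \<delta>1 I" "Y2 = sum \<delta>2 I"
    using sum_mset_split[OF fin Y(1)] by blast
  have \<delta>1: "\<delta>1 i = {#}" if "m = Single" "i \<in> I" for i
    using S that Y(3) \<delta>(2) fin by (simp add: sum_mset_eq_empty_iff)
  have ov': "mover L (\<gamma>1 i) \<and> mover L (\<gamma>2 i) \<and> mover L (\<delta>1 i) \<and> mover L (\<delta>2 i)" if "i \<in> I" for i
    using ov[OF that] by (simp add: \<gamma>(1)[OF that] \<delta>(1)[OF that])
  have J': "\<delta>1 i = {#} \<and> \<delta>2 i = {#}" if "i \<in> I" "i \<notin> J" for i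
    using J[OF that] \<delta>(1)[OF that(1)] by simp
  have vs': "mvars (\<phi> + \<psi>) \<subseteq> mvars (\<mu> + \<nu>)" if "i \<in> I" "(\<phi>, \<psi>) \<in> set (Fs i)" for i \<phi> \<psi>
    using vs[OF that] by (simp add: main)
  \<comment> \<open>As the premises are interpolable for every splitting, their active formulas may
    be placed in whichever part the case at hand needs.\<close>
  have split: "itp A B C E (n i (\<phi>, \<psi>))"
    if "i \<in> I" "(\<phi>, \<psi>) \<in> set (Fs i)" "\<gamma> i + \<phi> = A + C" "\<psi> + \<delta> i = B + E" "m = Single \<Longrightarrow> B = {#}"
    for i \<phi> \<psi> A B C E
    using IH[OF that(1,2)] that(3-5) unfolding interpolable_def by simp
  have "(\<mu>1 + \<nu>1) + (\<mu>2 + \<nu>2) = {#\<chi>#}"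
    using main X(2) Y(2) by (simp add: ac_simps)
  then have "\<mu>1 + \<nu>1 = {#} \<or> \<mu>2 + \<nu>2 = {#}"
    unfolding union_is_single by blast
  then consider (right) "\<mu>1 = {#}" "\<nu>1 = {#}" | (left) "\<mu>2 = {#}" "\<nu>2 = {#}" by auto
  then show "itp G1 D1 G2 D2 (28 + ?n)"
  proof cases
    case right
    have "itp (sum \<gamma>1 I) (sum \<delta>1 I) (sum \<gamma>2 I + \<mu>) (sum \<delta>2 I + \<nu>) (20 + ?n)"
    proof (rule itp_main_right[OF adm fin bnd])
      fix i \<phi> \<psi> assume i: "i \<in> I" "(\<phi>, \<psi>) \<in> set (Fs i)"
      show "itp (\<gamma>1 i) (\<delta>1 i) (\<gamma>2 i + \<phi>) (\<psi> + \<delta>2 i) (n i (\<phi>, \<psi>)) \<and> mvars (\<phi> + \<psi>) \<subseteq> mvars (\<mu> + \<nu>)"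
        using i \<delta>1 vs'[OF i] by (intro conjI split) (simp_all add: \<gamma>(1) \<delta>(1) ac_simps)
    next
      assume "m = Single"
      then show "size (sum \<delta>2 I + \<nu>) \<le> 1" using sg Y(1) \<delta>(3) by simp
    qed (use ov' J' \<delta>1 in auto)
    then show ?thesis using X Y \<gamma> \<delta> right by (auto intro: itp_mono)
  next
    case left
    show ?thesis
    \<comment> \<open>After an exchange \<open>D2\<close> belongs to the first part, which a
      single-conclusion calculus allows only when it is empty. The excluded case is the one that
      needs a genuine implication.\<close>
    proof (cases "m = Single \<and> sum \<delta> I \<noteq> {#}")
      case False
      have 2: "\<delta>2 i = {#}" if "m = Single" "i \<in> I" for i
        using False that \<delta>(1) fin by (simp add: sum_mset_eq_empty_iff)
      have "itp (sum \<gamma>2 I) (sum \<delta>2 I) (sum \<gamma>1 I + \<mu>) (sum \<delta>1 I + \<nu>) (20 + ?n)"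
      proof (rule itp_main_right[OF adm fin bnd])
        fix i \<phi> \<psi> assume i: "i \<in> I" "(\<phi>, \<psi>) \<in> set (Fs i)"
        show "itp (\<gamma>2 i) (\<delta>2 i) (\<gamma>1 i + \<phi>) (\<psi> + \<delta>1 i) (n i (\<phi>, \<psi>)) \<and> mvars (\<phi> + \<psi>) \<subseteq> mvars (\<mu> + \<nu>)"
          using i 2 vs'[OF i] by (intro conjI split) (simp_all add: \<gamma>(1) \<delta>(1) ac_simps)
      next
        assume "m = Single"
        then show "size (sum \<delta>1 I + \<nu>) \<le> 1" using sg Y(1) \<delta>(2) by simp
      qed (use ov' J' 2 in auto)
      then have 3: "itp G2 D2 G1 D1 (20 + ?n)" using X Y \<gamma> \<delta> left by simp
      have "m = Single \<Longrightarrow> D1 = {#}" using S by simp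
      from itp_mono[OF itp_swap[OF 3 this]] show ?thesis by simp
    next
      case True
      \<comment> \<open>The succedent has at most one formula, so it comes from this block alone and
        the other right contexts are empty.\<close>
      then obtain k where k: "k \<in> I" "\<delta> k \<noteq> {#}" by (metis sum.neutral)
      have sumk: "sum \<delta> I = \<delta> k + sum \<delta> (I - {k})" using fin k(1) by (rule sum.remove)
      then have size1: "size (\<delta> k) + size (sum \<delta> (I - {k})) \<le> 1"
        using sg True by (metis add_leD1 size_union)
      have "\<nu> = {#}" "D1 = {#}" using left Y S True by auto
      have "size (\<delta> k) \<ge> 1" using k(2) by (simp add: Suc_le_eq nonempty_has_size)
      with size1 have "size (sum \<delta> (I - {k})) = 0" by linarith
      then have "sum \<delta> (I - {k}) = {#}" by (simp only: size_eq_0_iff_empty)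
      then have other: "\<delta> i = {#}" if "i \<in> I" "i \<noteq> k" for i
        using that fin by (simp add: sum_mset_eq_empty_iff)
      have D2: "D2 = \<delta> k" using D \<open>\<nu> = {#}\<close> \<open>D1 = {#}\<close> sumk \<open>sum \<delta> (I - {k}) = {#}\<close> by simp
      have "k \<in> J" using J k by blast
      have "itp (sum \<gamma>1 I + \<mu>) {#} (sum \<gamma>2 I) (\<delta> k) (28 + ?n)"
      proof (rule itp_main_left_single[OF _ fin bnd k(1) \<open>k \<in> J\<close>])
        show "admits I Fs J \<mu> {#}" using adm \<open>\<nu> = {#}\<close> by simp
      next
        fix i \<phi> \<psi> assume i: "i \<in> I" "i \<noteq> k" "(\<phi>, \<psi>) \<in> set (Fs i)"
        show "itp (\<gamma>2 i) {#} (\<gamma>1 i + \<phi>) \<psi> (n i (\<phi>, \<psi>)) \<and> mvars (\<phi> + \<psi>) \<subseteq> mvars \<mu>"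
          using i vs'[OF i(1,3)] other[OF i(1,2)] \<open>\<nu> = {#}\<close>
          by (intro conjI split) (simp_all add: \<gamma>(1) ac_simps)
      next
        fix \<phi> \<psi> assume i: "(\<phi>, \<psi>) \<in> set (Fs k)"
        have "\<psi> = {#}" using shape True \<open>\<nu> = {#}\<close> k(1) \<open>k \<in> J\<close> i by blast
        then show "\<psi> = {#} \<and> itp (\<gamma>1 k + \<phi>) {#} (\<gamma>2 k) (\<delta> k) (n k (\<phi>, \<psi>)) \<and> mvars \<phi> \<subseteq> mvars \<mu>"
          using i vs'[OF k(1) i] \<open>\<nu> = {#}\<close> k(1)
          by (intro conjI split) (simp_all add: \<gamma>(1) ac_simps)
      next
        assume "m = Single"
        then show "size (\<delta> k) \<le> 1" using size1 by linarith
      qed (use ov ov' k in auto)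
      then show ?thesis using X Y \<gamma> left \<open>D1 = {#}\<close> D2 by simp
    qed
  qed
qed

section \<open>Focused axioms\<close>

abbreviation wt :: "formula multiset \<Rightarrow> nat" where
  "wt M \<equiv> (\<Sum>A\<in>#M. length (enc_fm A))"

text \<open>Replaces a whole antecedent by one formula with the same variables. The factor 2 arises
  because the tag of each \<open>fuse\<close> is at most as long as the formula it adds.\<close>

lemma fused_context:
  assumes "mover L M"
  shows "\<exists>C. over L C \<and> M \<turnstile> {#C#} \<and> (\<forall>\<Gamma> \<Delta>. M + \<Gamma> \<turnstile> \<Delta> \<longrightarrow> add_mset C \<Gamma> \<turnstile> \<Delta>) \<and>
    vars C = mvars M \<and> length (enc_fm C) \<le> 4 + 2 * wt M"
  using assms
proof (induction M)
  case empty
  show ?case by (intro exI[of _ unit]) (simp add: unit_right unit_left)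
next
  case (add A M)
  then obtain C where C: "over L C" "M \<turnstile> {#C#}" "\<And>\<Gamma> \<Delta>. M + \<Gamma> \<turnstile> \<Delta> \<Longrightarrow> add_mset C \<Gamma> \<turnstile> \<Delta>"
    "vars C = mvars M" "length (enc_fm C) \<le> 4 + 2 * wt M" by auto
  have "add_mset A M \<turnstile> {#fuse A C#}"
    using fuse_right[OF identity C(2), of A] add.prems by simp
  moreover have "add_mset (fuse A C) \<Gamma> \<turnstile> \<Delta>" if "add_mset A M + \<Gamma> \<turnstile> \<Delta>" for \<Gamma> \<Delta>
    using C(3)[of "add_mset A \<Gamma>"] that by (intro fuse_left) (simp add: add_mset_commute)
  ultimately show ?case
    using C(1,4,5) add.prems enc_fm_ge[of A] by (intro exI[of _ "fuse A C"]) auto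
qed

text \<open>The counterpart for succedents: the fusion of the negations \<open>Imp A zero\<close>.
  Each formula brings in 12 further bits, at most three times its own length, hence the factor 4.
  Excluding \<open>Single\<close> is essential, since \<open>A\<close> and its negation stand
  together in a succedent.\<close>

lemma cofused_context:
  assumes "mover L M" and "m \<noteq> Single"
  shows "\<exists>C. over L C \<and> {#} \<turnstile> add_mset C M \<and> (\<forall>\<Gamma> \<Delta>. \<Gamma> \<turnstile> M + \<Delta> \<longrightarrow> add_mset C \<Gamma> \<turnstile> \<Delta>) \<and>
    vars C = mvars M \<and> length (enc_fm C) \<le> 4 + 4 * wt M"
  using assms(1)
proof (induction M)
  case empty
  show ?case by (intro exI[of _ unit]) (simp add: unit_right unit_left)
next
  case (add A M)
  then obtain C where C: "over L C" "{#} \<turnstile> add_mset C M" "\<And>\<Gamma> \<Delta>. \<Gamma> \<turnstile> M + \<Delta> \<Longrightarrow> add_mset C \<Gamma> \<turnstile> \<Delta>"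
    "vars C = mvars M" "length (enc_fm C) \<le> 4 + 4 * wt M" by auto
  have "{#} \<turnstile> {#Imp A zero, A#}"
    by (rule imp_right, rule zero_right) (use add.prems identity assms(2) in auto)
  then have "{#} \<turnstile> add_mset (fuse (Imp A zero) C) (add_mset A M)"
    using fuse_right[OF _ C(2), of "{#}" "Imp A zero" "{#A#}"] by simp
  moreover have "add_mset (fuse (Imp A zero) C) \<Gamma> \<turnstile> \<Delta>" if "\<Gamma> \<turnstile> add_mset A M + \<Delta>" for \<Gamma> \<Delta>
  proof (rule fuse_left)
    have "add_mset C \<Gamma> \<turnstile> add_mset A \<Delta>" using C(3)[of \<Gamma> "add_mset A \<Delta>"] that by simp
    from imp_left[OF this zero_left] show "add_mset (Imp A zero) (add_mset C \<Gamma>) \<turnstile> \<Delta>" by simp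
  qed
  ultimately show ?case
    using C(1,4,5) add.prems enc_fm_ge[of A] by (intro exI[of _ "fuse (Imp A zero) C"]) auto
qed

lemma interpolable_identity:
  assumes "over L A"
  shows "interpolable ({#A#} \<Rrightarrow> {#A#}) (16 + wt {#A#})"
  unfolding interpolable_def sequent.sel
proof (intro allI impI)
  fix G1 G2 D1 D2 assume "{#A#} = G1 + G2" "{#A#} = D1 + D2" and S: "m = Single \<longrightarrow> D1 = {#}"
  then consider "G1 = {#A#}" "G2 = {#}" "D1 = {#}" "D2 = {#A#}" | "G1 = {#}" "G2 = {#A#}" "D1 = {#}" "D2 = {#A#}"
    | "G1 = {#A#}" "G2 = {#}" "D1 = {#A#}" "D2 = {#}" | "G1 = {#}" "G2 = {#A#}" "D1 = {#A#}" "D2 = {#}"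
    unfolding single_is_union by blast
  then show "itp G1 D1 G2 D2 (16 + wt {#A#})"
  proof cases
    case 1
    then show ?thesis unfolding itp_def using assms identity
      by (intro exI[of _ A]) simp
  next
    case 2
    then show ?thesis unfolding itp_def using assms identity unit_left unit_right
      by (intro exI[of _ unit]) simp
  next
    case 3
    with S have "m \<noteq> Single" by auto
    with 3 show ?thesis unfolding itp_def using assms identity zero_left zero_right
      by (intro exI[of _ zero]) simp
  next
    case 4
    with S have "m \<noteq> Single" by auto
    \<comment> \<open>The mirror image of the first case; the exchange of the parts turns the
      interpolant \<open>A\<close> into \<open>Imp A zero\<close>.\<close>
    then have "itp {#A#} {#} {#} {#A#} (8 + wt {#A#})"
      unfolding itp_def using assms identity by (intro exI[of _ A]) simp
    from itp_swap[OF this] \<open>m \<noteq> Single\<close> 4 show ?thesis by (simp add: itp_mono)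
  qed
qed

text \<open>If one part has no formula of the axiom, a constant interpolates. Otherwise the fusion
  of the first part does, and its variables occur in the second part because all formulas of the
  axiom have the same ones.\<close>

lemma interpolable_left_axiom:
  assumes ax: "\<phi> \<turnstile> {#}" and sv: "\<And>A B. A \<in># \<phi> \<Longrightarrow> B \<in># \<phi> \<Longrightarrow> vars A = vars B"
  shows "interpolable (\<phi> \<Rrightarrow> {#}) (16 + 4 * wt \<phi>)"
  unfolding interpolable_def sequent.sel
proof (intro allI impI)
  fix G1 G2 and D1 D2 :: "formula multiset" assume G: "\<phi> = G1 + G2" and "{#} = D1 + D2"
  then have D: "D1 = {#}" "D2 = {#}" by auto
  consider "G1 = {#}" | "G2 = {#}" | "G1 \<noteq> {#}" "G2 \<noteq> {#}" by blast
  then show "itp G1 D1 G2 D2 (16 + 4 * wt \<phi>)"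
  proof cases
    case 1
    then show ?thesis unfolding itp_def D using ax G unit_left unit_right
      by (intro exI[of _ unit]) simp
  next
    case 2
    then show ?thesis unfolding itp_def D using ax G zero_left zero_right
      by (intro exI[of _ zero]) simp
  next
    case 3
    have "mover L G1" using pr_over[OF ax] G by simp
    from fused_context[OF this] obtain C where C: "over L C" "G1 \<turnstile> {#C#}"
      "\<And>\<Gamma> \<Delta>. G1 + \<Gamma> \<turnstile> \<Delta> \<Longrightarrow> add_mset C \<Gamma> \<turnstile> \<Delta>" "vars C = mvars G1" "length (enc_fm C) \<le> 4 + 2 * wt G1"
      by blast
    moreover have "mvars G1 \<subseteq> mvars G2"
      using sv 3 unfolding G by (intro mvars_subset_if_same_vars)
    moreover have "add_mset C G2 \<turnstile> {#}" using C(3) ax G by simp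
    ultimately show ?thesis unfolding itp_def D using G by (intro exI[of _ C]) simp
  qed
qed

text \<open>As for antecedents, with negations; a nonempty \<open>D1\<close> can occur only in the
  multi-conclusion case, where these are at hand.\<close>

lemma interpolable_right_axiom:
  assumes ax: "{#} \<turnstile> \<phi>" and sv: "\<And>A B. A \<in># \<phi> \<Longrightarrow> B \<in># \<phi> \<Longrightarrow> vars A = vars B"
  shows "interpolable ({#} \<Rrightarrow> \<phi>) (16 + 4 * wt \<phi>)"
  unfolding interpolable_def sequent.sel
proof (intro allI impI)
  fix G1 G2 :: "formula multiset" and D1 D2
  assume "{#} = G1 + G2" and D: "\<phi> = D1 + D2" and S: "m = Single \<longrightarrow> D1 = {#}"
  then have G: "G1 = {#}" "G2 = {#}" by auto
  consider "D1 = {#}" | "D1 \<noteq> {#}" "D2 = {#}" | "D1 \<noteq> {#}" "D2 \<noteq> {#}" by blast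
  then show "itp G1 D1 G2 D2 (16 + 4 * wt \<phi>)"
  proof cases
    case 1
    then show ?thesis unfolding itp_def G using ax D unit_left unit_right
      by (intro exI[of _ unit]) simp
  next
    case 2
    then have "{#} \<turnstile> add_mset zero D1" using ax D S by (intro zero_right) auto
    with 2 show ?thesis unfolding itp_def G using zero_left
      by (intro exI[of _ zero]) simp
  next
    case 3
    have "mover L D1" using pr_over[OF ax] D by simp
    from cofused_context[OF this] S 3 obtain C where C: "over L C" "{#} \<turnstile> add_mset C D1"
      "\<And>\<Gamma> \<Delta>. \<Gamma> \<turnstile> D1 + \<Delta> \<Longrightarrow> add_mset C \<Gamma> \<turnstile> \<Delta>" "vars C = mvars D1" "length (enc_fm C) \<le> 4 + 4 * wt D1"
      by blast
    moreover have "mvars D1 \<subseteq> mvars D2"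
      using sv 3 unfolding D by (intro mvars_subset_if_same_vars)
    moreover have "{#C#} \<turnstile> D2" using C(3) ax D by simp
    ultimately show ?thesis unfolding itp_def G using D by (intro exI[of _ C]) simp
  qed
qed

text \<open>The contexts share no variables in general and must not enter the interpolant.
  \<open>Top\<close> absorbs those of the first part, \<open>Bot\<close> those of the second, and if
  both parts have formulas of the axiom the fusion of the first ones is completed by
  \<open>Top\<close>. The 20 bits are the slack 8, the \<open>unit\<close> inside the fused context,
  \<open>Top\<close>, and one \<open>fuse\<close>.\<close>

lemma interpolable_left_axiom_context:
  assumes ax: "\<And>\<Gamma> \<Delta>. mover L \<Gamma> \<Longrightarrow> mover L \<Delta> \<Longrightarrow> (m = Single \<Longrightarrow> size \<Delta> \<le> 1) \<Longrightarrow> \<phi> + \<Gamma> \<turnstile> \<Delta>"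
    and sv: "\<And>A B. A \<in># \<phi> \<Longrightarrow> B \<in># \<phi> \<Longrightarrow> vars A = vars B"
    and hb: has_bounds and ov: "mover L \<phi>" "mover L \<Gamma>" "mover L \<Delta>"
    and sg: "m = Single \<Longrightarrow> size \<Delta> \<le> 1"
  shows "interpolable (\<phi> + \<Gamma> \<Rrightarrow> \<Delta>) (20 + 4 * wt \<phi>)"
  unfolding interpolable_def sequent.sel
proof (intro allI impI)
  fix G1 G2 D1 D2
  assume G: "\<phi> + \<Gamma> = G1 + G2" and D: "\<Delta> = D1 + D2" and S: "m = Single \<longrightarrow> D1 = {#}"
  obtain \<phi>1 \<phi>2 X1 X2 where X: "\<phi> = \<phi>1 + \<phi>2" "\<Gamma> = X1 + X2" "G1 = \<phi>1 + X1" "G2 = \<phi>2 + X2"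
    using mset_refinement[OF G] .
  have ov': "mover L X1" "mover L X2" "mover L \<phi>1" "mover L \<phi>2" "mover L D1" "mover L D2"
    using ov X D by auto
  have T: "\<Gamma> \<turnstile> add_mset Top D1" if "mover L \<Gamma>" for \<Gamma>
    using hb that ov' S unfolding has_bounds_def by blast
  have sg2: "m = Single \<Longrightarrow> size D2 \<le> 1" using sg D by simp
  consider "\<phi>1 = {#}" | "\<phi>2 = {#}" | "\<phi>1 \<noteq> {#}" "\<phi>2 \<noteq> {#}" by blast
  then show "itp G1 D1 G2 D2 (20 + 4 * wt \<phi>)"
  proof cases
    case 1
    have "\<phi> + add_mset Top X2 \<turnstile> D2" using ov' sg2 by (intro ax) auto
    with T[of G1] 1 X ov' show ?thesis unfolding itp_def by (intro exI[of _ Top]) simp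
  next
    case 2
    have "\<phi> + X1 \<turnstile> add_mset Bot D1" using ov' S by (intro ax) auto
    moreover have "add_mset Bot G2 \<turnstile> D2" using hb ov' X sg2 unfolding has_bounds_def by simp
    ultimately show ?thesis using 2 X unfolding itp_def by (intro exI[of _ Bot]) simp
  next
    case 3
    from fused_context[OF ov'(3)] obtain C where C: "over L C" "\<phi>1 \<turnstile> {#C#}"
      "\<And>\<Gamma> \<Delta>. \<phi>1 + \<Gamma> \<turnstile> \<Delta> \<Longrightarrow> add_mset C \<Gamma> \<turnstile> \<Delta>" "vars C = mvars \<phi>1" "length (enc_fm C) \<le> 4 + 2 * wt \<phi>1"
      by blast
    have "mvars \<phi>1 \<subseteq> mvars \<phi>2"
      using sv 3 unfolding X(1) by (intro mvars_subset_if_same_vars)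
    moreover have "G1 \<turnstile> add_mset (fuse C Top) D1"
      using fuse_right[OF C(2) T[OF ov'(1)]] X by simp
    moreover have "add_mset (fuse C Top) G2 \<turnstile> D2"
    proof (rule fuse_left, rule C(3))
      have "\<phi> + add_mset Top X2 \<turnstile> D2" using ov' sg2 by (intro ax) auto
      then show "\<phi>1 + add_mset Top G2 \<turnstile> D2" using X by (simp add: ac_simps)
    qed
    ultimately show ?thesis unfolding itp_def using X(1) C
      by (intro exI[of _ "fuse C Top"]) (auto simp: X(3,4))
  qed
qed

lemma interpolable_right_axiom_context:
  assumes ax: "\<And>\<Gamma> \<Delta>. mover L \<Gamma> \<Longrightarrow> mover L \<Delta> \<Longrightarrow> (m = Single \<Longrightarrow> size (\<phi> + \<Delta>) \<le> 1) \<Longrightarrow> \<Gamma> \<turnstile> \<phi> + \<Delta>"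
    and sv: "\<And>A B. A \<in># \<phi> \<Longrightarrow> B \<in># \<phi> \<Longrightarrow> vars A = vars B"
    and hb: has_bounds and ov: "mover L \<phi>" "mover L \<Gamma>" "mover L \<Delta>"
    and sg: "m = Single \<Longrightarrow> size (\<phi> + \<Delta>) \<le> 1"
  shows "interpolable (\<Gamma> \<Rrightarrow> \<phi> + \<Delta>) (20 + 4 * wt \<phi>)"
  unfolding interpolable_def sequent.sel
proof (intro allI impI)
  fix G1 G2 D1 D2
  assume G: "\<Gamma> = G1 + G2" and D: "\<phi> + \<Delta> = D1 + D2" and S: "m = Single \<longrightarrow> D1 = {#}"
  obtain \<phi>1 \<phi>2 Y1 Y2 where Y: "\<phi> = \<phi>1 + \<phi>2" "\<Delta> = Y1 + Y2" "D1 = \<phi>1 + Y1" "D2 = \<phi>2 + Y2"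
    using mset_refinement[OF D] .
  have ov': "mover L Y1" "mover L Y2" "mover L \<phi>1" "mover L \<phi>2" "mover L G1" "mover L G2"
    using ov Y G by auto
  have T: "\<Gamma> \<turnstile> add_mset Top \<Delta>" if "mover L \<Gamma>" "mover L \<Delta>" "m = Single \<Longrightarrow> \<Delta> = {#}" for \<Gamma> \<Delta>
    using hb that S unfolding has_bounds_def by blast
  \<comment> \<open>The axiom accepts any left context, including one extended by the interpolant
    \<open>Top\<close>.\<close>
  have top: "add_mset Top G2 \<turnstile> \<phi> + Y2" by (rule ax) (use ov' sg Y in auto)
  consider "\<phi>1 = {#}" | "\<phi>1 \<noteq> {#}" "\<phi>2 = {#}" | "\<phi>1 \<noteq> {#}" "\<phi>2 \<noteq> {#}" by blast
  then show "itp G1 D1 G2 D2 (20 + 4 * wt \<phi>)"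
  proof cases
    case 1
    with T[of G1 D1] Y ov' S top show ?thesis unfolding itp_def by (intro exI[of _ Top]) simp
  next
    case 2
    then have ms: "m \<noteq> Single" using S Y by auto
    then have "G1 \<turnstile> \<phi> + add_mset Bot Y1" using ov' by (intro ax) auto
    moreover have "add_mset Bot G2 \<turnstile> D2" using hb ov' Y ms unfolding has_bounds_def by simp
    ultimately show ?thesis using 2 Y unfolding itp_def by (intro exI[of _ Bot]) simp
  next
    case 3
    then have ms: "m \<noteq> Single" using S Y by auto
    from cofused_context[OF ov'(3) ms] obtain C where C: "over L C" "{#} \<turnstile> add_mset C \<phi>1"
      "\<And>\<Gamma> \<Delta>. \<Gamma> \<turnstile> \<phi>1 + \<Delta> \<Longrightarrow> add_mset C \<Gamma> \<turnstile> \<Delta>" "vars C = mvars \<phi>1" "length (enc_fm C) \<le> 4 + 4 * wt \<phi>1"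
      by blast
    have "mvars \<phi>1 \<subseteq> mvars \<phi>2"
      using sv 3 unfolding Y(1) by (intro mvars_subset_if_same_vars)
    moreover have "G1 \<turnstile> add_mset (fuse C Top) D1"
      using fuse_right[OF C(2) T[of G1 Y1]] Y ms ov' by simp
    moreover have "add_mset (fuse C Top) G2 \<turnstile> D2"
      by (rule fuse_left, rule C(3)) (use top Y in \<open>simp add: ac_simps\<close>)
    ultimately show ?thesis unfolding itp_def using Y(1) C
      by (intro exI[of _ "fuse C Top"]) (auto simp: Y(3,4))
  qed
qed

section \<open>Modal rules\<close>

text \<open>It is enough to interpolate with the succedent in the second part: it has at most one
  formula, so if the first part contains it, the second part has none and the parts can be exchanged
  for 8 bits.\<close>

lemma interpolable_box:
  assumes "\<And>\<Gamma>1 \<Gamma>2. \<Gamma> = \<Gamma>1 + \<Gamma>2 \<Longrightarrow> itp (image_mset Box \<Gamma>1) {#} (image_mset Box \<Gamma>2) D n"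
    and "size D \<le> 1"
  shows "interpolable (image_mset Box \<Gamma> \<Rrightarrow> D) (n + 8)"
  unfolding interpolable_def sequent.sel
proof (intro allI impI)
  fix G1 G2 D1 D2
  assume "image_mset Box \<Gamma> = G1 + G2" and D: "D = D1 + D2" and S: "m = Single \<longrightarrow> D1 = {#}"
  then obtain \<Gamma>1 \<Gamma>2 where \<Gamma>: "\<Gamma> = \<Gamma>1 + \<Gamma>2" "G1 = image_mset Box \<Gamma>1" "G2 = image_mset Box \<Gamma>2"
    using image_mset_eq_plusD by metis
  show "itp G1 D1 G2 D2 (n + 8)"
  proof (cases "D1 = {#}")
    case True
    with assms(1)[OF \<Gamma>(1)] D \<Gamma> show ?thesis by (simp add: itp_mono)
  next
    case False
    then have "size D1 \<ge> 1" by (simp add: Suc_le_eq nonempty_has_size)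
    moreover have "size D1 + size D2 \<le> 1" using assms(2) D by simp
    ultimately have "size D2 = 0" by linarith
    then have "D2 = {#}" by simp
    have "itp G2 {#} G1 D1 n" using assms(1)[of \<Gamma>2 \<Gamma>1] \<Gamma> D \<open>D2 = {#}\<close> by (simp add: add.commute)
    from itp_swap[OF this] False S \<open>D2 = {#}\<close> show ?thesis by simp
  qed
qed

text \<open>Treats \<open>K\<close> (\<open>D\<close> a singleton) and the rule without succedent
  (\<open>D\<close> empty) together. In both cases the half that proves the interpolant has a
  succedent, so boxing it takes \<open>K\<close>; for this reason the empty rule presupposes
  \<open>K\<close>. The 12 bits are the tag of \<open>Box\<close> and the exchange.\<close>

lemma interpolable_K:
  assumes K: "\<And>\<Gamma> A. \<Gamma> \<turnstile> {#A#} \<Longrightarrow> image_mset Box \<Gamma> \<turnstile> {#Box A#}" and L: "BoxC \<in> L"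
    and KD: "\<And>\<Gamma>. \<Gamma> \<turnstile> D \<Longrightarrow> image_mset Box \<Gamma> \<turnstile> image_mset Box D" and D: "size D \<le> 1"
    and IH: "interpolable (\<Gamma> \<Rrightarrow> D) n"
  shows "interpolable (image_mset Box \<Gamma> \<Rrightarrow> image_mset Box D) (n + 12)"
proof -
  have "itp (image_mset Box \<Gamma>1) {#} (image_mset Box \<Gamma>2) (image_mset Box D) (n + 4)"
    if "\<Gamma> = \<Gamma>1 + \<Gamma>2" for \<Gamma>1 \<Gamma>2
  proof -
    have "itp \<Gamma>1 {#} \<Gamma>2 D n" using IH that unfolding interpolable_def by simp
    then obtain C where C: "over L C" "\<Gamma>1 \<turnstile> {#C#}" "add_mset C \<Gamma>2 \<turnstile> D"
      "vars C \<subseteq> mvars \<Gamma>1 \<inter> mvars (\<Gamma>2 + D)" "length (enc_fm C) + 8 \<le> n"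
      unfolding itp_def by auto
    with K[OF C(2)] KD[OF C(3)] L show ?thesis unfolding itp_def
      by (intro exI[of _ "Box C"]) simp
  qed
  from interpolable_box[OF this] D show ?thesis by (simp add: add.assoc)
qed

text \<open>The interpolant \<open>C\<close> enters the second half without a box, and the rule
  requires a boxed antecedent; \<open>LS4\<close> boxes \<open>C\<close> on the left
  beforehand.\<close>

lemma interpolable_RS4:
  assumes RS4: "\<And>\<Gamma> A. image_mset Box \<Gamma> \<turnstile> {#A#} \<Longrightarrow> image_mset Box \<Gamma> \<turnstile> {#Box A#}" and L: "BoxC \<in> L"
    and LS4: "\<And>\<Gamma> A \<Delta>. add_mset A \<Gamma> \<turnstile> \<Delta> \<Longrightarrow> add_mset (Box A) \<Gamma> \<turnstile> \<Delta>"
    and IH: "interpolable (image_mset Box \<Gamma> \<Rrightarrow> {#A#}) n"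
  shows "interpolable (image_mset Box \<Gamma> \<Rrightarrow> {#Box A#}) (n + 12)"
proof -
  have "itp (image_mset Box \<Gamma>1) {#} (image_mset Box \<Gamma>2) {#Box A#} (n + 4)"
    if "\<Gamma> = \<Gamma>1 + \<Gamma>2" for \<Gamma>1 \<Gamma>2
  proof -
    have "itp (image_mset Box \<Gamma>1) {#} (image_mset Box \<Gamma>2) {#A#} n"
      using IH that unfolding interpolable_def by simp
    then obtain C where C: "over L C" "image_mset Box \<Gamma>1 \<turnstile> {#C#}"
      "add_mset C (image_mset Box \<Gamma>2) \<turnstile> {#A#}"
      "vars C \<subseteq> mvars \<Gamma>1 \<inter> mvars (\<Gamma>2 + {#A#})" "length (enc_fm C) + 8 \<le> n"
      unfolding itp_def by auto
    have "add_mset (Box C) (image_mset Box \<Gamma>2) \<turnstile> {#Box A#}"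
      using RS4[of "add_mset C \<Gamma>2" A] LS4[OF C(3)] by simp
    with RS4[OF C(2)] C L show ?thesis unfolding itp_def
      by (intro exI[of _ "Box C"]) simp
  qed
  from interpolable_box[OF this] show ?thesis by (simp add: add.assoc)
qed

section \<open>Context sharing\<close>

definition structural :: bool where
  "structural \<longleftrightarrow> (\<forall>\<Gamma> \<Delta> A. \<Gamma> \<turnstile> \<Delta> \<longrightarrow> over L A \<longrightarrow> add_mset A \<Gamma> \<turnstile> \<Delta>) \<and>
     (\<forall>\<Gamma> \<Delta> A. add_mset A (add_mset A \<Gamma>) \<turnstile> \<Delta> \<longrightarrow> add_mset A \<Gamma> \<turnstile> \<Delta>)"

lemma weakening: "structural \<Longrightarrow> \<Gamma> \<turnstile> \<Delta> \<Longrightarrow> mover L M \<Longrightarrow> M + \<Gamma> \<turnstile> \<Delta>"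
proof (induction M)
  case (add A M)
  then have "M + \<Gamma> \<turnstile> \<Delta>" "over L A" by simp_all
  with add.prems(1) have "add_mset A (M + \<Gamma>) \<turnstile> \<Delta>" unfolding structural_def by blast
  then show ?case by simp
qed simp

lemma contraction: "structural \<Longrightarrow> M + (M + \<Gamma>) \<turnstile> \<Delta> \<Longrightarrow> M + \<Gamma> \<turnstile> \<Delta>"
proof (induction M arbitrary: \<Gamma>)
  case (add A M)
  then have "add_mset A (add_mset A (M + (M + \<Gamma>))) \<turnstile> \<Delta>" by simp
  with add.prems(1) have "add_mset A (M + (M + \<Gamma>)) \<turnstile> \<Delta>" unfolding structural_def by blast
  then show ?case using add.IH[of "add_mset A \<Gamma>"] add.prems(1) by simp
qed simp

text \<open>Both copies of \<open>M\<close> are split in the same way, so that each part contains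
  its own share twice and contraction applies separately in the two parts. The interpolant is
  unchanged.\<close>

lemma interpolable_contract:
  assumes st: structural and IH: "interpolable (M + M + N \<Rrightarrow> D) n"
  shows "interpolable (M + N \<Rrightarrow> D) n"
  unfolding interpolable_def sequent.sel
proof (intro allI impI)
  fix G1 G2 D1 D2
  assume G: "M + N = G1 + G2" and D: "D = D1 + D2" and S: "m = Single \<longrightarrow> D1 = {#}"
  obtain M1 M2 N1 N2 where X: "M = M1 + M2" "N = N1 + N2" "G1 = M1 + N1" "G2 = M2 + N2"
    using mset_refinement[OF G] .
  have "itp (M1 + (M1 + N1)) D1 (M2 + (M2 + N2)) D2 n"
    using IH D S X unfolding interpolable_def sequent.sel by (simp add: ac_simps)
  then obtain C where C: "over L C" "M1 + (M1 + N1) \<turnstile> add_mset C D1" "add_mset C (M2 + (M2 + N2)) \<turnstile> D2"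
    "vars C \<subseteq> mvars (G1 + D1) \<inter> mvars (G2 + D2)" "length (enc_fm C) + 8 \<le> n"
    unfolding itp_def X by auto
  have "add_mset C G2 \<turnstile> D2" using contraction[OF st, of M2 "add_mset C N2" D2] C(3) X by simp
  with contraction[OF st C(2)] C X show "itp G1 D1 G2 D2 n" unfolding itp_def
    by (intro exI[of _ C]) simp
qed

text \<open>
  With weakening and contraction a context-sharing rule is as good as the rule in which the two
  families of premises have separate contexts; \<open>(i, False)\<close> and \<open>(i, True)\<close> are the resulting blocks.
\<close>

lemma interpolable_context_sharing:
  fixes I :: "nat set"
  assumes st: structural and hb: has_bounds and S: "m = Single" and fin: "finite I"
    and cl: "\<And>\<gamma> \<delta>. (\<And>i. i \<in> I \<Longrightarrow> mover L (\<gamma> i) \<and> mover L (\<delta> i) \<and>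
        (\<forall>(\<psi>, \<theta>) \<in> set (Es i). \<gamma> i + \<psi> \<turnstile> \<theta>) \<and> (\<forall>\<phi> \<in> set (Fs i). \<gamma> i + \<phi> \<turnstile> \<delta> i)) \<Longrightarrow>
      size (sum \<delta> I) \<le> 1 \<Longrightarrow> sum \<gamma> I + {#\<chi>#} \<turnstile> sum \<delta> I"
    and vsE: "\<And>i \<phi> \<psi>. i \<in> I \<Longrightarrow> (\<phi>, \<psi>) \<in> set (Es i) \<Longrightarrow> mvars (\<phi> + \<psi>) \<subseteq> vars \<chi>"
    and vsF: "\<And>i \<phi>. i \<in> I \<Longrightarrow> \<phi> \<in> set (Fs i) \<Longrightarrow> mvars \<phi> \<subseteq> vars \<chi>"
    and ov: "\<And>i. i \<in> I \<Longrightarrow> mover L (\<gamma> i) \<and> mover L (\<delta> i)"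
    and sg: "size (sum \<delta> I) \<le> 1"
    and IHE: "\<And>i \<phi> \<psi>. i \<in> I \<Longrightarrow> (\<phi>, \<psi>) \<in> set (Es i) \<Longrightarrow> interpolable (\<gamma> i + \<phi> \<Rrightarrow> \<psi>) (nE i (\<phi>, \<psi>))"
    and IHF: "\<And>i \<phi>. i \<in> I \<Longrightarrow> \<phi> \<in> set (Fs i) \<Longrightarrow> interpolable (\<gamma> i + \<phi> \<Rrightarrow> \<delta> i) (nF i \<phi>)"
  shows "interpolable (sum \<gamma> I + {#\<chi>#} \<Rrightarrow> sum \<delta> I)
    (28 + (\<Sum>i\<in>I. (\<Sum>p\<leftarrow>Es i. nE i p) + (\<Sum>\<phi>\<leftarrow>Fs i. nF i \<phi>)))"
proof -
  let ?I = "I \<times> (UNIV :: bool set)" and ?J = "I \<times> {True}"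
  let ?F = "\<lambda>(i, b). if b then map (\<lambda>\<phi>. (\<phi>, {#})) (Fs i) else Es i"
  let ?n = "\<lambda>(i, b) p. if b then nF i (fst p) else nE i p"
  let ?\<delta> = "\<lambda>(i, b). if b then \<delta> i else {#}"
  have adm: "admits ?I ?F ?J {#\<chi>#} {#}"
    unfolding admits_def
  proof (intro allI impI)
    fix \<gamma>' \<delta>' :: "nat \<times> bool \<Rightarrow> formula multiset"
    assume a: "\<forall>i\<in>?I. mover L (\<gamma>' i) \<and> mover L (\<delta>' i) \<and> (i \<notin> ?J \<longrightarrow> \<delta>' i = {#}) \<and>
       (\<forall>(\<phi>, \<psi>) \<in> set (?F i). \<gamma>' i + \<phi> \<turnstile> \<psi> + \<delta>' i)"
      and s: "m = Single \<longrightarrow> size (sum \<delta>' ?I + {#}) \<le> 1"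
    have e: "\<delta>' (i, False) = {#}" if "i \<in> I" for i using a that by auto
    have sd: "sum \<delta>' ?I = (\<Sum>i\<in>I. \<delta>' (i, True))" unfolding sum_Times_bool using e by simp
    \<comment> \<open>The shared context of index \<open>i\<close> is taken to be the sum of the two
      separate ones; weakening makes the premises of either family fit it.\<close>
    have "(\<Sum>i\<in>I. \<gamma>' (i, False) + \<gamma>' (i, True)) + {#\<chi>#} \<turnstile> (\<Sum>i\<in>I. \<delta>' (i, True))"
    proof (rule cl)
      fix i assume i: "i \<in> I"
      have ov': "mover L (\<gamma>' (i, b))" "mover L (\<delta>' (i, b))" for b using a i by auto
      have "\<gamma>' (i, False) + \<gamma>' (i, True) + \<psi> \<turnstile> \<theta>" if "(\<psi>, \<theta>) \<in> set (Es i)" for \<psi> \<theta>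
      proof -
        have "\<gamma>' (i, False) + \<psi> \<turnstile> \<theta>" using bspec[OF a, of "(i, False)"] i that e[OF i] by auto
        from weakening[OF st this ov'(1), of True] show ?thesis by (simp add: ac_simps)
      qed
      moreover have "\<gamma>' (i, False) + \<gamma>' (i, True) + \<phi> \<turnstile> \<delta>' (i, True)" if "\<phi> \<in> set (Fs i)" for \<phi>
      proof -
        have "\<gamma>' (i, True) + \<phi> \<turnstile> \<delta>' (i, True)" using bspec[OF a, of "(i, True)"] i that by auto
        from weakening[OF st this ov'(1), of False] show ?thesis by (simp add: ac_simps)
      qed
      ultimately show "mover L (\<gamma>' (i, False) + \<gamma>' (i, True)) \<and> mover L (\<delta>' (i, True)) \<and>
        (\<forall>(\<psi>, \<theta>) \<in> set (Es i). \<gamma>' (i, False) + \<gamma>' (i, True) + \<psi> \<turnstile> \<theta>) \<and>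
        (\<forall>\<phi> \<in> set (Fs i). \<gamma>' (i, False) + \<gamma>' (i, True) + \<phi> \<turnstile> \<delta>' (i, True))"
        using ov' by auto
    next
      show "size (\<Sum>i\<in>I. \<delta>' (i, True)) \<le> 1" using s S unfolding sd by simp
    qed
    then show "sum \<gamma>' ?I + {#\<chi>#} \<turnstile> sum \<delta>' ?I + {#}" unfolding sd unfolding sum_Times_bool by simp
  qed
  have sd: "sum ?\<delta> ?I = sum \<delta> I" unfolding sum_Times_bool by simp
  have "interpolable (sum (\<gamma> \<circ> fst) ?I + {#\<chi>#} \<Rrightarrow> sum ?\<delta> ?I + {#}) (28 + (\<Sum>i\<in>?I. \<Sum>p\<leftarrow>?F i. ?n i p))"
  proof (rule admits_interpolable[OF adm])
    show "finite ?I" using fin by simp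
    show "has_bounds \<or> (\<forall>i\<in>?I. ?F i \<noteq> [])" using hb by simp
    show "m = Single \<Longrightarrow> size (sum ?\<delta> ?I + {#}) \<le> 1" unfolding sd using sg by simp
  next
    fix i \<phi> \<psi> assume a: "i \<in> ?I" "(\<phi>, \<psi>) \<in> set (?F i)"
    obtain j b where i: "i = (j, b)" by force
    show "mvars (\<phi> + \<psi>) \<subseteq> vars \<chi>" using a vsE[of j \<phi> \<psi>] vsF[of j \<phi>] i by (cases b) auto
    show "interpolable ((\<gamma> \<circ> fst) i + \<phi> \<Rrightarrow> \<psi> + ?\<delta> i) (?n i (\<phi>, \<psi>))"
      using a IHE[of j \<phi> \<psi>] IHF[of j \<phi>] i by (cases b) auto
    show "i \<in> ?J \<Longrightarrow> \<psi> = {#}" using a by auto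
  qed (use ov in \<open>auto split: if_splits\<close>)
  \<comment> \<open>Both blocks of an index receive the same left context, so the separated rule
    yields a doubled antecedent, to be contracted at the end.\<close>
  moreover have "sum (\<gamma> \<circ> fst) ?I = sum \<gamma> I + sum \<gamma> I" unfolding sum_Times_bool by (simp add: sum.distrib)
  moreover have "(\<Sum>i\<in>?I. \<Sum>p\<leftarrow>?F i. ?n i p) = (\<Sum>i\<in>I. (\<Sum>p\<leftarrow>Es i. nE i p) + (\<Sum>\<phi>\<leftarrow>Fs i. nF i \<phi>))"
    unfolding sum_Times_bool by (simp add: comp_def)
  ultimately have "interpolable (sum \<gamma> I + sum \<gamma> I + {#\<chi>#} \<Rrightarrow> sum \<delta> I)
    (28 + (\<Sum>i\<in>I. (\<Sum>p\<leftarrow>Es i. nE i p) + (\<Sum>\<phi>\<leftarrow>Fs i. nF i \<phi>)))"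
    unfolding sd by simp
  then show ?thesis by (rule interpolable_contract[OF st])
qed

end

section \<open>The base calculi\<close>

text \<open>The base calculi use the formula variables 0, 1 and the contexts 0 to 3 only, so an
  instance of one of their rules is given by a pair and a quadruple.\<close>

definition two :: "'a \<Rightarrow> 'a \<Rightarrow> nat \<Rightarrow> 'a" where
  "two a b i = (if i = 0 then a else b)"

definition four :: "'a \<Rightarrow> 'a \<Rightarrow> 'a \<Rightarrow> 'a \<Rightarrow> nat \<Rightarrow> 'a" where
  "four a b c d i = (if i = 0 then a else if i = 1 then b else if i = 2 then c else d)"

lemma extends_rule4:
  assumes "extends m L H G" and "Rule P S \<in> G" and "over L A" "over L B"
    and "mover L \<Gamma>" "mover L \<Delta>" "mover L \<Sigma>" "mover L \<Lambda>"
    and "\<forall>S \<in># P. provable m L H (inst (two A B) (four \<Gamma> \<Delta> \<Sigma> \<Lambda>) S)"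
    and "admitted m (inst (two A B) (four \<Gamma> \<Delta> \<Sigma> \<Lambda>) S)"
  shows "provable m L H (inst (two A B) (four \<Gamma> \<Delta> \<Sigma> \<Lambda>) S)"
  using extends_rule[OF assms(1,2), of "two A B" "four \<Gamma> \<Delta> \<Sigma> \<Lambda>"] assms(3-)
  by (auto simp: two_def four_def)

lemma provable_overD:
  "calculus_over L H \<Longrightarrow> provable m L H (\<Gamma> \<Rrightarrow> \<Delta>) \<Longrightarrow> mover L \<Gamma> \<and> mover L \<Delta>"
  using provable_over by fastforce

abbreviation (input) "\<phi>0 \<equiv> Leaf (FVar 0)"
abbreviation (input) "\<phi>1 \<equiv> Leaf (FVar 1)"

locale single_extension =
  fixes L H G
  assumes calc: "calculus_over L H" and ext: "extends Single L H G"
    and lattice: "lattice_imp_rules \<subseteq> G"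
begin

abbreviation pr :: "formula multiset \<Rightarrow> formula multiset \<Rightarrow> bool" (infix "\<turnstile>" 50) where
  "\<Gamma> \<turnstile> \<Delta> \<equiv> provable Single L H (\<Gamma> \<Rrightarrow> \<Delta>)"

lemmas over_admitted = provable_overD[OF calc] provable_admitted

lemma and_left1:
  assumes p: "add_mset A \<Gamma> \<turnstile> \<Delta>" and o0: "over L B"
  shows "add_mset (And A B) \<Gamma> \<turnstile> \<Delta>"
proof -
  have "Rule {#{#Ctx 0, Fm \<phi>0#} \<Rrightarrow> {#Ctx 1#}#}
      ({#Ctx 0, Fm (And \<phi>0 \<phi>1)#} \<Rrightarrow> {#Ctx 1#}) \<in> G"
    using lattice by (auto simp: lattice_imp_rules_def)
  from extends_rule4[OF ext this, of A B \<Gamma> \<Delta> "{#}" "{#}"] show ?thesis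
    using p o0 over_admitted[OF p] by (simp add: inst_def two_def four_def)
qed

lemma and_left2:
  assumes p: "add_mset B \<Gamma> \<turnstile> \<Delta>" and o0: "over L A"
  shows "add_mset (And A B) \<Gamma> \<turnstile> \<Delta>"
proof -
  have "Rule {#{#Ctx 0, Fm \<phi>1#} \<Rrightarrow> {#Ctx 1#}#}
      ({#Ctx 0, Fm (And \<phi>0 \<phi>1)#} \<Rrightarrow> {#Ctx 1#}) \<in> G"
    using lattice by (auto simp: lattice_imp_rules_def)
  from extends_rule4[OF ext this, of A B \<Gamma> \<Delta> "{#}" "{#}"] show ?thesis
    using p o0 over_admitted[OF p] by (simp add: inst_def two_def four_def)
qed

text \<open>The side context \<open>\<Delta>\<close> is there to match the abstract calculus, which
  covers both modes; admissibility of \<open>p\<close> in single-conclusion mode forces it to be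
  empty.\<close>

lemma and_right:
  assumes p: "\<Gamma> \<turnstile> add_mset A \<Delta>" and q: "\<Gamma> \<turnstile> add_mset B \<Delta>"
  shows "\<Gamma> \<turnstile> add_mset (And A B) \<Delta>"
proof -
  have "Rule {#{#Ctx 0#} \<Rrightarrow> {#Fm \<phi>0#}, {#Ctx 0#} \<Rrightarrow> {#Fm \<phi>1#}#}
      ({#Ctx 0#} \<Rrightarrow> {#Fm (And \<phi>0 \<phi>1)#}) \<in> G"
    using lattice by (auto simp: lattice_imp_rules_def)
  from extends_rule4[OF ext this, of A B \<Gamma> "{#}" "{#}" "{#}"] show ?thesis
    using p q over_admitted[OF p] over_admitted[OF q] by (simp add: inst_def two_def four_def)
qed

lemma or_left:
  assumes p: "add_mset A \<Gamma> \<turnstile> \<Delta>" and q: "add_mset B \<Gamma> \<turnstile> \<Delta>"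
  shows "add_mset (Or A B) \<Gamma> \<turnstile> \<Delta>"
proof -
  have "Rule {#{#Ctx 0, Fm \<phi>0#} \<Rrightarrow> {#Ctx 1#}, {#Ctx 0, Fm \<phi>1#} \<Rrightarrow> {#Ctx 1#}#}
      ({#Ctx 0, Fm (Or \<phi>0 \<phi>1)#} \<Rrightarrow> {#Ctx 1#}) \<in> G"
    using lattice by (auto simp: lattice_imp_rules_def)
  from extends_rule4[OF ext this, of A B \<Gamma> \<Delta> "{#}" "{#}"] show ?thesis
    using p q over_admitted[OF p] over_admitted[OF q] by (simp add: inst_def two_def four_def)
qed

lemma or_right1:
  assumes p: "\<Gamma> \<turnstile> add_mset A \<Delta>" and o0: "over L B"
  shows "\<Gamma> \<turnstile> add_mset (Or A B) \<Delta>"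
proof -
  have "Rule {#{#Ctx 0#} \<Rrightarrow> {#Fm \<phi>0#}#}
      ({#Ctx 0#} \<Rrightarrow> {#Fm (Or \<phi>0 \<phi>1)#}) \<in> G"
    using lattice by (auto simp: lattice_imp_rules_def)
  from extends_rule4[OF ext this, of A B \<Gamma> "{#}" "{#}" "{#}"] show ?thesis
    using p o0 over_admitted[OF p] by (simp add: inst_def two_def four_def)
qed

lemma or_right2:
  assumes p: "\<Gamma> \<turnstile> add_mset B \<Delta>" and o0: "over L A"
  shows "\<Gamma> \<turnstile> add_mset (Or A B) \<Delta>"
proof -
  have "Rule {#{#Ctx 0#} \<Rrightarrow> {#Fm \<phi>1#}#}
      ({#Ctx 0#} \<Rrightarrow> {#Fm (Or \<phi>0 \<phi>1)#}) \<in> G"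
    using lattice by (auto simp: lattice_imp_rules_def)
  from extends_rule4[OF ext this, of A B \<Gamma> "{#}" "{#}" "{#}"] show ?thesis
    using p o0 over_admitted[OF p] by (simp add: inst_def two_def four_def)
qed

lemma imp_left:
  assumes p: "\<Gamma> \<turnstile> add_mset A \<Delta>" and q: "add_mset B \<Gamma>' \<turnstile> \<Delta>'"
  shows "add_mset (Imp A B) (\<Gamma> + \<Gamma>') \<turnstile> \<Delta> + \<Delta>'"
proof -
  have "Rule {#{#Ctx 0#} \<Rrightarrow> {#Fm \<phi>0#}, {#Ctx 2, Fm \<phi>1#} \<Rrightarrow> {#Ctx 3#}#}
      ({#Ctx 0, Ctx 2, Fm (Imp \<phi>0 \<phi>1)#} \<Rrightarrow> {#Ctx 3#}) \<in> G"
    using lattice by (auto simp: lattice_imp_rules_def)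
  from extends_rule4[OF ext this, of A B \<Gamma> "{#}" \<Gamma>' \<Delta>'] show ?thesis
    using p q over_admitted[OF p] over_admitted[OF q] by (simp add: inst_def two_def four_def)
qed

lemma imp_right:
  assumes p: "add_mset A \<Gamma> \<turnstile> add_mset B \<Delta>"
  shows "\<Gamma> \<turnstile> add_mset (Imp A B) \<Delta>"
proof -
  have "Rule {#{#Ctx 0, Fm \<phi>0#} \<Rrightarrow> {#Fm \<phi>1#}#}
      ({#Ctx 0#} \<Rrightarrow> {#Fm (Imp \<phi>0 \<phi>1)#}) \<in> G"
    using lattice by (auto simp: lattice_imp_rules_def)
  from extends_rule4[OF ext this, of A B \<Gamma> "{#}" "{#}" "{#}"] show ?thesis
    using p over_admitted[OF p] by (simp add: inst_def two_def four_def)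
qed

end

locale FLe_extension = single_extension +
  assumes FLe_minus: "FLe_minus \<subseteq> G"
begin

lemma identity:
  assumes o0: "over L A"
  shows "{#A#} \<turnstile> {#A#}"
proof -
  have "Rule {#}
      ({#Fm \<phi>0#} \<Rrightarrow> {#Fm \<phi>0#}) \<in> G"
    using FLe_minus by (auto simp: FLe_minus_def)
  from extends_rule4[OF ext this, of A A "{#}" "{#}" "{#}" "{#}"] show ?thesis
    using o0 by (simp add: inst_def two_def four_def)
qed

lemma unit_right:
  shows "{#} \<turnstile> {#One#}"
proof -
  have "Rule {#}
      ({#} \<Rrightarrow> {#Fm One#}) \<in> G"
    using FLe_minus by (auto simp: FLe_minus_def)
  from extends_rule4[OF ext this, of One One "{#}" "{#}" "{#}" "{#}"] show ?thesis
    by (simp add: inst_def two_def four_def)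
qed

lemma zero_left:
  shows "{#Zero#} \<turnstile> {#}"
proof -
  have "Rule {#}
      ({#Fm Zero#} \<Rrightarrow> {#}) \<in> G"
    using FLe_minus by (auto simp: FLe_minus_def)
  from extends_rule4[OF ext this, of One One "{#}" "{#}" "{#}" "{#}"] show ?thesis
    by (simp add: inst_def two_def four_def)
qed

lemma unit_left:
  assumes p: "\<Gamma> \<turnstile> \<Delta>"
  shows "add_mset One \<Gamma> \<turnstile> \<Delta>"
proof -
  have "Rule {#{#Ctx 0#} \<Rrightarrow> {#Ctx 1#}#}
      ({#Ctx 0, Fm One#} \<Rrightarrow> {#Ctx 1#}) \<in> G"
    using FLe_minus by (auto simp: FLe_minus_def)
  from extends_rule4[OF ext this, of One One \<Gamma> \<Delta> "{#}" "{#}"] show ?thesis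
    using p over_admitted[OF p] by (simp add: inst_def two_def four_def)
qed

lemma zero_right:
  assumes p: "\<Gamma> \<turnstile> {#}"
  shows "\<Gamma> \<turnstile> {#Zero#}"
proof -
  have "Rule {#{#Ctx 0#} \<Rrightarrow> {#}#}
      ({#Ctx 0#} \<Rrightarrow> {#Fm Zero#}) \<in> G"
    using FLe_minus by (auto simp: FLe_minus_def)
  from extends_rule4[OF ext this, of One One \<Gamma> "{#}" "{#}" "{#}"] show ?thesis
    using p over_admitted[OF p] by (simp add: inst_def two_def four_def)
qed

lemma fuse_left:
  assumes p: "add_mset A (add_mset B \<Gamma>) \<turnstile> \<Delta>"
  shows "add_mset (Fusion A B) \<Gamma> \<turnstile> \<Delta>"
proof -
  have "Rule {#{#Ctx 0, Fm \<phi>0, Fm \<phi>1#} \<Rrightarrow> {#Ctx 1#}#}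
      ({#Ctx 0, Fm (Fusion \<phi>0 \<phi>1)#} \<Rrightarrow> {#Ctx 1#}) \<in> G"
    using FLe_minus by (auto simp: FLe_minus_def)
  from extends_rule4[OF ext this, of A B \<Gamma> \<Delta> "{#}" "{#}"] show ?thesis
    using p over_admitted[OF p] by (simp add: inst_def two_def four_def add_mset_commute)
qed

lemma fuse_right:
  assumes p: "\<Gamma> \<turnstile> add_mset A \<Delta>" and q: "\<Gamma>' \<turnstile> add_mset B \<Delta>'"
  shows "\<Gamma> + \<Gamma>' \<turnstile> add_mset (Fusion A B) (\<Delta> + \<Delta>')"
proof -
  have "Rule {#{#Ctx 0#} \<Rrightarrow> {#Fm \<phi>0#}, {#Ctx 2#} \<Rrightarrow> {#Fm \<phi>1#}#}
      ({#Ctx 0, Ctx 2#} \<Rrightarrow> {#Fm (Fusion \<phi>0 \<phi>1)#}) \<in> G"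
    using FLe_minus by (auto simp: FLe_minus_def)
  from extends_rule4[OF ext this, of A B \<Gamma> "{#}" \<Gamma>' "{#}"] show ?thesis
    using p q over_admitted[OF p] over_admitted[OF q] by (simp add: inst_def two_def four_def)
qed

lemma interpolation_calculus: "interpolation_calculus Single L pr Fusion One Zero"
proof
  fix \<Gamma> \<Delta> assume p: "\<Gamma> \<turnstile> \<Delta>"
  show "mover L \<Gamma> \<and> mover L \<Delta>" using over_admitted(1)[OF p] .
  show "size \<Delta> \<le> 1" if "Single = Single" using over_admitted(2)[OF p] that by simp
  show "\<Gamma> \<turnstile> add_mset Zero \<Delta>" if "Single = Single \<Longrightarrow> \<Delta> = {#}" using p that zero_right by simp
qed (simp_all add: identity and_left1 and_left2 and_right or_left or_right1 or_right2 imp_left imp_right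
  fuse_left fuse_right unit_left unit_right zero_left)

end

locale FLe_bounded_extension = FLe_extension +
  assumes FLe: "FLe \<subseteq> G"
begin

lemma top_right:
  assumes o0: "mover L \<Gamma>"
  shows "\<Gamma> \<turnstile> {#Top#}"
proof -
  have "Rule {#}
      ({#Ctx 0#} \<Rrightarrow> {#Fm Top#}) \<in> G"
    using FLe by (auto simp: FLe_def)
  from extends_rule4[OF ext this, of One One \<Gamma> "{#}" "{#}" "{#}"] show ?thesis
    using o0 by (simp add: inst_def two_def four_def)
qed

lemma bot_left:
  assumes o0: "mover L \<Gamma>" and o1: "mover L \<Delta>" and o2: "size \<Delta> \<le> 1"
  shows "add_mset Bot \<Gamma> \<turnstile> \<Delta>"
proof -
  have "Rule {#}
      ({#Ctx 0, Fm Bot#} \<Rrightarrow> {#Ctx 1#}) \<in> G"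
    using FLe by (auto simp: FLe_def)
  from extends_rule4[OF ext this, of One One \<Gamma> \<Delta> "{#}" "{#}"] show ?thesis
    using o0 o1 o2 by (simp add: inst_def two_def four_def)
qed

lemma has_bounds: "interpolation_calculus.has_bounds Single L pr"
  unfolding interpolation_calculus.has_bounds_def[OF interpolation_calculus]
  using top_right bot_left by simp

end

locale IPC_extension = single_extension +
  assumes IPC: "IPC \<subseteq> G"
begin

lemma identity:
  assumes o0: "over L A"
  shows "{#A#} \<turnstile> {#A#}"
proof -
  have "Rule {#}
      ({#Fm \<phi>0#} \<Rrightarrow> {#Fm \<phi>0#}) \<in> G"
    using IPC by (auto simp: IPC_def)
  from extends_rule4[OF ext this, of A A "{#}" "{#}" "{#}" "{#}"] show ?thesis
    using o0 by (simp add: inst_def two_def four_def)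
qed

lemma unit_right:
  shows "{#} \<turnstile> {#Top#}"
proof -
  have "Rule {#}
      ({#} \<Rrightarrow> {#Fm Top#}) \<in> G"
    using IPC by (auto simp: IPC_def)
  from extends_rule4[OF ext this, of One One "{#}" "{#}" "{#}" "{#}"] show ?thesis
    by (simp add: inst_def two_def four_def)
qed

lemma zero_left:
  shows "{#Bot#} \<turnstile> {#}"
proof -
  have "Rule {#}
      ({#Fm Bot#} \<Rrightarrow> {#}) \<in> G"
    using IPC by (auto simp: IPC_def)
  from extends_rule4[OF ext this, of One One "{#}" "{#}" "{#}" "{#}"] show ?thesis
    by (simp add: inst_def two_def four_def)
qed

lemma weaken:
  assumes p: "\<Gamma> \<turnstile> \<Delta>" and o0: "over L A"
  shows "add_mset A \<Gamma> \<turnstile> \<Delta>"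
proof -
  have "Rule {#{#Ctx 0#} \<Rrightarrow> {#Ctx 1#}#}
      ({#Ctx 0, Fm \<phi>0#} \<Rrightarrow> {#Ctx 1#}) \<in> G"
    using IPC by (auto simp: IPC_def)
  from extends_rule4[OF ext this, of A A \<Gamma> \<Delta> "{#}" "{#}"] show ?thesis
    using p o0 over_admitted[OF p] by (simp add: inst_def two_def four_def)
qed

lemma contract:
  assumes p: "add_mset A (add_mset A \<Gamma>) \<turnstile> \<Delta>"
  shows "add_mset A \<Gamma> \<turnstile> \<Delta>"
proof -
  have "Rule {#{#Ctx 0, Fm \<phi>0, Fm \<phi>0#} \<Rrightarrow> {#Ctx 1#}#}
      ({#Ctx 0, Fm \<phi>0#} \<Rrightarrow> {#Ctx 1#}) \<in> G"
    using IPC by (auto simp: IPC_def)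
  from extends_rule4[OF ext this, of A A \<Gamma> \<Delta> "{#}" "{#}"] show ?thesis
    using p over_admitted[OF p] by (simp add: inst_def two_def four_def)
qed

lemma weaken_right:
  assumes p: "\<Gamma> \<turnstile> {#}" and o0: "over L A"
  shows "\<Gamma> \<turnstile> {#A#}"
proof -
  have "Rule {#{#Ctx 0#} \<Rrightarrow> {#}#}
      ({#Ctx 0#} \<Rrightarrow> {#Fm \<phi>0#}) \<in> G"
    using IPC by (auto simp: IPC_def)
  from extends_rule4[OF ext this, of A A \<Gamma> "{#}" "{#}" "{#}"] show ?thesis
    using p o0 over_admitted[OF p] by (simp add: inst_def two_def four_def)
qed

lemma weaken_context: "\<Gamma> \<turnstile> \<Delta> \<Longrightarrow> mover L M \<Longrightarrow> M + \<Gamma> \<turnstile> \<Delta>"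
  by (induction M) (simp_all add: weaken)

text \<open>Contraction supplies two copies of the conjunction, one projected to each
  conjunct.\<close>

lemma fuse_left:
  assumes p: "add_mset A (add_mset B \<Gamma>) \<turnstile> \<Delta>"
  shows "add_mset (And A B) \<Gamma> \<turnstile> \<Delta>"
proof (rule contract, rule and_left2)
  have "over L A" "over L B" using over_admitted(1)[OF p] by simp_all
  then show "add_mset B (add_mset (And A B) \<Gamma>) \<turnstile> \<Delta>" "over L A"
    using and_left1[OF p] by (simp_all add: add_mset_commute)
qed

text \<open>Additive conjunction becomes multiplicative once both premises are weakened to the joint
  antecedent.\<close>

lemma fuse_right:
  assumes p: "\<Gamma> \<turnstile> add_mset A \<Delta>" and q: "\<Gamma>' \<turnstile> add_mset B \<Delta>'"
  shows "\<Gamma> + \<Gamma>' \<turnstile> add_mset (And A B) (\<Delta> + \<Delta>')"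
proof (rule and_right)
  have "\<Delta> = {#}" "\<Delta>' = {#}" using over_admitted(2)[OF p] over_admitted(2)[OF q] by simp_all
  then show "\<Gamma> + \<Gamma>' \<turnstile> add_mset A (\<Delta> + \<Delta>')" "\<Gamma> + \<Gamma>' \<turnstile> add_mset B (\<Delta> + \<Delta>')"
    using weaken_context[OF p, of \<Gamma>'] weaken_context[OF q, of \<Gamma>] p q
      over_admitted(1)[OF p] over_admitted(1)[OF q] by (simp_all add: add.commute)
qed

lemmas unit_left = weaken[where A = Top]
lemmas zero_right = weaken_right[where A = Bot]

lemma interpolation_calculus: "interpolation_calculus Single L pr And Top Bot"
proof
  fix \<Gamma> \<Delta> assume p: "\<Gamma> \<turnstile> \<Delta>"
  show "mover L \<Gamma> \<and> mover L \<Delta>" using over_admitted(1)[OF p] .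
  show "size \<Delta> \<le> 1" if "Single = Single" using over_admitted(2)[OF p] that by simp
  show "\<Gamma> \<turnstile> add_mset Bot \<Delta>" if "Single = Single \<Longrightarrow> \<Delta> = {#}" using p that zero_right by simp
qed (simp_all add: identity and_left1 and_left2 and_right or_left or_right1 or_right2 imp_left imp_right
  fuse_left fuse_right unit_left unit_right zero_left)

lemma structural: "interpolation_calculus.structural L pr"
  unfolding interpolation_calculus.structural_def[OF interpolation_calculus]
  using weaken contract by blast

lemma has_bounds: "interpolation_calculus.has_bounds Single L pr"
  unfolding interpolation_calculus.has_bounds_def[OF interpolation_calculus]
proof (intro conjI allI impI)
  fix \<Gamma> \<Delta> :: "formula multiset"
  assume ov: "mover L \<Gamma>" "mover L \<Delta>"
  show "\<Gamma> \<turnstile> add_mset Top \<Delta>" if "Single = Single \<longrightarrow> \<Delta> = {#}"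
    using weaken_context[OF unit_right ov(1)] that by simp
  have bot: "add_mset Bot \<Gamma> \<turnstile> {#}"
    using weaken_context[OF zero_left ov(1)] by simp
  assume "Single = Single \<longrightarrow> size \<Delta> \<le> 1"
  then have "size \<Delta> \<le> 1" by simp
  then show "add_mset Bot \<Gamma> \<turnstile> \<Delta>"
    using bot weaken_right[OF bot] ov(2) by (cases rule: size_le_1_cases) simp_all
qed

end

locale CFLe_extension =
  fixes L H G
  assumes calc: "calculus_over L H" and ext: "extends Multi L H G"
    and CFLe_minus: "CFLe_minus \<subseteq> G"
begin

abbreviation pr :: "formula multiset \<Rightarrow> formula multiset \<Rightarrow> bool" (infix "\<turnstile>" 50) where
  "\<Gamma> \<turnstile> \<Delta> \<equiv> provable Multi L H (\<Gamma> \<Rrightarrow> \<Delta>)"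

lemmas over_admitted = provable_overD[OF calc] provable_admitted

lemma and_left1:
  assumes p: "add_mset A \<Gamma> \<turnstile> \<Delta>" and o0: "over L B"
  shows "add_mset (And A B) \<Gamma> \<turnstile> \<Delta>"
proof -
  have "Rule {#{#Ctx 0, Fm \<phi>0#} \<Rrightarrow> {#Ctx 1#}#}
      ({#Ctx 0, Fm (And \<phi>0 \<phi>1)#} \<Rrightarrow> {#Ctx 1#}) \<in> G"
    using CFLe_minus by (auto simp: CFLe_minus_def)
  from extends_rule4[OF ext this, of A B \<Gamma> \<Delta> "{#}" "{#}"] show ?thesis
    using p o0 over_admitted[OF p] by (simp add: inst_def two_def four_def)
qed

lemma and_left2:
  assumes p: "add_mset B \<Gamma> \<turnstile> \<Delta>" and o0: "over L A"
  shows "add_mset (And A B) \<Gamma> \<turnstile> \<Delta>"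
proof -
  have "Rule {#{#Ctx 0, Fm \<phi>1#} \<Rrightarrow> {#Ctx 1#}#}
      ({#Ctx 0, Fm (And \<phi>0 \<phi>1)#} \<Rrightarrow> {#Ctx 1#}) \<in> G"
    using CFLe_minus by (auto simp: CFLe_minus_def)
  from extends_rule4[OF ext this, of A B \<Gamma> \<Delta> "{#}" "{#}"] show ?thesis
    using p o0 over_admitted[OF p] by (simp add: inst_def two_def four_def)
qed

lemma and_right:
  assumes p: "\<Gamma> \<turnstile> add_mset A \<Delta>" and q: "\<Gamma> \<turnstile> add_mset B \<Delta>"
  shows "\<Gamma> \<turnstile> add_mset (And A B) \<Delta>"
proof -
  have "Rule {#{#Ctx 0#} \<Rrightarrow> {#Fm \<phi>0, Ctx 1#}, {#Ctx 0#} \<Rrightarrow> {#Fm \<phi>1, Ctx 1#}#}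
      ({#Ctx 0#} \<Rrightarrow> {#Fm (And \<phi>0 \<phi>1), Ctx 1#}) \<in> G"
    using CFLe_minus by (auto simp: CFLe_minus_def)
  from extends_rule4[OF ext this, of A B \<Gamma> \<Delta> "{#}" "{#}"] show ?thesis
    using p q over_admitted[OF p] over_admitted[OF q] by (simp add: inst_def two_def four_def)
qed

lemma or_left:
  assumes p: "add_mset A \<Gamma> \<turnstile> \<Delta>" and q: "add_mset B \<Gamma> \<turnstile> \<Delta>"
  shows "add_mset (Or A B) \<Gamma> \<turnstile> \<Delta>"
proof -
  have "Rule {#{#Ctx 0, Fm \<phi>0#} \<Rrightarrow> {#Ctx 1#}, {#Ctx 0, Fm \<phi>1#} \<Rrightarrow> {#Ctx 1#}#}
      ({#Ctx 0, Fm (Or \<phi>0 \<phi>1)#} \<Rrightarrow> {#Ctx 1#}) \<in> G"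
    using CFLe_minus by (auto simp: CFLe_minus_def)
  from extends_rule4[OF ext this, of A B \<Gamma> \<Delta> "{#}" "{#}"] show ?thesis
    using p q over_admitted[OF p] over_admitted[OF q] by (simp add: inst_def two_def four_def)
qed

lemma or_right1:
  assumes p: "\<Gamma> \<turnstile> add_mset A \<Delta>" and o0: "over L B"
  shows "\<Gamma> \<turnstile> add_mset (Or A B) \<Delta>"
proof -
  have "Rule {#{#Ctx 0#} \<Rrightarrow> {#Fm \<phi>0, Ctx 1#}#}
      ({#Ctx 0#} \<Rrightarrow> {#Fm (Or \<phi>0 \<phi>1), Ctx 1#}) \<in> G"
    using CFLe_minus by (auto simp: CFLe_minus_def)
  from extends_rule4[OF ext this, of A B \<Gamma> \<Delta> "{#}" "{#}"] show ?thesis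
    using p o0 over_admitted[OF p] by (simp add: inst_def two_def four_def)
qed

lemma or_right2:
  assumes p: "\<Gamma> \<turnstile> add_mset B \<Delta>" and o0: "over L A"
  shows "\<Gamma> \<turnstile> add_mset (Or A B) \<Delta>"
proof -
  have "Rule {#{#Ctx 0#} \<Rrightarrow> {#Fm \<phi>1, Ctx 1#}#}
      ({#Ctx 0#} \<Rrightarrow> {#Fm (Or \<phi>0 \<phi>1), Ctx 1#}) \<in> G"
    using CFLe_minus by (auto simp: CFLe_minus_def)
  from extends_rule4[OF ext this, of A B \<Gamma> \<Delta> "{#}" "{#}"] show ?thesis
    using p o0 over_admitted[OF p] by (simp add: inst_def two_def four_def)
qed

lemma imp_left:
  assumes p: "\<Gamma> \<turnstile> add_mset A \<Delta>" and q: "add_mset B \<Gamma>' \<turnstile> \<Delta>'"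
  shows "add_mset (Imp A B) (\<Gamma> + \<Gamma>') \<turnstile> \<Delta> + \<Delta>'"
proof -
  have "Rule {#{#Ctx 0#} \<Rrightarrow> {#Fm \<phi>0, Ctx 1#}, {#Ctx 2, Fm \<phi>1#} \<Rrightarrow> {#Ctx 3#}#}
      ({#Ctx 0, Ctx 2, Fm (Imp \<phi>0 \<phi>1)#} \<Rrightarrow> {#Ctx 1, Ctx 3#}) \<in> G"
    using CFLe_minus by (auto simp: CFLe_minus_def)
  from extends_rule4[OF ext this, of A B \<Gamma> \<Delta> \<Gamma>' \<Delta>'] show ?thesis
    using p q over_admitted[OF p] over_admitted[OF q] by (simp add: inst_def two_def four_def)
qed

lemma imp_right:
  assumes p: "add_mset A \<Gamma> \<turnstile> add_mset B \<Delta>"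
  shows "\<Gamma> \<turnstile> add_mset (Imp A B) \<Delta>"
proof -
  have "Rule {#{#Ctx 0, Fm \<phi>0#} \<Rrightarrow> {#Fm \<phi>1, Ctx 1#}#}
      ({#Ctx 0#} \<Rrightarrow> {#Fm (Imp \<phi>0 \<phi>1), Ctx 1#}) \<in> G"
    using CFLe_minus by (auto simp: CFLe_minus_def)
  from extends_rule4[OF ext this, of A B \<Gamma> \<Delta> "{#}" "{#}"] show ?thesis
    using p over_admitted[OF p] by (simp add: inst_def two_def four_def)
qed

lemma identity:
  assumes o0: "over L A"
  shows "{#A#} \<turnstile> {#A#}"
proof -
  have "Rule {#}
      ({#Fm \<phi>0#} \<Rrightarrow> {#Fm \<phi>0#}) \<in> G"
    using CFLe_minus by (auto simp: CFLe_minus_def)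
  from extends_rule4[OF ext this, of A A "{#}" "{#}" "{#}" "{#}"] show ?thesis
    using o0 by (simp add: inst_def two_def four_def)
qed

lemma unit_right:
  shows "{#} \<turnstile> {#One#}"
proof -
  have "Rule {#}
      ({#} \<Rrightarrow> {#Fm One#}) \<in> G"
    using CFLe_minus by (auto simp: CFLe_minus_def)
  from extends_rule4[OF ext this, of One One "{#}" "{#}" "{#}" "{#}"] show ?thesis
    by (simp add: inst_def two_def four_def)
qed

lemma zero_left:
  shows "{#Zero#} \<turnstile> {#}"
proof -
  have "Rule {#}
      ({#Fm Zero#} \<Rrightarrow> {#}) \<in> G"
    using CFLe_minus by (auto simp: CFLe_minus_def)
  from extends_rule4[OF ext this, of One One "{#}" "{#}" "{#}" "{#}"] show ?thesis
    by (simp add: inst_def two_def four_def)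
qed

lemma unit_left:
  assumes p: "\<Gamma> \<turnstile> \<Delta>"
  shows "add_mset One \<Gamma> \<turnstile> \<Delta>"
proof -
  have "Rule {#{#Ctx 0#} \<Rrightarrow> {#Ctx 1#}#}
      ({#Ctx 0, Fm One#} \<Rrightarrow> {#Ctx 1#}) \<in> G"
    using CFLe_minus by (auto simp: CFLe_minus_def)
  from extends_rule4[OF ext this, of One One \<Gamma> \<Delta> "{#}" "{#}"] show ?thesis
    using p over_admitted[OF p] by (simp add: inst_def two_def four_def)
qed

lemma zero_right:
  assumes p: "\<Gamma> \<turnstile> \<Delta>"
  shows "\<Gamma> \<turnstile> add_mset Zero \<Delta>"
proof -
  have "Rule {#{#Ctx 0#} \<Rrightarrow> {#Ctx 1#}#}
      ({#Ctx 0#} \<Rrightarrow> {#Fm Zero, Ctx 1#}) \<in> G"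
    using CFLe_minus by (auto simp: CFLe_minus_def)
  from extends_rule4[OF ext this, of One One \<Gamma> \<Delta> "{#}" "{#}"] show ?thesis
    using p over_admitted[OF p] by (simp add: inst_def two_def four_def)
qed

lemma fuse_left:
  assumes p: "add_mset A (add_mset B \<Gamma>) \<turnstile> \<Delta>"
  shows "add_mset (Fusion A B) \<Gamma> \<turnstile> \<Delta>"
proof -
  have "Rule {#{#Ctx 0, Fm \<phi>0, Fm \<phi>1#} \<Rrightarrow> {#Ctx 1#}#}
      ({#Ctx 0, Fm (Fusion \<phi>0 \<phi>1)#} \<Rrightarrow> {#Ctx 1#}) \<in> G"
    using CFLe_minus by (auto simp: CFLe_minus_def)
  from extends_rule4[OF ext this, of A B \<Gamma> \<Delta> "{#}" "{#}"] show ?thesis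
    using p over_admitted[OF p] by (simp add: inst_def two_def four_def add_mset_commute)
qed

lemma fuse_right:
  assumes p: "\<Gamma> \<turnstile> add_mset A \<Delta>" and q: "\<Gamma>' \<turnstile> add_mset B \<Delta>'"
  shows "\<Gamma> + \<Gamma>' \<turnstile> add_mset (Fusion A B) (\<Delta> + \<Delta>')"
proof -
  have "Rule {#{#Ctx 0#} \<Rrightarrow> {#Fm \<phi>0, Ctx 1#}, {#Ctx 2#} \<Rrightarrow> {#Fm \<phi>1, Ctx 3#}#}
      ({#Ctx 0, Ctx 2#} \<Rrightarrow> {#Fm (Fusion \<phi>0 \<phi>1), Ctx 1, Ctx 3#}) \<in> G"
    using CFLe_minus by (auto simp: CFLe_minus_def)
  from extends_rule4[OF ext this, of A B \<Gamma> \<Delta> \<Gamma>' \<Delta>'] show ?thesis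
    using p q over_admitted[OF p] over_admitted[OF q] by (simp add: inst_def two_def four_def)
qed

lemma interpolation_calculus: "interpolation_calculus Multi L pr Fusion One Zero"
proof
  fix \<Gamma> \<Delta> assume p: "\<Gamma> \<turnstile> \<Delta>"
  show "mover L \<Gamma> \<and> mover L \<Delta>" using over_admitted(1)[OF p] .
  show "size \<Delta> \<le> 1" if "Multi = Single" using over_admitted(2)[OF p] that by simp
  show "\<Gamma> \<turnstile> add_mset Zero \<Delta>" if "Multi = Single \<Longrightarrow> \<Delta> = {#}" using p that zero_right by simp
qed (simp_all add: identity and_left1 and_left2 and_right or_left or_right1 or_right2 imp_left imp_right
  fuse_left fuse_right unit_left unit_right zero_left)

end

locale CFLe_bounded_extension = CFLe_extension +
  assumes CFLe: "CFLe \<subseteq> G"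
begin

lemma top_right:
  assumes o0: "mover L \<Gamma>" and o1: "mover L \<Delta>"
  shows "\<Gamma> \<turnstile> add_mset Top \<Delta>"
proof -
  have "Rule {#}
      ({#Ctx 0#} \<Rrightarrow> {#Fm Top, Ctx 1#}) \<in> G"
    using CFLe by (auto simp: CFLe_def)
  from extends_rule4[OF ext this, of One One \<Gamma> \<Delta> "{#}" "{#}"] show ?thesis
    using o0 o1 by (simp add: inst_def two_def four_def)
qed

lemma bot_left:
  assumes o0: "mover L \<Gamma>" and o1: "mover L \<Delta>"
  shows "add_mset Bot \<Gamma> \<turnstile> \<Delta>"
proof -
  have "Rule {#}
      ({#Ctx 0, Fm Bot#} \<Rrightarrow> {#Ctx 1#}) \<in> G"
    using CFLe by (auto simp: CFLe_def)
  from extends_rule4[OF ext this, of One One \<Gamma> \<Delta> "{#}" "{#}"] show ?thesis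
    using o0 o1 by (simp add: inst_def two_def four_def)
qed

lemma has_bounds: "interpolation_calculus.has_bounds Multi L pr"
  unfolding interpolation_calculus.has_bounds_def[OF interpolation_calculus]
  using top_right bot_left by simp

end

section \<open>Instances of semi-analytic rules\<close>

lemma fms_simps [simp]: "fms {#} = {#}" "fms (add_mset A M) = add_mset (Fm A) (fms M)"
  by (simp_all add: fms_def)

lemma ctxs_simps [simp]: "ctxs [] = {#}" "ctxs (i # is) = add_mset (Ctx i) (ctxs is)"
  "ctxs (is @ js) = ctxs is + ctxs js"
  by (simp_all add: ctxs_def)

lemma inst_fms [simp]: "\<Sum>\<^sub># (image_mset (inst_item \<sigma> \<gamma>) (fms M)) = image_mset (subst \<sigma>) M"
  by (induction M) auto

lemma inst_ctxs [simp]: "\<Sum>\<^sub># (image_mset (inst_item \<sigma> \<gamma>) (ctxs is)) = sum_list (map \<gamma> is)"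
  by (induction "is") auto

text \<open>
  A block \<open>(g, ds, Fs)\<close> has the left context \<open>g\<close> and at most one right context, listed in \<open>ds\<close>; all
  kinds of semi-analytic rules without context sharing are of this form.
\<close>

type_synonym block = "nat \<times> nat list \<times> (mformula multiset \<times> mformula multiset) list"

definition block_rule :: "block list \<Rightarrow> mformula multiset \<Rightarrow> mformula multiset \<Rightarrow> rule" where
  "block_rule Bs \<mu> \<nu> = Rule
     (mset [add_mset (Ctx g) (fms \<phi>s) \<Rrightarrow> fms \<psi>s + ctxs ds. (g, ds, Fs) \<leftarrow> Bs, (\<phi>s, \<psi>s) \<leftarrow> Fs])
     (ctxs (map fst Bs) + fms \<mu> \<Rrightarrow> ctxs (concat (map (fst \<circ> snd) Bs)) + fms \<nu>)"

definition block_contexts :: "block list \<Rightarrow> bool" where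
  "block_contexts Bs \<longleftrightarrow>
     distinct (map fst Bs @ concat (map (fst \<circ> snd) Bs)) \<and> (\<forall>(g, ds, Fs) \<in> set Bs. length ds \<le> 1)"

definition block_vars :: "block list \<Rightarrow> mformula \<Rightarrow> bool" where
  "block_vars Bs \<chi> \<longleftrightarrow>
     (\<forall>(g, ds, Fs) \<in> set Bs. \<forall>(\<phi>s, \<psi>s) \<in> set Fs. mvars \<phi>s \<subseteq> vars \<chi> \<and> mvars \<psi>s \<subseteq> vars \<chi>)"

text \<open>No context name occurs twice, so the contexts of the blocks can be prescribed
  independently of each other. Without this, interpolants could not be added to one block
  alone.\<close>

lemma realize_contexts:
  assumes "distinct (map fst Bs @ concat (map (fst \<circ> snd) Bs))"
  shows "\<exists>f. \<forall>i<length Bs. f (fst (Bs ! i)) = \<gamma> i \<and> (\<forall>d \<in> set (fst (snd (Bs ! i))). f d = \<delta> i)"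
  using assms
proof (induction Bs arbitrary: \<gamma> \<delta>)
  case (Cons B Bs)
  then have "distinct (map fst Bs @ concat (map (fst \<circ> snd) Bs))" by (auto simp: comp_def)
  from Cons.IH[OF this, of "\<gamma> \<circ> Suc" "\<delta> \<circ> Suc"] obtain f where
    f: "\<And>i. i < length Bs \<Longrightarrow> f (fst (Bs ! i)) = \<gamma> (Suc i) \<and> (\<forall>d \<in> set (fst (snd (Bs ! i))). f d = \<delta> (Suc i))"
    by auto
  let ?f = "\<lambda>x. if x = fst B then \<gamma> 0 else if x \<in> set (fst (snd B)) then \<delta> 0 else f x"
  have new: "fst (Bs ! i) \<noteq> fst B \<and> fst (Bs ! i) \<notin> set (fst (snd B)) \<and>
    (\<forall>d \<in> set (fst (snd (Bs ! i))). d \<noteq> fst B \<and> d \<notin> set (fst (snd B)))" if "i < length Bs" for i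
  proof -
    define X where "X = map fst Bs"
    define Y where "Y = concat (map (fst \<circ> snd) Bs)"
    define Z where "Z = fst (snd B)"
    have "distinct (fst B # X @ Z @ Y)" using Cons.prems by (simp add: X_def Y_def Z_def comp_def)
    moreover have "fst (Bs ! i) \<in> set X" "set (fst (snd (Bs ! i))) \<subseteq> set Y"
      using nth_mem[OF that] by (auto simp: X_def Y_def)
    ultimately show ?thesis unfolding Z_def[symmetric] by auto
  qed
  have "?f (fst ((B # Bs) ! i)) = \<gamma> i \<and> (\<forall>d \<in> set (fst (snd ((B # Bs) ! i))). ?f d = \<delta> i)"
    if "i < length (B # Bs)" for i
  proof (cases i)
    case 0
    then show ?thesis using Cons.prems by auto
  next
    case (Suc j)
    then show ?thesis using that f[of j] new[of j] by auto
  qed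
  then show ?case by (intro exI[of _ ?f] allI impI)
qed simp

lemma realize_contexts_over:
  assumes "distinct (map fst Bs @ concat (map (fst \<circ> snd) Bs))"
    and ov: "\<And>i. i < length Bs \<Longrightarrow> mover L (\<gamma> i) \<and> mover L (\<delta> i)"
  shows "\<exists>f. (\<forall>x. mover L (f x)) \<and>
    (\<forall>i<length Bs. f (fst (Bs ! i)) = \<gamma> i \<and> (\<forall>d \<in> set (fst (snd (Bs ! i))). f d = \<delta> i))"
proof -
  obtain f where "\<forall>i<length Bs. f (fst (Bs ! i)) = \<gamma> i \<and> (\<forall>d \<in> set (fst (snd (Bs ! i))). f d = \<delta> i)"
    using realize_contexts[OF assms(1)] by blast
  with ov show ?thesis
    \<comment> \<open>A proof step requires every context to be over \<open>L\<close>, also those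
      whose names occur in no block; offending values are reset to the empty multiset.\<close>
    by (intro exI[of _ "\<lambda>x. if mover L (f x) then f x else {#}"]) auto
qed

lemma sum_list_concat_nth:
  "sum_list (map f (concat (map g xs))) = (\<Sum>i<length xs. sum_list (map f (g (xs ! i))) :: 'b :: comm_monoid_add)"
proof -
  have "sum_list (map f (concat (map g xs))) = sum_list (map (\<lambda>x. sum_list (map f (g x))) xs)"
    by (induction xs) auto
  then show ?thesis by (simp add: sum_list_sum_nth atLeast0LessThan)
qed

lemma sum_list_map_nth:
  "sum_list (map f xs) = (\<Sum>i<length xs. f (xs ! i) :: 'b :: comm_monoid_add)"
  by (simp add: sum_list_sum_nth atLeast0LessThan)

lemma prems_block_rule:
  "S \<in># prems (block_rule Bs \<mu> \<nu>) \<longleftrightarrow>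
     (\<exists>i \<phi> \<psi>. i < length Bs \<and> (\<phi>, \<psi>) \<in> set (snd (snd (Bs ! i))) \<and>
        S = (add_mset (Ctx (fst (Bs ! i))) (fms \<phi>) \<Rrightarrow> fms \<psi> + ctxs (fst (snd (Bs ! i)))))"
  by (fastforce simp: block_rule_def in_set_conv_nth[of _ Bs])

text \<open>The sum runs over a multiset, so that a repeated premise is charged as often as it
  occurs, just as in a tree-like proof.\<close>

lemma sum_prems_block_rule:
  "(\<Sum>S \<in># prems (block_rule Bs \<mu> \<nu>). c S) =
     (\<Sum>i<length Bs. \<Sum>(\<phi>, \<psi>) \<leftarrow> snd (snd (Bs ! i)).
        c (add_mset (Ctx (fst (Bs ! i))) (fms \<phi>) \<Rrightarrow> fms \<psi> + ctxs (fst (snd (Bs ! i)))) :: nat)"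
  unfolding block_rule_def rule.sel mset_map[symmetric] sum_mset_sum_list sum_list_concat_nth
  by (simp add: split_def comp_def)

section \<open>Translation of the rule formats into blocks\<close>

text \<open>The two families of premises become blocks without and with a right context. The last
  property records that premises with a right context have no active succedent, which the
  implication case of the interpolation argument relies on.\<close>

lemma left_semi_analytic_block:
  assumes "left_semi_analytic R"
  obtains Bs \<chi> where "R = block_rule Bs {#\<chi>#} {#}" "block_contexts Bs" "block_vars Bs \<chi>"
    "\<And>g ds Fs \<phi> \<psi>. (g, ds, Fs) \<in> set Bs \<Longrightarrow> ds \<noteq> [] \<Longrightarrow> (\<phi>, \<psi>) \<in> set Fs \<Longrightarrow> \<psi> = {#}"
proof -
  from assms obtain P :: "(nat \<times> (mformula multiset \<times> mformula multiset) list) list"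
      and Q :: "(nat \<times> nat \<times> mformula multiset list) list" and \<chi> where
    d: "distinct (map fst P @ map fst Q @ map (fst \<circ> snd) Q)" and
    v: "\<forall>(p, Fs) \<in> set P. \<forall>(\<psi>s, \<theta>s) \<in> set Fs. mvars \<psi>s \<subseteq> vars \<chi> \<and> mvars \<theta>s \<subseteq> vars \<chi>"
      "\<forall>(g, d, Fs) \<in> set Q. \<forall>\<phi>s \<in> set Fs. mvars \<phi>s \<subseteq> vars \<chi>" and
    R: "R = Rule
          (mset [add_mset (Ctx p) (fms \<psi>s) \<Rrightarrow> fms \<theta>s. (p, Fs) \<leftarrow> P, (\<psi>s, \<theta>s) \<leftarrow> Fs] +
           mset [add_mset (Ctx g) (fms \<phi>s) \<Rrightarrow> {#Ctx d#}. (g, d, Fs) \<leftarrow> Q, \<phi>s \<leftarrow> Fs])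
          (add_mset (Fm \<chi>) (ctxs (map fst P) + ctxs (map fst Q)) \<Rrightarrow> ctxs (map (fst \<circ> snd) Q))"
    unfolding left_semi_analytic_def by blast
  let ?Bs = "map (\<lambda>(p, Fs). (p, [], Fs)) P @ map (\<lambda>(g, d, Fs). (g, [d], map (\<lambda>\<phi>. (\<phi>, {#})) Fs)) Q"
  have 1: "map fst ?Bs = map fst P @ map fst Q" by (simp add: split_def comp_def)
  have 2: "concat (map (fst \<circ> snd) ?Bs) = map (fst \<circ> snd) Q" by (simp add: split_def comp_def)
  show thesis
  proof (rule that)
    show "R = block_rule ?Bs {#\<chi>#} {#}"
      unfolding block_rule_def R 1 2 by (simp add: split_def comp_def)
    show "block_contexts ?Bs" unfolding block_contexts_def 1 2 using d by auto
    show "block_vars ?Bs \<chi>" using v by (fastforce simp: block_vars_def)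
  qed auto
qed

lemma right_semi_analytic_block:
  assumes "right_semi_analytic R"
  obtains Bs \<chi> where "R = block_rule Bs {#} {#\<chi>#}" "block_contexts Bs" "block_vars Bs \<chi>"
proof -
  from assms obtain P :: "(nat \<times> (mformula multiset \<times> mformula multiset) list) list" and \<chi> where
    d: "distinct (map fst P)" and
    v: "\<forall>(p, Fs) \<in> set P. \<forall>(\<psi>s, \<theta>s) \<in> set Fs. mvars \<psi>s \<subseteq> vars \<chi> \<and> mvars \<theta>s \<subseteq> vars \<chi>" and
    R: "R = Rule
          (mset [add_mset (Ctx g) (fms \<phi>s) \<Rrightarrow> fms \<psi>s. (g, Fs) \<leftarrow> P, (\<phi>s, \<psi>s) \<leftarrow> Fs])
          (ctxs (map fst P) \<Rrightarrow> {#Fm \<chi>#})"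
    unfolding right_semi_analytic_def by blast
  let ?Bs = "map (\<lambda>(p, Fs). (p, [], Fs)) P"
  have 1: "map fst ?Bs = map fst P" by (simp add: split_def comp_def)
  have 2: "concat (map (fst \<circ> snd) ?Bs) = []" by (simp add: split_def comp_def)
  show thesis
  proof (rule that)
    show "R = block_rule ?Bs {#} {#\<chi>#}"
      unfolding block_rule_def R 1 2 by (simp add: split_def comp_def)
    show "block_contexts ?Bs" unfolding block_contexts_def 1 2 using d by auto
    show "block_vars ?Bs \<chi>" using v by (fastforce simp: block_vars_def)
  qed
qed

lemma multi_semi_analytic_block:
  assumes "multi_left_semi_analytic R \<or> multi_right_semi_analytic R"
  obtains Bs \<mu> \<nu> \<chi> where "R = block_rule Bs \<mu> \<nu>" "\<mu> + \<nu> = {#\<chi>#}" "block_contexts Bs" "block_vars Bs \<chi>"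
proof -
  from assms obtain Q :: "(nat \<times> nat \<times> (mformula multiset \<times> mformula multiset) list) list" and \<chi> \<mu> \<nu> where
    d: "distinct (map fst Q @ map (fst \<circ> snd) Q)" and
    v: "\<forall>(g, d, Fs) \<in> set Q. \<forall>(\<psi>s, \<theta>s) \<in> set Fs. mvars \<psi>s \<subseteq> vars \<chi> \<and> mvars \<theta>s \<subseteq> vars \<chi>" and
    R: "R = Rule
          (mset [add_mset (Ctx g) (fms \<phi>s) \<Rrightarrow> add_mset (Ctx d) (fms \<psi>s).
                   (g, d, Fs) \<leftarrow> Q, (\<phi>s, \<psi>s) \<leftarrow> Fs])
          (ctxs (map fst Q) + fms \<mu> \<Rrightarrow> ctxs (map (fst \<circ> snd) Q) + fms \<nu>)" and
    main: "\<mu> + \<nu> = {#\<chi>#}"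
    unfolding multi_left_semi_analytic_def multi_right_semi_analytic_def
  proof (elim disjE exE conjE, goal_cases)
    case (1 Q \<chi>)
    show ?case by (rule 1(1)[of Q \<chi> "{#\<chi>#}" "{#}"]) (use 1(2-) in simp_all)
  next
    case (2 Q \<chi>)
    show ?case by (rule 2(1)[of Q \<chi> "{#}" "{#\<chi>#}"]) (use 2(2-) in simp_all)
  qed
  let ?Bs = "map (\<lambda>(g, d, Fs). (g, [d], Fs)) Q"
  have 1: "map fst ?Bs = map fst Q" by (simp add: split_def comp_def)
  have 2: "concat (map (fst \<circ> snd) ?Bs) = map (fst \<circ> snd) Q" by (simp add: split_def comp_def)
  show thesis
  proof (rule that)
    show "R = block_rule ?Bs \<mu> \<nu>"
      unfolding block_rule_def R 1 2 by (simp add: split_def comp_def)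
    show "block_contexts ?Bs" unfolding block_contexts_def 1 2 using d by auto
    show "block_vars ?Bs \<chi>" using v by (fastforce simp: block_vars_def)
  qed (rule main)
qed

text \<open>By distinctness of the names, the left context of block \<open>i\<close> can occur only
  in premises of that block; a context that has to occur in a premise thus provides one.\<close>

lemma block_nonempty:
  assumes "contexts_in_premises (block_rule Bs \<mu> \<nu>)" and "block_contexts Bs" and i: "i < length Bs"
  shows "snd (snd (Bs ! i)) \<noteq> []"
proof -
  have "Ctx (fst (Bs ! i)) \<in># ante (concl (block_rule Bs \<mu> \<nu>))"
    using i by (auto simp: block_rule_def ctxs_def)
  then obtain S where S: "S \<in># prems (block_rule Bs \<mu> \<nu>)" "Ctx (fst (Bs ! i)) \<in># ante S + succ S"
    using assms(1) unfolding contexts_in_premises_def by fastforce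
  then obtain j \<phi> \<psi> where j: "j < length Bs" "(\<phi>, \<psi>) \<in> set (snd (snd (Bs ! j)))"
    "Ctx (fst (Bs ! i)) = Ctx (fst (Bs ! j)) \<or> Ctx (fst (Bs ! i)) \<in># ctxs (fst (snd (Bs ! j)))"
    unfolding prems_block_rule by (auto simp: fms_def)
  have d: "distinct (map fst Bs)" "set (map fst Bs) \<inter> set (concat (map (fst \<circ> snd) Bs)) = {}"
    using assms(2) by (auto simp: block_contexts_def)
  have "fst (Bs ! i) \<in> set (map fst Bs)" using i by simp
  moreover have "set (fst (snd (Bs ! j))) \<subseteq> set (concat (map (fst \<circ> snd) Bs))"
    using nth_mem[OF j(1)] by auto
  ultimately have "fst (Bs ! i) \<notin> set (fst (snd (Bs ! j)))" using d(2) by blast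
  with j(3) have "fst (Bs ! i) = fst (Bs ! j)" by (auto simp: ctxs_def)
  then have "i = j" using d(1) i j(1) nth_eq_iff_index_eq[of "map fst Bs" i j] by simp
  with j(2) show ?thesis by auto
qed

lemma admitted_iff: "admitted m S \<longleftrightarrow> (m = Single \<longrightarrow> size (succ S) \<le> 1)"
  by (cases m) auto

lemma inst_block_premise:
  "inst \<sigma> \<gamma> (add_mset (Ctx g) (fms \<phi>) \<Rrightarrow> fms \<psi> + ctxs ds) =
     (\<gamma> g + image_mset (subst \<sigma>) \<phi> \<Rrightarrow> image_mset (subst \<sigma>) \<psi> + sum_list (map \<gamma> ds))"
  by (simp add: inst_def)

lemma inst_block_concl:
  "inst \<sigma> \<gamma> (concl (block_rule Bs \<mu> \<nu>)) =
     ((\<Sum>i<length Bs. \<gamma> (fst (Bs ! i))) + image_mset (subst \<sigma>) \<mu> \<Rrightarrow>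
      (\<Sum>i<length Bs. sum_list (map \<gamma> (fst (snd (Bs ! i))))) + image_mset (subst \<sigma>) \<nu>)"
  by (simp add: inst_def block_rule_def sum_list_concat_nth) (simp add: sum_list_map_nth)

section \<open>Interpolation for the rules of a concrete calculus\<close>

locale semi_analytic_calculus =
  interpolation_calculus m L "\<lambda>\<Gamma> \<Delta>. provable m L H (\<Gamma> \<Rrightarrow> \<Delta>)" fuse unit zero
  for m L H fuse unit zero +
  assumes calc: "calculus_over L H" and modal: "modal_condition H"
begin

lemma block_admits:
  assumes R: "block_rule Bs \<mu> \<nu> \<in> H" and ctx: "block_contexts Bs" and \<sigma>: "\<And>x. over L (\<sigma> x)"
  shows "admits {..<length Bs}
    (\<lambda>i. map (map_prod (image_mset (subst \<sigma>)) (image_mset (subst \<sigma>))) (snd (snd (Bs ! i))))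
    {i. fst (snd (Bs ! i)) \<noteq> []} (image_mset (subst \<sigma>) \<mu>) (image_mset (subst \<sigma>) \<nu>)"
  unfolding admits_def
proof (intro allI impI)
  let ?I = "{..<length Bs}"
  fix \<gamma> \<delta> :: "nat \<Rightarrow> formula multiset"
  assume a: "\<forall>i\<in>?I. mover L (\<gamma> i) \<and> mover L (\<delta> i) \<and>
      (i \<notin> {i. fst (snd (Bs ! i)) \<noteq> []} \<longrightarrow> \<delta> i = {#}) \<and>
      (\<forall>(\<phi>, \<psi>) \<in> set (map (map_prod (image_mset (subst \<sigma>)) (image_mset (subst \<sigma>))) (snd (snd (Bs ! i)))).
         provable m L H (\<gamma> i + \<phi> \<Rrightarrow> \<psi> + \<delta> i))"
    and s: "m = Single \<longrightarrow> size (sum \<delta> ?I + image_mset (subst \<sigma>) \<nu>) \<le> 1"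
  have ov: "mover L (\<gamma> i) \<and> mover L (\<delta> i)" if "i < length Bs" for i using a that by blast
  have dist: "distinct (map fst Bs @ concat (map (fst \<circ> snd) Bs))"
    using ctx by (simp add: block_contexts_def)
  obtain f where f: "\<And>x. mover L (f x)" "\<And>i. i < length Bs \<Longrightarrow> f (fst (Bs ! i)) = \<gamma> i"
    "\<And>i d. i < length Bs \<Longrightarrow> d \<in> set (fst (snd (Bs ! i))) \<Longrightarrow> f d = \<delta> i"
    using realize_contexts_over[of Bs L \<gamma> \<delta>, OF dist ov] by blast
  \<comment> \<open>A block has at most one right context, and where it has none,
    \<open>admits\<close> demands that \<open>\<delta> i\<close> be empty.\<close>
  have ds: "sum_list (map f (fst (snd (Bs ! i)))) = \<delta> i" if i: "i < length Bs" for i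
  proof (cases "fst (snd (Bs ! i))")
    case Nil
    then show ?thesis using a i by simp
  next
    case (Cons d ds)
    have "length (fst (snd (Bs ! i))) \<le> 1"
      using ctx nth_mem[OF i] unfolding block_contexts_def by (auto simp: split_def)
    with Cons have "fst (snd (Bs ! i)) = [d]" by simp
    then show ?thesis using f(3)[OF i, of d] by simp
  qed
  have concl: "inst \<sigma> f (concl (block_rule Bs \<mu> \<nu>)) =
    (sum \<gamma> ?I + image_mset (subst \<sigma>) \<mu> \<Rrightarrow> sum \<delta> ?I + image_mset (subst \<sigma>) \<nu>)"
    unfolding inst_block_concl using f(2) ds by simp
  have "provable m L H (inst \<sigma> f (concl (block_rule Bs \<mu> \<nu>)))"
  proof (rule provable_rule[OF R \<sigma> f(1)])
    fix S assume "S \<in># prems (block_rule Bs \<mu> \<nu>)"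
    then obtain i \<phi> \<psi> where i: "i < length Bs" "(\<phi>, \<psi>) \<in> set (snd (snd (Bs ! i)))"
      "S = (add_mset (Ctx (fst (Bs ! i))) (fms \<phi>) \<Rrightarrow> fms \<psi> + ctxs (fst (snd (Bs ! i))))"
      unfolding prems_block_rule by blast
    then show "provable m L H (inst \<sigma> f S)"
      unfolding i(3) inst_block_premise ds[OF i(1)] f(2)[OF i(1)] using a by fastforce
  next
    show "admitted m (inst \<sigma> f (concl (block_rule Bs \<mu> \<nu>)))"
      unfolding concl admitted_iff using s by simp
  qed
  then show "provable m L H (sum \<gamma> ?I + image_mset (subst \<sigma>) \<mu> \<Rrightarrow> sum \<delta> ?I + image_mset (subst \<sigma>) \<nu>)"
    unfolding concl .
qed

text \<open>The cost \<open>c\<close> is an arbitrary function on sequents, which keeps the argument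
  independent of the proofs that the premises come from.\<close>

lemma block_interpolable:
  assumes R: "block_rule Bs \<mu> \<nu> \<in> H" and ctx: "block_contexts Bs" and vs: "block_vars Bs \<chi>"
    and main: "\<mu> + \<nu> = {#\<chi>#}"
    and bnd: "has_bounds \<or> contexts_in_premises (block_rule Bs \<mu> \<nu>)"
    and shape: "\<And>g ds Fs \<phi> \<psi>. m = Single \<Longrightarrow> \<nu> = {#} \<Longrightarrow> (g, ds, Fs) \<in> set Bs \<Longrightarrow> ds \<noteq> [] \<Longrightarrow>
      (\<phi>, \<psi>) \<in> set Fs \<Longrightarrow> \<psi> = {#}"
    and \<sigma>: "\<And>x. over L (\<sigma> x)" and \<gamma>: "\<And>i. mover L (\<gamma> i)"
    and IH: "\<And>S. S \<in># prems (block_rule Bs \<mu> \<nu>) \<Longrightarrow> interpolable (inst \<sigma> \<gamma> S) (c (inst \<sigma> \<gamma> S))"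
    and ad: "admitted m (inst \<sigma> \<gamma> (concl (block_rule Bs \<mu> \<nu>)))"
  shows "interpolable (inst \<sigma> \<gamma> (concl (block_rule Bs \<mu> \<nu>)))
    (28 + (\<Sum>S \<in># prems (block_rule Bs \<mu> \<nu>). c (inst \<sigma> \<gamma> S)))"
proof -
  let ?s = "image_mset (subst \<sigma>)"
  let ?F = "\<lambda>i. map (map_prod ?s ?s) (snd (snd (Bs ! i)))"
  let ?\<gamma> = "\<lambda>i. \<gamma> (fst (Bs ! i))" and ?\<delta> = "\<lambda>i. sum_list (map \<gamma> (fst (snd (Bs ! i))))"
  let ?n = "\<lambda>i (\<phi>, \<psi>). c (?\<gamma> i + \<phi> \<Rrightarrow> \<psi> + ?\<delta> i)"
  have mem: "\<exists>g ds Fs. (g, ds, Fs) \<in> set Bs \<and> fst (snd (Bs ! i)) = ds \<and> snd (snd (Bs ! i)) = Fs"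
    if "i < length Bs" for i
    using nth_mem[OF that] by (metis prod.collapse)
  have "interpolable (sum ?\<gamma> {..<length Bs} + ?s \<mu> \<Rrightarrow> sum ?\<delta> {..<length Bs} + ?s \<nu>)
    (28 + (\<Sum>i<length Bs. \<Sum>p\<leftarrow>?F i. ?n i p))"
  proof (rule admits_interpolable[OF block_admits[OF R ctx \<sigma>]])
    show "?s \<mu> + ?s \<nu> = {#subst \<sigma> \<chi>#}"
      using main by (metis image_mset_single image_mset_union)
    show "has_bounds \<or> (\<forall>i\<in>{..<length Bs}. ?F i \<noteq> [])"
      using bnd block_nonempty[OF _ ctx] by auto
    show "m = Single \<Longrightarrow> size (sum ?\<delta> {..<length Bs} + ?s \<nu>) \<le> 1"
      using ad unfolding inst_block_concl admitted_iff by simp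
  next
    fix i \<phi> \<psi> assume i: "i \<in> {..<length Bs}" and "(\<phi>, \<psi>) \<in> set (?F i)"
    then obtain \<phi>' \<psi>' where p: "\<phi> = ?s \<phi>'" "\<psi> = ?s \<psi>'" "(\<phi>', \<psi>') \<in> set (snd (snd (Bs ! i)))" by auto
    obtain g ds Fs where B: "(g, ds, Fs) \<in> set Bs" "fst (snd (Bs ! i)) = ds" "snd (snd (Bs ! i)) = Fs"
      using mem i by blast
    have "mvars \<phi>' \<subseteq> vars \<chi>" "mvars \<psi>' \<subseteq> vars \<chi>"
      using vs B p(3) unfolding block_vars_def by fastforce+
    then show "mvars (\<phi> + \<psi>) \<subseteq> vars (subst \<sigma> \<chi>)" using p mvars_subst_mono by simp
    show "interpolable (?\<gamma> i + \<phi> \<Rrightarrow> \<psi> + ?\<delta> i) (?n i (\<phi>, \<psi>))"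
      using IH[of "add_mset (Ctx (fst (Bs ! i))) (fms \<phi>') \<Rrightarrow> fms \<psi>' + ctxs (fst (snd (Bs ! i)))"] p i
      unfolding prems_block_rule inst_block_premise by auto
    show "m = Single \<Longrightarrow> ?s \<nu> = {#} \<Longrightarrow> i \<in> {i. fst (snd (Bs ! i)) \<noteq> []} \<Longrightarrow> \<psi> = {#}"
      using shape[OF _ _ B(1), of \<phi>' \<psi>'] p B by auto
  next
    fix i assume "i \<in> {..<length Bs}"
    have "mover L (sum_list (map \<gamma> ds))" for ds by (induction ds) (simp_all add: \<gamma>)
    then show "mover L (?\<gamma> i) \<and> mover L (?\<delta> i)" using \<gamma> by simp
  qed auto
  moreover have "(\<Sum>i<length Bs. \<Sum>p\<leftarrow>?F i. ?n i p) = (\<Sum>S \<in># prems (block_rule Bs \<mu> \<nu>). c (inst \<sigma> \<gamma> S))"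
    unfolding sum_prems_block_rule inst_block_premise by (simp add: comp_def split_def)
  ultimately show ?thesis unfolding inst_block_concl by simp
qed

lemma context_sharing_interpolable:
  assumes RH: "R \<in> H" and cs: "context_sharing_semi_analytic R"
    and st: structural and hb: has_bounds and S: "m = Single"
    and \<sigma>: "\<And>x. over L (\<sigma> x)" and \<gamma>: "\<And>i. mover L (\<gamma> i)"
    and IH: "\<And>S. S \<in># prems R \<Longrightarrow> interpolable (inst \<sigma> \<gamma> S) (c (inst \<sigma> \<gamma> S))"
    and ad: "admitted m (inst \<sigma> \<gamma> (concl R))"
  shows "interpolable (inst \<sigma> \<gamma> (concl R)) (28 + (\<Sum>S \<in># prems R. c (inst \<sigma> \<gamma> S)))"
proof -
  from cs obtain Q :: "(nat \<times> nat \<times> (mformula multiset \<times> mformula multiset) list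
              \<times> mformula multiset list) list" and \<chi> where
    dist: "distinct (map fst Q @ map (fst \<circ> snd) Q)" and
    v: "\<forall>(g, d, Es, Fs) \<in> set Q.
           (\<forall>(\<psi>s, \<theta>s) \<in> set Es. mvars \<psi>s \<subseteq> vars \<chi> \<and> mvars \<theta>s \<subseteq> vars \<chi>) \<and>
           (\<forall>\<phi>s \<in> set Fs. mvars \<phi>s \<subseteq> vars \<chi>)" and
    R: "R = Rule
          (mset [add_mset (Ctx g) (fms \<psi>s) \<Rrightarrow> fms \<theta>s. (g, d, Es, Fs) \<leftarrow> Q, (\<psi>s, \<theta>s) \<leftarrow> Es] +
           mset [add_mset (Ctx g) (fms \<phi>s) \<Rrightarrow> {#Ctx d#}. (g, d, Es, Fs) \<leftarrow> Q, \<phi>s \<leftarrow> Fs])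
          (add_mset (Fm \<chi>) (ctxs (map fst Q)) \<Rrightarrow> ctxs (map (fst \<circ> snd) Q))"
    unfolding context_sharing_semi_analytic_def by blast
  define g where "g i = fst (Q ! i)" for i
  define d where "d i = fst (snd (Q ! i))" for i
  define E where "E i = fst (snd (snd (Q ! i)))" for i
  define F where "F i = snd (snd (snd (Q ! i)))" for i
  let ?s = "image_mset (subst \<sigma>)" and ?I = "{..<length Q}"
  have Qi: "Q ! i = (g i, d i, E i, F i)" for i by (simp add: g_def d_def E_def F_def)
  have mem: "(g i, d i, E i, F i) \<in> set Q" if "i < length Q" for i
    using nth_mem[OF that] unfolding Qi .
  have prem: "S \<in># prems R \<longleftrightarrow> (\<exists>i<length Q. (\<exists>\<psi> \<theta>. (\<psi>, \<theta>) \<in> set (E i) \<and> S = (add_mset (Ctx (g i)) (fms \<psi>) \<Rrightarrow> fms \<theta>))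
    \<or> (\<exists>\<phi>. \<phi> \<in> set (F i) \<and> S = (add_mset (Ctx (g i)) (fms \<phi>) \<Rrightarrow> {#Ctx (d i)#})))" for S
    by (fastforce simp: R in_set_conv_nth[of _ Q] Qi)
  have iE: "inst \<sigma> f (add_mset (Ctx (g i)) (fms \<psi>) \<Rrightarrow> fms \<theta>) = (f (g i) + ?s \<psi> \<Rrightarrow> ?s \<theta>)"
    and iF: "inst \<sigma> f (add_mset (Ctx (g i)) (fms \<psi>) \<Rrightarrow> {#Ctx (d i)#}) = (f (g i) + ?s \<psi> \<Rrightarrow> f (d i))" for f i \<psi> \<theta>
    by (simp_all add: inst_def)
  have concl: "inst \<sigma> f (concl R) = ((\<Sum>i<length Q. f (g i)) + {#subst \<sigma> \<chi>#} \<Rrightarrow> (\<Sum>i<length Q. f (d i)))" for f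
    by (simp add: inst_def R) (simp add: sum_list_map_nth g_def d_def)
  let ?nE = "\<lambda>i (\<psi>, \<theta>). c (\<gamma> (g i) + \<psi> \<Rrightarrow> \<theta>)" and ?nF = "\<lambda>i \<phi>. c (\<gamma> (g i) + \<phi> \<Rrightarrow> \<gamma> (d i))"
  have sum: "(\<Sum>S \<in># prems R. c (inst \<sigma> \<gamma> S)) =
    (\<Sum>i<length Q. (\<Sum>p\<leftarrow>map (map_prod ?s ?s) (E i). ?nE i p) + (\<Sum>\<phi>\<leftarrow>map ?s (F i). ?nF i \<phi>))"
    unfolding R rule.sel mset_append[symmetric] mset_map[symmetric] sum_mset_sum_list map_append
      sum_list_append sum_list_concat_nth sum.distrib
    by (simp add: Qi comp_def split_def iE iF)
  show ?thesis unfolding concl sum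
  proof (rule interpolable_context_sharing[OF st hb S])
    fix \<gamma>' \<delta>' :: "nat \<Rightarrow> formula multiset"
    assume a: "\<And>i. i \<in> ?I \<Longrightarrow> mover L (\<gamma>' i) \<and> mover L (\<delta>' i) \<and>
        (\<forall>(\<psi>, \<theta>) \<in> set (map (map_prod ?s ?s) (E i)). provable m L H (\<gamma>' i + \<psi> \<Rrightarrow> \<theta>)) \<and>
        (\<forall>\<phi> \<in> set (map ?s (F i)). provable m L H (\<gamma>' i + \<phi> \<Rrightarrow> \<delta>' i))"
      and sz: "size (sum \<delta>' ?I) \<le> 1"
    \<comment> \<open>\<open>realize_contexts_over\<close> ignores the third component of a block,
      so with the dummy \<open>()\<close> it also serves the two families of a context-sharing
      rule.\<close>
    let ?Bs = "map (\<lambda>(g, d, Es, Fs). (g, [d], ())) Q"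
    have 1: "map fst ?Bs = map fst Q" "concat (map (fst \<circ> snd) ?Bs) = map (fst \<circ> snd) Q"
      by (simp_all add: split_def comp_def)
    have "\<exists>f. (\<forall>x. mover L (f x)) \<and>
      (\<forall>i<length ?Bs. f (fst (?Bs ! i)) = \<gamma>' i \<and> (\<forall>d \<in> set (fst (snd (?Bs ! i))). f d = \<delta>' i))"
      by (rule realize_contexts_over) (use dist a in \<open>simp_all only: 1 length_map lessThan_iff\<close>)
    then obtain f where f: "\<And>x. mover L (f x)" "\<And>i. i < length Q \<Longrightarrow> f (g i) = \<gamma>' i"
      "\<And>i. i < length Q \<Longrightarrow> f (d i) = \<delta>' i"
      by (auto simp: Qi)
    have cf: "inst \<sigma> f (concl R) = (sum \<gamma>' ?I + {#subst \<sigma> \<chi>#} \<Rrightarrow> sum \<delta>' ?I)"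
      unfolding concl using f by simp
    have "provable m L H (inst \<sigma> f (concl R))"
    proof (rule provable_rule[OF RH \<sigma> f(1)])
      fix S assume "S \<in># prems R"
      then obtain i where i: "i < length Q"
        and "(\<exists>\<psi> \<theta>. (\<psi>, \<theta>) \<in> set (E i) \<and> S = (add_mset (Ctx (g i)) (fms \<psi>) \<Rrightarrow> fms \<theta>)) \<or>
          (\<exists>\<phi>. \<phi> \<in> set (F i) \<and> S = (add_mset (Ctx (g i)) (fms \<phi>) \<Rrightarrow> {#Ctx (d i)#}))"
        unfolding prem by blast
      from this(2) show "provable m L H (inst \<sigma> f S)"
      proof (elim disjE exE conjE)
        fix \<psi> \<theta> assume "(\<psi>, \<theta>) \<in> set (E i)" "S = (add_mset (Ctx (g i)) (fms \<psi>) \<Rrightarrow> fms \<theta>)"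
        then show ?thesis using a[of i] i f(2)[OF i] iE by fastforce
      next
        fix \<phi> assume "\<phi> \<in> set (F i)" "S = (add_mset (Ctx (g i)) (fms \<phi>) \<Rrightarrow> {#Ctx (d i)#})"
        then show ?thesis using a[of i] i f(2,3)[OF i] iF by simp
      qed
    next
      show "admitted m (inst \<sigma> f (concl R))" unfolding cf admitted_iff using sz by simp
    qed
    then show "provable m L H (sum \<gamma>' ?I + {#subst \<sigma> \<chi>#} \<Rrightarrow> sum \<delta>' ?I)" unfolding cf .
  next
    fix i \<phi> \<psi> assume i: "i \<in> ?I" and "(\<phi>, \<psi>) \<in> set (map (map_prod ?s ?s) (E i))"
    then obtain \<phi>' \<psi>' where p: "\<phi> = ?s \<phi>'" "\<psi> = ?s \<psi>'" "(\<phi>', \<psi>') \<in> set (E i)" by auto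
    have "mvars \<phi>' \<subseteq> vars \<chi>" "mvars \<psi>' \<subseteq> vars \<chi>" using v mem[of i] i p(3) by fastforce+
    then show "mvars (\<phi> + \<psi>) \<subseteq> vars (subst \<sigma> \<chi>)" using p mvars_subst_mono by simp
    have "add_mset (Ctx (g i)) (fms \<phi>') \<Rrightarrow> fms \<psi>' \<in># prems R" unfolding prem using i p(3) by blast
    from IH[OF this] show "interpolable (\<gamma> (g i) + \<phi> \<Rrightarrow> \<psi>) (?nE i (\<phi>, \<psi>))"
      unfolding iE p by simp
  next
    fix i \<phi> assume i: "i \<in> ?I" and "\<phi> \<in> set (map ?s (F i))"
    then obtain \<phi>' where p: "\<phi> = ?s \<phi>'" "\<phi>' \<in> set (F i)" by auto
    have "mvars \<phi>' \<subseteq> vars \<chi>" using v mem[of i] i p(2) by fastforce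
    then show "mvars \<phi> \<subseteq> vars (subst \<sigma> \<chi>)" using p mvars_subst_mono by simp
    have "add_mset (Ctx (g i)) (fms \<phi>') \<Rrightarrow> {#Ctx (d i)#} \<in># prems R" unfolding prem using i p(2) by blast
    from IH[OF this] show "interpolable (\<gamma> (g i) + \<phi> \<Rrightarrow> \<gamma> (d i)) (?nF i \<phi>)"
      unfolding iF p by simp
  next
    show "size (\<Sum>i<length Q. \<gamma> (d i)) \<le> 1" using ad S unfolding concl admitted_iff by simp
  qed (use \<gamma> in simp_all)
qed

section \<open>Focused axioms of the calculus\<close>

lemma wt_le_enc_seq: "wt (ante S) + wt (succ S) \<le> length (enc_seq S)"
proof -
  have *: "wt M \<le> length (enc_mset M)" for M
  proof -
    let ?xs = "sorted_list_of_multiset (image_mset enc_fm M)"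
    have "length (concat ?xs) = (\<Sum>x\<in>#mset ?xs. length x)"
      by (simp only: length_concat sum_mset_sum_list[symmetric] mset_map)
    also have "\<dots> = wt M" by (simp add: image_mset.compositionality comp_def)
    finally show ?thesis by (simp add: enc_mset_def)
  qed
  show ?thesis unfolding enc_seq_def length_append by (intro add_mono *)
qed

lemma same_vars_subst:
  assumes "same_vars M" and "A \<in># image_mset (subst \<sigma>) M" "B \<in># image_mset (subst \<sigma>) M"
  shows "vars A = vars B"
proof -
  from assms(2,3) obtain A' B' where "A' \<in># M" "A = subst \<sigma> A'" "B' \<in># M" "B = subst \<sigma> B'"
    by auto
  moreover from this have "vars A' = vars B'" using assms(1) unfolding same_vars_def by blast
  ultimately show ?thesis by (simp only: vars_subst)
qed

lemma context_free_axiom_interpolable: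
  assumes R: "R \<in> H" and ax: "context_free_focused_axiom R"
    and \<sigma>: "\<And>x. over L (\<sigma> x)" and \<gamma>: "\<And>i. mover L (\<gamma> i)"
    and ad: "admitted m (inst \<sigma> \<gamma> (concl R))"
  shows "interpolable (inst \<sigma> \<gamma> (concl R)) (28 + 4 * length (enc_seq (inst \<sigma> \<gamma> (concl R))))"
proof -
  note wt = wt_le_enc_seq[of "inst \<sigma> \<gamma> (concl R)"]
  have no: "prems R = {#}" using ax by (auto simp: context_free_focused_axiom_def)
  have pr: "provable m L H (inst \<sigma> \<gamma> (concl R))"
    by (rule provable_rule[OF R \<sigma> \<gamma> _ ad]) (simp add: no)
  let ?s = "image_mset (subst \<sigma>)"
  from ax consider (id) \<phi> where "R = Rule {#} ({#Fm \<phi>#} \<Rrightarrow> {#Fm \<phi>#})"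
    | (right) \<alpha> where "same_vars \<alpha>" "R = Rule {#} ({#} \<Rrightarrow> fms \<alpha>)"
    | (left) \<beta> where "same_vars \<beta>" "R = Rule {#} (fms \<beta> \<Rrightarrow> {#})"
    unfolding context_free_focused_axiom_def by blast
  then show ?thesis
  proof cases
    case id
    then have i: "inst \<sigma> \<gamma> (concl R) = ({#subst \<sigma> \<phi>#} \<Rrightarrow> {#subst \<sigma> \<phi>#})" by (simp add: inst_def)
    then have "over L (subst \<sigma> \<phi>)" using provable_overD[OF calc] pr by fastforce
    from interpolable_mono[OF interpolable_identity[OF this]] show ?thesis
      using wt unfolding i by simp
  next
    case right
    then have i: "inst \<sigma> \<gamma> (concl R) = ({#} \<Rrightarrow> ?s \<alpha>)" by (simp add: inst_def)
    have "interpolable ({#} \<Rrightarrow> ?s \<alpha>) (16 + 4 * wt (?s \<alpha>))"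
      by (rule interpolable_right_axiom) (use pr i in simp, rule same_vars_subst[OF right(1)])
    from interpolable_mono[OF this] show ?thesis using wt unfolding i by simp
  next
    case left
    then have i: "inst \<sigma> \<gamma> (concl R) = (?s \<beta> \<Rrightarrow> {#})" by (simp add: inst_def)
    have "interpolable (?s \<beta> \<Rrightarrow> {#}) (16 + 4 * wt (?s \<beta>))"
      by (rule interpolable_left_axiom) (use pr i in simp, rule same_vars_subst[OF left(1)])
    from interpolable_mono[OF this] show ?thesis using wt unfolding i by simp
  qed
qed

lemma axiom_interpolable:
  assumes R: "R \<in> H" and ax: "focused_axiom R" and hb: has_bounds
    and \<sigma>: "\<And>x. over L (\<sigma> x)" and \<gamma>: "\<And>i. mover L (\<gamma> i)"
    and ad: "admitted m (inst \<sigma> \<gamma> (concl R))"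
  shows "interpolable (inst \<sigma> \<gamma> (concl R)) (28 + 4 * length (enc_seq (inst \<sigma> \<gamma> (concl R))))"
proof -
  note wt = wt_le_enc_seq[of "inst \<sigma> \<gamma> (concl R)"]
  have no: "prems R = {#}" using ax by (auto simp: focused_axiom_def context_free_focused_axiom_def)
  \<comment> \<open>All choices of contexts are needed, because \<open>Top\<close> and
    \<open>Bot\<close> end up inside the contexts of the axiom.\<close>
  have pr: "provable m L H (inst \<sigma> \<gamma>' (concl R))"
    if "\<And>i. mover L (\<gamma>' i)" "admitted m (inst \<sigma> \<gamma>' (concl R))" for \<gamma>'
    by (rule provable_rule[OF R \<sigma> that(1) _ that(2)]) (simp add: no)
  have ov: "mover L (ante (inst \<sigma> \<gamma> (concl R)) + succ (inst \<sigma> \<gamma> (concl R)))"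
    by (rule provable_over[OF calc pr[OF \<gamma> ad]])
  let ?s = "image_mset (subst \<sigma>)"
  from ax consider (free) "context_free_focused_axiom R"
    | (left) g d \<phi> where "g \<noteq> d" "same_vars \<phi>" "R = Rule {#} (add_mset (Ctx g) (fms \<phi>) \<Rrightarrow> {#Ctx d#})"
    | (right) g d \<phi> where "g \<noteq> d" "same_vars \<phi>" "R = Rule {#} ({#Ctx g#} \<Rrightarrow> add_mset (Ctx d) (fms \<phi>))"
    unfolding focused_axiom_def by blast
  then show ?thesis
  proof cases
    case free
    then show ?thesis by (rule context_free_axiom_interpolable[OF R _ \<sigma> \<gamma> ad])
  next
    case left
    have i: "inst \<sigma> \<gamma>' (concl R) = (?s \<phi> + \<gamma>' g \<Rrightarrow> \<gamma>' d)" for \<gamma>'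
      using left by (simp add: inst_def add.commute)
    have "interpolable (?s \<phi> + \<gamma> g \<Rrightarrow> \<gamma> d) (20 + 4 * wt (?s \<phi>))"
    proof (rule interpolable_left_axiom_context[OF _ _ hb])
      fix \<Gamma> \<Delta> assume "mover L \<Gamma>" "mover L \<Delta>" "m = Single \<Longrightarrow> size \<Delta> \<le> 1"
      then show "provable m L H (?s \<phi> + \<Gamma> \<Rrightarrow> \<Delta>)"
        using pr[of "\<lambda>i. if i = g then \<Gamma> else \<Delta>"] left(1) unfolding i admitted_iff by auto
    next
      fix A B assume "A \<in># ?s \<phi>" "B \<in># ?s \<phi>"
      then show "vars A = vars B" by (rule same_vars_subst[OF left(2)])
    qed (use ov ad in \<open>simp_all add: i admitted_iff\<close>)
    from interpolable_mono[OF this] show ?thesis using wt unfolding i by simp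
  next
    case right
    have i: "inst \<sigma> \<gamma>' (concl R) = (\<gamma>' g \<Rrightarrow> ?s \<phi> + \<gamma>' d)" for \<gamma>'
      using right by (simp add: inst_def add.commute)
    have "interpolable (\<gamma> g \<Rrightarrow> ?s \<phi> + \<gamma> d) (20 + 4 * wt (?s \<phi>))"
    proof (rule interpolable_right_axiom_context[OF _ _ hb])
      fix \<Gamma> \<Delta> assume "mover L \<Gamma>" "mover L \<Delta>" "m = Single \<Longrightarrow> size (?s \<phi> + \<Delta>) \<le> 1"
      then show "provable m L H (\<Gamma> \<Rrightarrow> ?s \<phi> + \<Delta>)"
        using pr[of "\<lambda>i. if i = g then \<Gamma> else \<Delta>"] right(1) unfolding i admitted_iff by auto
    next
      fix A B assume "A \<in># ?s \<phi>" "B \<in># ?s \<phi>"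
      then show "vars A = vars B" by (rule same_vars_subst[OF right(2)])
    qed (use ov ad in \<open>simp_all add: i admitted_iff\<close>)
    from interpolable_mono[OF this] show ?thesis using wt unfolding i by simp
  qed
qed

section \<open>Modal rules of the calculus\<close>

lemma K_rule:
  assumes R: "R \<in> H" "rule_K R" and p: "provable m L H (\<Gamma> \<Rrightarrow> {#A#})"
  shows "provable m L H (image_mset Box \<Gamma> \<Rrightarrow> {#Box A#})"
proof -
  from R(2) obtain g x where r: "R = Rule {#{#Ctx g#} \<Rrightarrow> {#Fm (Leaf (FVar x))#}#}
       ({#BCtx g#} \<Rrightarrow> {#Fm (Box (Leaf (FVar x)))#})"
    unfolding rule_K_def by blast
  show ?thesis
    using provable_rule[OF R(1), of L "\<lambda>_. A" "\<lambda>_. \<Gamma>" m] p provable_overD[OF calc p]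
    by (simp add: r inst_def admitted_iff)
qed

lemma D_rule:
  assumes R: "R \<in> H" "rule_D R" and p: "provable m L H (\<Gamma> \<Rrightarrow> {#})"
  shows "provable m L H (image_mset Box \<Gamma> \<Rrightarrow> {#})"
proof -
  from R(2) obtain g where r: "R = Rule {#{#Ctx g#} \<Rrightarrow> {#}#} ({#BCtx g#} \<Rrightarrow> {#})"
    unfolding rule_D_def by blast
  show ?thesis
    using provable_rule[OF R(1), of L "\<lambda>_. One" "\<lambda>_. \<Gamma>" m] p provable_overD[OF calc p]
    by (simp add: r inst_def admitted_iff)
qed

lemma RS4_rule:
  assumes R: "R \<in> H" "rule_RS4 R" and p: "provable m L H (image_mset Box \<Gamma> \<Rrightarrow> {#A#})"
  shows "provable m L H (image_mset Box \<Gamma> \<Rrightarrow> {#Box A#})"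
proof -
  from R(2) obtain g x where r: "R = Rule {#{#BCtx g#} \<Rrightarrow> {#Fm (Leaf (FVar x))#}#}
       ({#BCtx g#} \<Rrightarrow> {#Fm (Box (Leaf (FVar x)))#})"
    unfolding rule_RS4_def by blast
  show ?thesis
    using provable_rule[OF R(1), of L "\<lambda>_. A" "\<lambda>_. \<Gamma>" m] p provable_overD[OF calc p]
    by (simp add: r inst_def admitted_iff)
qed

lemma LS4_rule:
  assumes R: "R \<in> H" "rule_LS4 R" and p: "provable m L H (add_mset A \<Gamma> \<Rrightarrow> \<Delta>)"
  shows "provable m L H (add_mset (Box A) \<Gamma> \<Rrightarrow> \<Delta>)"
proof -
  from R(2) obtain g d x where r: "g \<noteq> d" "R = Rule {#{#Ctx g, Fm (Leaf (FVar x))#} \<Rrightarrow> {#Ctx d#}#}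
       ({#Ctx g, Fm (Box (Leaf (FVar x)))#} \<Rrightarrow> {#Ctx d#})"
    unfolding rule_LS4_def by blast
  show ?thesis
    using provable_rule[OF R(1), of L "\<lambda>_. A" "\<lambda>i. if i = g then \<Gamma> else \<Delta>" m] p
      provable_overD[OF calc p] provable_admitted[OF p] r(1)
    by (simp add: r(2) inst_def admitted_iff)
qed

lemma modal_interpolable:
  assumes R: "R \<in> H" and mr: "modal_semi_analytic R"
    and IH: "\<And>S. S \<in># prems R \<Longrightarrow> interpolable (inst \<sigma> \<gamma> S) (c (inst \<sigma> \<gamma> S))"
  shows "interpolable (inst \<sigma> \<gamma> (concl R)) (28 + (\<Sum>S \<in># prems R. c (inst \<sigma> \<gamma> S)))"
proof -
  \<comment> \<open>Each modal rule has a boxed context in its conclusion, so the language contains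
    \<open>Box\<close> and the boxed interpolants belong to it.\<close>
  have ov: "mseq_over L (concl R)" using calc R by (auto simp: calculus_over_def)
  from mr consider (K) "rule_K R" | (D) "rule_D R" | (S4) "rule_RS4 R"
    unfolding modal_semi_analytic_def by blast
  then show ?thesis
  proof cases
    case K
    then obtain g x where r: "R = Rule {#{#Ctx g#} \<Rrightarrow> {#Fm (Leaf (FVar x))#}#}
       ({#BCtx g#} \<Rrightarrow> {#Fm (Box (Leaf (FVar x)))#})"
      unfolding rule_K_def by blast
    have "interpolable (image_mset Box (\<gamma> g) \<Rrightarrow> image_mset Box {#\<sigma> x#}) (c (\<gamma> g \<Rrightarrow> {#\<sigma> x#}) + 12)"
      by (rule interpolable_K) (use K_rule[OF R K] IH ov in \<open>simp_all add: r inst_def mseq_over_def\<close>)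
    then show ?thesis by (simp add: r inst_def interpolable_mono)
  next
    case D
    then obtain g where r: "R = Rule {#{#Ctx g#} \<Rrightarrow> {#}#} ({#BCtx g#} \<Rrightarrow> {#})"
      unfolding rule_D_def by blast
    \<comment> \<open>\<open>K\<close> boxes the half whose succedent is the interpolant, the rule
      itself the half with an empty succedent.\<close>
    from D R modal obtain R' where R': "R' \<in> H" "rule_K R'" unfolding modal_condition_def by blast
    have "interpolable (image_mset Box (\<gamma> g) \<Rrightarrow> image_mset Box {#}) (c (\<gamma> g \<Rrightarrow> {#}) + 12)"
      by (rule interpolable_K)
        (use K_rule[OF R'] D_rule[OF R D] IH ov in \<open>simp_all add: r inst_def mseq_over_def\<close>)
    then show ?thesis by (simp add: r inst_def interpolable_mono)
  next
    case S4
    then obtain g x where r: "R = Rule {#{#BCtx g#} \<Rrightarrow> {#Fm (Leaf (FVar x))#}#}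
       ({#BCtx g#} \<Rrightarrow> {#Fm (Box (Leaf (FVar x)))#})"
      unfolding rule_RS4_def by blast
    from S4 R modal obtain R' where R': "R' \<in> H" "rule_LS4 R'" unfolding modal_condition_def by blast
    have "interpolable (image_mset Box (\<gamma> g) \<Rrightarrow> {#Box (\<sigma> x)#}) (c (image_mset Box (\<gamma> g) \<Rrightarrow> {#\<sigma> x#}) + 12)"
      by (rule interpolable_RS4)
        (use LS4_rule[OF R'] RS4_rule[OF R S4] IH ov in \<open>simp_all add: r inst_def mseq_over_def\<close>)
    then show ?thesis by (simp add: r inst_def interpolable_mono)
  qed
qed

section \<open>Induction on proofs and the polynomial bound\<close>

text \<open>Couples each rule format with the resources its interpolation needs. The hypotheses of
  all cases of the theorem imply it, so that one induction is enough.\<close>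

definition treatable :: "rule \<Rightarrow> bool" where
  "treatable R \<longleftrightarrow>
     semi_analytic m R \<and> (has_bounds \<or> contexts_in_premises R) \<or>
     context_sharing_semi_analytic R \<and> m = Single \<and> structural \<and> has_bounds \<or>
     context_free_focused_axiom R \<or> focused_axiom R \<and> has_bounds"

lemma rule_interpolable:
  assumes R: "R \<in> H" and tr: "treatable R"
    and \<sigma>: "\<And>x. over L (\<sigma> x)" and \<gamma>: "\<And>i. mover L (\<gamma> i)"
    and IH: "\<And>S. S \<in># prems R \<Longrightarrow> interpolable (inst \<sigma> \<gamma> S) (c (inst \<sigma> \<gamma> S))"
    and ad: "admitted m (inst \<sigma> \<gamma> (concl R))"
  shows "interpolable (inst \<sigma> \<gamma> (concl R))
    (28 + 4 * length (enc_seq (inst \<sigma> \<gamma> (concl R))) + (\<Sum>S \<in># prems R. c (inst \<sigma> \<gamma> S)))"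
proof -
  let ?c = "\<Sum>S \<in># prems R. c (inst \<sigma> \<gamma> S)"
  have block: "interpolable (inst \<sigma> \<gamma> (concl R)) (28 + ?c)"
    if "semi_analytic m R" "\<not> modal_semi_analytic R" and bnd: "has_bounds \<or> contexts_in_premises R"
  proof (cases m)
    case Single
    with that consider "left_semi_analytic R" | "right_semi_analytic R" by (auto simp: semi_analytic_def)
    then show ?thesis
    proof cases
      case 1
      then obtain Bs \<chi> where B: "R = block_rule Bs {#\<chi>#} {#}" "block_contexts Bs" "block_vars Bs \<chi>"
        "\<And>g ds Fs \<phi> \<psi>. (g, ds, Fs) \<in> set Bs \<Longrightarrow> ds \<noteq> [] \<Longrightarrow> (\<phi>, \<psi>) \<in> set Fs \<Longrightarrow> \<psi> = {#}"
        by (rule left_semi_analytic_block) blast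
      show ?thesis unfolding B(1)
        by (rule block_interpolable[OF _ B(2,3)]) (use R bnd \<sigma> \<gamma> IH ad B(4) in \<open>simp_all add: B(1)\<close>)
    next
      case 2
      then obtain Bs \<chi> where B: "R = block_rule Bs {#} {#\<chi>#}" "block_contexts Bs" "block_vars Bs \<chi>"
        by (rule right_semi_analytic_block)
      show ?thesis unfolding B(1)
        by (rule block_interpolable[OF _ B(2,3)]) (use R bnd \<sigma> \<gamma> IH ad in \<open>simp_all add: B(1)\<close>)
    qed
  next
    case Multi
    with that have "multi_left_semi_analytic R \<or> multi_right_semi_analytic R" by (auto simp: semi_analytic_def)
    then obtain Bs \<mu> \<nu> \<chi> where B: "R = block_rule Bs \<mu> \<nu>" "\<mu> + \<nu> = {#\<chi>#}" "block_contexts Bs" "block_vars Bs \<chi>"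
      by (rule multi_semi_analytic_block)
    show ?thesis unfolding B(1)
      by (rule block_interpolable[OF _ B(3,4,2)]) (use R bnd \<sigma> \<gamma> IH ad Multi in \<open>simp_all add: B(1)\<close>)
  qed
  from tr consider "semi_analytic m R" "\<not> modal_semi_analytic R" "has_bounds \<or> contexts_in_premises R"
    | "modal_semi_analytic R"
    | "context_sharing_semi_analytic R" "m = Single" "structural" "has_bounds"
    | "context_free_focused_axiom R" | "focused_axiom R" "has_bounds"
    unfolding treatable_def by blast
  then show ?thesis
  proof cases
    case 1
    from interpolable_mono[OF block[OF this]] show ?thesis by simp
  next
    case 2
    from interpolable_mono[OF modal_interpolable[OF R 2 IH]] show ?thesis by simp
  next
    case 3
    from interpolable_mono[OF context_sharing_interpolable[OF R 3(1,3,4,2) \<sigma> \<gamma> IH ad]] show ?thesis by simp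
  next
    case 4
    from interpolable_mono[OF context_free_axiom_interpolable[OF R 4 \<sigma> \<gamma> ad]] show ?thesis by simp
  next
    case 5
    from interpolable_mono[OF axiom_interpolable[OF R 5 \<sigma> \<gamma> ad]] show ?thesis by simp
  qed
qed

lemma proof_interpolable:
  assumes "is_proof m L H \<pi>" and tr: "\<And>R. R \<in> H \<Longrightarrow> treatable R"
  shows "interpolable (root \<pi>) (20 * length (enc_proof \<pi>))"
  using assms(1)
proof (induction rule: is_proof.induct)
  case (1 R \<sigma> \<gamma> ts S)
  let ?N = "\<lambda>t. 20 * length (enc_proof t)"
  \<comment> \<open>Premises are charged by sequent, but equal premises may have different
    subproofs. Taking the cheapest one makes the cost a function of the sequent that is bounded by
    the cost of every such subproof.\<close>
  define c where "c S = (LEAST n. \<exists>t \<in> set ts. root t = S \<and> n = ?N t)" for S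
  have IH: "\<And>t. t \<in> set ts \<Longrightarrow> interpolable (root t) (?N t)" using 1 by blast
  have c_le: "c (root t) \<le> ?N t" if "t \<in> set ts" for t
    unfolding c_def by (rule Least_le) (use that in blast)
  have c_itp: "interpolable T (c T)" if "T \<in> root ` set ts" for T
  proof -
    have "\<exists>n. \<exists>t \<in> set ts. root t = T \<and> n = ?N t" using that by blast
    from LeastI_ex[OF this] show ?thesis unfolding c_def[symmetric] using IH by metis
  qed
  have ms: "image_mset root (mset ts) = image_mset (inst \<sigma> \<gamma>) (prems R)" by fact
  have "interpolable (inst \<sigma> \<gamma> (concl R))
    (28 + 4 * length (enc_seq (inst \<sigma> \<gamma> (concl R))) + (\<Sum>T \<in># prems R. c (inst \<sigma> \<gamma> T)))"
  proof (rule rule_interpolable[OF 1(1) tr[OF 1(1)]])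
    fix T assume "T \<in># prems R"
    then have "inst \<sigma> \<gamma> T \<in># image_mset root (mset ts)" unfolding ms by simp
    then show "interpolable (inst \<sigma> \<gamma> T) (c (inst \<sigma> \<gamma> T))" by (intro c_itp) simp
  qed (use 1 in \<open>auto simp: mover_def\<close>)
  moreover have "(\<Sum>T \<in># prems R. c (inst \<sigma> \<gamma> T)) \<le> 20 * length (concat (map enc_proof ts))"
  proof -
    have "(\<Sum>T \<in># prems R. c (inst \<sigma> \<gamma> T)) = (\<Sum>T \<in># image_mset (inst \<sigma> \<gamma>) (prems R). c T)"
      by (simp add: image_mset.compositionality comp_def)
    also have "\<dots> = (\<Sum>t\<leftarrow>ts. c (root t))"
      unfolding ms[symmetric] by (simp add: image_mset.compositionality comp_def flip: sum_mset_sum_list)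
    also have "\<dots> \<le> (\<Sum>t\<leftarrow>ts. ?N t)" by (rule sum_list_mono) (rule c_le)
    also have "\<dots> = 20 * length (concat (map enc_proof ts))"
      by (simp add: length_concat comp_def sum_list_const_mult)
    finally show ?thesis .
  qed
  \<comment> \<open>The code of a sequent contains two numbers and so has length \<open>l\<close> at
    least 2; therefore 28 plus \<open>4 * l\<close> is at most \<open>20 * l\<close>, the origin of
    the factor 20.\<close>
  moreover have "length (enc_nat n) \<ge> 1" for n by (subst enc_nat.simps) simp
  then have "length (enc_seq S) \<ge> 2"
    unfolding enc_seq_def enc_mset_def length_append
    by (metis add_mono le_add1 one_add_one order_trans)
  ultimately show ?case using 1(5) by (auto elim!: interpolable_mono)
qed

lemma feasible_interpolation:
  assumes "\<And>R. R \<in> H \<Longrightarrow> treatable R"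
  shows "feasible_interpolation m L H H"
  unfolding feasible_interpolation_def
proof (intro exI[of _ 4] allI impI, elim conjE)
  fix \<pi> \<Sigma> \<Lambda> \<Delta> assume p: "is_proof m L H \<pi>" "root \<pi> = (\<Sigma> + \<Lambda> \<Rrightarrow> \<Delta>)"
  let ?N = "length (enc_proof \<pi>)"
  have "itp \<Sigma> {#} \<Lambda> \<Delta> (20 * ?N)"
    using proof_interpolable[OF p(1) assms] p(2) unfolding interpolable_def by simp
  then obtain C where C: "over L C" "provable m L H (\<Sigma> \<Rrightarrow> {#C#})" "provable m L H (add_mset C \<Lambda> \<Rrightarrow> \<Delta>)"
    "vars C \<subseteq> mvars \<Sigma> \<inter> mvars (\<Lambda> + \<Delta>)" "length (enc_fm C) + 8 \<le> 20 * ?N"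
    unfolding itp_def by auto
  have 1: "length (enc_nat n) \<ge> 1" for n by (subst enc_nat.simps) simp
  have "?N \<ge> 3"
    using 1[of "size (ante (root \<pi>))"] 1[of "size (succ (root \<pi>))"] 1[of "length (subproofs \<pi>)"]
    by (cases \<pi>) (simp add: enc_seq_def enc_mset_def)
  \<comment> \<open>The root sequent contributes two numbers and the list of subproofs one, so the
    length is at least 3. The exponent 4 then absorbs the factor 20, which is below 27.\<close>
  then have "3 ^ 3 * ?N \<le> ?N ^ 3 * ?N" by (intro mult_right_mono power_mono) simp_all
  also have "\<dots> = ?N ^ 4" by (simp add: eval_nat_numeral)
  finally have "length (enc_fm C) \<le> ?N ^ 4" using C(5) by simp
  with C show "\<exists>C. over L C \<and> provable m L H (\<Sigma> \<Rrightarrow> {#C#}) \<and> provable m L H (add_mset C \<Lambda> \<Rrightarrow> \<Delta>) \<and>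
    vars C \<subseteq> mvars \<Sigma> \<inter> mvars (\<Lambda> + \<Delta>) \<and> length (enc_fm C) \<le> ?N ^ 4" by blast
qed

end

text \<open>For the abstract argument the bases differ only in the mode, in the operations taken for
  \<open>fuse\<close>, \<open>unit\<close>, \<open>zero\<close>, and in whether
  \<open>has_bounds\<close> and \<open>structural\<close> are available; the latter two decide which
  rule formats are \<open>treatable\<close>.\<close>

theorem theorem4p6:
  fixes L :: language and H :: calculus
  assumes "calculus_over L H" and "modal_condition H"
  shows
    "(extends Single L H FLe \<longrightarrow>
        (\<forall>R\<in>H. semi_analytic Single R \<or> focused_axiom R) \<longrightarrow>
        feasible_interpolation Single L H H)
     \<and>
     (extends Single L H FLe_minus \<longrightarrow>
        (\<forall>R\<in>H. semi_analytic Single R \<and> contexts_in_premises R \<or> context_free_focused_axiom R) \<longrightarrow>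
        feasible_interpolation Single L H H)
     \<and>
     (extends Single L H IPC \<longrightarrow>
        (\<forall>R\<in>H. semi_analytic Single R \<or> context_sharing_semi_analytic R \<or> focused_axiom R) \<longrightarrow>
        feasible_interpolation Single L H H)
     \<and>
     (PlusC \<in> L \<longrightarrow> extends Multi L H CFLe \<longrightarrow>
        (\<forall>R\<in>H. semi_analytic Multi R \<or> focused_axiom R) \<longrightarrow>
        feasible_interpolation Multi L H H)
     \<and>
     (PlusC \<in> L \<longrightarrow> extends Multi L H CFLe_minus \<longrightarrow>
        (\<forall>R\<in>H. semi_analytic Multi R \<and> contexts_in_premises R \<or> context_free_focused_axiom R) \<longrightarrow>
        feasible_interpolation Multi L H H)"
proof (intro conjI impI)
  assume ext: "extends Single L H FLe"
    and H: "\<forall>R\<in>H. semi_analytic Single R \<or> focused_axiom R"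
  interpret E: FLe_bounded_extension L H FLe
    by unfold_locales (use assms ext in \<open>auto simp: FLe_def FLe_minus_def\<close>)
  interpret semi_analytic_calculus Single L H Fusion One Zero
    by (intro semi_analytic_calculus.intro semi_analytic_calculus_axioms.intro E.interpolation_calculus assms)
  show "feasible_interpolation Single L H H"
    by (rule feasible_interpolation) (use H E.has_bounds in \<open>auto simp: treatable_def\<close>)
next
  assume ext: "extends Single L H FLe_minus"
    and H: "\<forall>R\<in>H. semi_analytic Single R \<and> contexts_in_premises R \<or> context_free_focused_axiom R"
  interpret E: FLe_extension L H FLe_minus
    by unfold_locales (use assms ext in \<open>auto simp: FLe_minus_def\<close>)
  interpret semi_analytic_calculus Single L H Fusion One Zero
    by (intro semi_analytic_calculus.intro semi_analytic_calculus_axioms.intro E.interpolation_calculus assms)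
  show "feasible_interpolation Single L H H"
    by (rule feasible_interpolation) (use H in \<open>auto simp: treatable_def\<close>)
next
  assume ext: "extends Single L H IPC"
    and H: "\<forall>R\<in>H. semi_analytic Single R \<or> context_sharing_semi_analytic R \<or> focused_axiom R"
  interpret E: IPC_extension L H IPC
    by unfold_locales (use assms ext in \<open>auto simp: IPC_def\<close>)
  interpret semi_analytic_calculus Single L H And Top Bot
    by (intro semi_analytic_calculus.intro semi_analytic_calculus_axioms.intro E.interpolation_calculus assms)
  show "feasible_interpolation Single L H H"
    by (rule feasible_interpolation) (use H E.has_bounds E.structural in \<open>auto simp: treatable_def\<close>)
next
  assume ext: "extends Multi L H CFLe"
    and H: "\<forall>R\<in>H. semi_analytic Multi R \<or> focused_axiom R"
  interpret E: CFLe_bounded_extension L H CFLe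
    by unfold_locales (use assms ext in \<open>auto simp: CFLe_def\<close>)
  interpret semi_analytic_calculus Multi L H Fusion One Zero
    by (intro semi_analytic_calculus.intro semi_analytic_calculus_axioms.intro E.interpolation_calculus assms)
  show "feasible_interpolation Multi L H H"
    by (rule feasible_interpolation) (use H E.has_bounds in \<open>auto simp: treatable_def\<close>)
next
  assume ext: "extends Multi L H CFLe_minus"
    and H: "\<forall>R\<in>H. semi_analytic Multi R \<and> contexts_in_premises R \<or> context_free_focused_axiom R"
  interpret E: CFLe_extension L H CFLe_minus
    by unfold_locales (use assms ext in \<open>auto simp: CFLe_minus_def\<close>)
  interpret semi_analytic_calculus Multi L H Fusion One Zero
    by (intro semi_analytic_calculus.intro semi_analytic_calculus_axioms.intro E.interpolation_calculus assms)
  show "feasible_interpolation Multi L H H"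
    by (rule feasible_interpolation) (use H in \<open>auto simp: treatable_def\<close>)
qed

end
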